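(* Let $d>1$ be an integer and $\mu\ge0$. There exists a constant $c^\diamond>0$ (depending only on $d$) such that for any integer $n\ge1$ and any set $\mathcal{X}_\varepsilon$ of almost uniformly $\varepsilon$-distributed points on $B^d$ with $\varepsilon:=c^\diamond/n$, there exist positive coefficients $\{\lambda_\xi\}_{\xi\in\mathcal{X}_\varepsilon}$ such that the cubature formula $$ \int_{B^d}f(x)W_\mu(x)\,dx\sim\sum_{\xi\in\mathcal{X}_\varepsilon}\lambda_\xi f(\xi) $$ is exact for all polynomials of degree $\le n$ (that is, both sides are equal for every $f\in\Pi_n^d$). In addition, for $\xi\in\mathcal{X}_\varepsilon$, $$ \lambda_\xi\sim n^{-d}\mathcal{W}_\mu(n;\xi)\sim\varepsilon^d(1-|\xi|^2)^\mu\sim m_\mu(B_\xi(\varepsilon)) $$ with constants of equivalence depending only on $\mu$ and $d$.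
   Context: $B^d$ is the closed unit ball of $\mathbb{R}^d$, $|\cdot|$ the Euclidean norm, $W_\mu(x)=(1-|x|^2)^{\mu-1/2}$, $\Pi_n^d$ the polynomials of total degree at most $n$ in $d$ variables. $d(x,y)=\arccos\{\langle x,y\rangle+\sqrt{1-|x|^2}\sqrt{1-|y|^2}\}$ is the distance on $B^d$, $B_\xi(r)=\{x\in B^d:d(x,\xi)\le r\}$, $\mathcal{W}_\mu(n;x)=(\sqrt{1-|x|^2}+n^{-1})^{2\mu}$, and $m_\mu(E)=\int_EW_\mu(x)\,dx$. In the cubature formula $\sim$ indicates the approximation of the integral by the sum; for positive quantities, $A\sim B$ means $c_1A\le B\le c_2A$ with positive constants $c_1,c_2$ (the constants of equivalence). Spherical simplices and centers: let $S^d_+=\{z\in\mathbb{R}^{d+1}:|z|=1,\ z_{d+1}\ge0\}$, projected onto $B^d$ by dropping the last coordinate. For a sign vector $s\in\{-1,1\}^{d+1}$ with $s_{d+1}=1$, let $w_1,\dots,w_{d+1}$ be linearly independent points of $\{z\in\mathbb{R}^{d+1}:s_iz_i\ge0\ \forall i,\ \sum_is_iz_i=1\}$; the corresponding spherical simplex is $\{z/|z|: z\in\operatorname{conv}(w_1,\dots,w_{d+1})\}\subset S^d_+$, and its center is $w/|w|$ with $w=\frac1{d+1}\sum_iw_i$. The center of the projection of a spherical simplex onto $B^d$ is the projection of its center. Almost uniformly $\varepsilon$-distributed points ($0<\varepsilon\le\pi$): a set $\mathcal{X}_\varepsilon\subset B^d$ for which there is an associated partition $\mathcal{R}_\varepsilon$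 of $B^d$ consisting of projections onto $B^d$ of spherical simplices, $\mathcal{X}_\varepsilon$ being the set of their centers, such that (i) $B^d=\bigcup_{R\in\mathcal{R}_\varepsilon}R$ and the sets in $\mathcal{R}_\varepsilon$ do not overlap (distinct members have disjoint interiors); (ii) for each $R\in\mathcal{R}_\varepsilon$ there is a unique $\xi\in\mathcal{X}_\varepsilon$ with $B_\xi(c^*\varepsilon)\subset R\subset B_\xi(\varepsilon)$; (iii) $\#\mathcal{X}_\varepsilon=\#\mathcal{R}_\varepsilon\le c^{**}\varepsilon^{-d}$. Here $c^*,c^{**}>0$ are fixed constants depending only on $d$, such that sets with these properties exist for every $0<\varepsilon\le\pi$.
   Formalization: The constant c^⋄ is allowed to depend on μ as well as d: no c^⋄ depending only on d serves all μ≥0, since for fixed points (all nonzero) exactness on 1 and |x|^2 with positive weights fails as μ→∞. *)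

theory Defs
  imports "HOL-Analysis.Analysis"
begin

(* Throughout, R^d is real^'d with d = CARD('d), and R^(d+1) is the product (real^'d) \<times> real,
   whose norm is the Euclidean one; the snd component is the coordinate z_(d+1), so that
   dropping the last coordinate is fst.  B^d is cball 0 1. *)

(* The value at |x| = 1 is 0 (as 0 powr a = 0); this only concerns a null set. *)
definition W :: "real \<Rightarrow> real^'d \<Rightarrow> real" where
  "W \<mu> x = (1 - (norm x)\<^sup>2) powr (\<mu> - 1/2)"

definition W_n :: "real \<Rightarrow> nat \<Rightarrow> real^'d \<Rightarrow> real" where
  "W_n \<mu> n x = (sqrt (1 - (norm x)\<^sup>2) + 1 / real n) powr (2 * \<mu>)"

definition m_weight :: "real \<Rightarrow> (real^'d) set \<Rightarrow> real" where
  "m_weight \<mu> E = (LINT x:E|lborel. W \<mu> x)"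

definition ball_dist :: "real^'d \<Rightarrow> real^'d \<Rightarrow> real" where
  "ball_dist x y = arccos (x \<bullet> y + sqrt (1 - (norm x)\<^sup>2) * sqrt (1 - (norm y)\<^sup>2))"

definition dball :: "real^'d \<Rightarrow> real \<Rightarrow> (real^'d) set" where
  "dball \<xi> r = {x \<in> cball 0 1. ball_dist x \<xi> \<le> r}"

(* Polynomial functions of total degree at most n.  The sum is over a finite set of
   multi-indices, since 'd is finite. *)
definition Poly_le :: "nat \<Rightarrow> (real^'d \<Rightarrow> real) set" where
  "Poly_le n = {f. \<exists>a :: ('d \<Rightarrow> nat) \<Rightarrow> real.
     f = (\<lambda>x. \<Sum>\<alpha> | (\<Sum>i\<in>UNIV. \<alpha> i) \<le> n. a \<alpha> * (\<Prod>i\<in>UNIV. (x $ i) ^ \<alpha> i))}"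

(* The sign vector s is given by its first d entries; the last entry is 1. *)
definition orthant_face :: "real^'d \<Rightarrow> ((real^'d) \<times> real) set" where
  "orthant_face s = {z. (\<forall>i. s $ i * fst z $ i \<ge> 0) \<and> snd z \<ge> 0 \<and>
     (\<Sum>i\<in>UNIV. s $ i * fst z $ i) + snd z = 1}"

(* V is the set {w_1, ..., w_(d+1)}. *)
definition simplex_vertices :: "((real^'d) \<times> real) set \<Rightarrow> bool" where
  "simplex_vertices V \<longleftrightarrow>
     (\<exists>s. (\<forall>i. s $ i = 1 \<or> s $ i = -1) \<and> V \<subseteq> orthant_face s) \<and>
     card V = CARD('d) + 1 \<and> independent V"

definition spherical_simplex :: "((real^'d) \<times> real) set \<Rightarrow> ((real^'d) \<times> real) set" where
  "spherical_simplex V = (\<lambda>z. z /\<^sub>R norm z) ` (convex hull V)"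

definition simplex_center :: "((real^'d) \<times> real) set \<Rightarrow> (real^'d) \<times> real" where
  "simplex_center V =
     (let w = (1 / real (CARD('d) + 1)) *\<^sub>R (\<Sum>v\<in>V. v) in w /\<^sub>R norm w)"

(* X is the set of projected centers of the members of RR.  A member R determines its
   vertex set V (the w_i span its extreme rays,
   and by independence they fix the sign vector), so taking the center of every V that
   represents R gives exactly one center for each R. *)
definition associated_partition ::
  "real \<Rightarrow> real \<Rightarrow> real \<Rightarrow> (real^'d) set \<Rightarrow> (real^'d) set set \<Rightarrow> bool" where
  "associated_partition cs css \<epsilon> X RR \<longleftrightarrow>
     (\<forall>R\<in>RR. \<exists>V. simplex_vertices V \<and> R = fst ` spherical_simplex V) \<and>
     X = {fst (simplex_center V) | V. simplex_vertices V \<and> fst ` spherical_simplex V \<in> RR} \<and>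
     \<Union>RR = cball 0 1 \<and>
     pairwise (\<lambda>R S. interior R \<inter> interior S = {}) RR \<and>
     (\<forall>R\<in>RR. \<exists>!\<xi>. \<xi> \<in> X \<and> dball \<xi> (cs * \<epsilon>) \<subseteq> R \<and> R \<subseteq> dball \<xi> \<epsilon>) \<and>
     finite RR \<and> finite X \<and> card X = card RR \<and> real (card RR) \<le> css * (1 / \<epsilon>) ^ CARD('d)"

definition almost_uniform :: "real \<Rightarrow> real \<Rightarrow> real \<Rightarrow> (real^'d) set \<Rightarrow> bool" where
  "almost_uniform cs css \<epsilon> X \<longleftrightarrow>
     0 < \<epsilon> \<and> \<epsilon> \<le> pi \<and> (\<exists>RR. associated_partition cs css \<epsilon> X RR)"

definition equiv_with :: "real \<Rightarrow> real \<Rightarrow> real \<Rightarrow> real \<Rightarrow> bool" where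
  "equiv_with c1 c2 A B \<longleftrightarrow> c1 * A \<le> B \<and> B \<le> c2 * A"

end

theory Submission
  imports Defs "HOL-Complex_Analysis.Conformal_Mappings"
begin

text \<open>
  The ball is lifted to the upper hemisphere, where the distance of \<open>B\<^sup>d\<close> is the geodesic distance and
  \<open>W\<^sub>\<mu> dx\<close> becomes \<open>|z\<^sub>d\<^sub>+\<^sub>1|\<^bsup>2\<mu>\<^esup> d\<sigma>\<close>.  All constants come from three facts: Bernstein's inequality along great
  circles (Cauchy's estimate for the complex polynomial behind a trigonometric one), fast decaying powers
  of the Fejer kernel, and two-sided bounds for the mass of a cap.

  For a polynomial \<open>f\<close> of degree \<open>n\<close> and a point \<open>x\<^sub>0\<close>, let \<open>x\<^sub>1\<close> maximize \<open>|f(x)| (1 + n d(x\<^sub>0,x))\<^bsup>-s\<^esup>\<close>.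
  Multiplied by a kernel centred at \<open>x\<^sub>1\<close>, \<open>f\<close> has sup norm comparable to \<open>|f(x\<^sub>1)|\<close>, so Bernstein gives
  \<open>|f| \<ge> |f(x\<^sub>1)|/2\<close> on a cap of radius about \<open>1/n\<close> at \<open>x\<^sub>1\<close>.  This bounds the maximum, and the oscillation of
  \<open>f\<close> near \<open>x\<^sub>0\<close>, by a weighted \<open>L\<^sup>1\<close> average of \<open>f\<close> with a fast decaying kernel; summing over the cells of the
  partition yields a Marcinkiewicz-Zygmund inequality in \<open>L\<^sup>1(W\<^sub>\<mu>)\<close>.  Hence the quadrature with weights
  \<open>m\<^sub>\<mu>(R\<^sub>\<xi>)\<close> is nearly exact, and minimizing the squared residual of the moment equations over all weights
  between \<open>1/2\<close> and \<open>3/2\<close> times \<open>m\<^sub>\<mu>(R\<^sub>\<xi>)\<close> makes it exact.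
\<close>

section \<open>Polynomials on the sphere and Bernstein's inequality\<close>

text \<open>Near the boundary \<open>W\<close> may blow up or vanish, so its point values say
  nothing about the mass of a small cell. The stable quantity at scale \<open>1/n\<close> is
  \<open>(rho x + 1/n) powr (2 * \<mu>)\<close>, and every estimate uses only its polynomial growth
  in \<open>1 + n * chord\<close>. The damping exponent \<open>s\<close> must pay for this growth
  three times (from \<open>x0\<close> to the maximum point, from a cell to the integration variable,
  and in the masses of large caps) and still leave \<open>d + 2\<close> powers for a convergent sum
  over annuli; this gives \<open>s = d + 3 * wexp \<mu> + 2\<close>. The term
  \<open>\<epsilon>^d * (1 - |\<xi>|^2) powr \<mu>\<close> carries no \<open>1/n\<close>, and its
  equivalence would fail at an arbitrary point of a cell near the boundary. It holds because the
  centre of a spherical simplex is never much lower than the other points of the simplex, so it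
  stays at height of order \<open>\<epsilon>\<close>. Solving the moment equations directly could
  destroy positivity. The near-exactness has the form
  \<open>integral f \<le> sum a f + (sum a |f|) / 2\<close>, and the right side is the largest value
  of \<open>sum l f\<close> over \<open>a/2 \<le> l \<le> 3a/2\<close>: this is the solvability
  criterion for the box.\<close>

inductive pdeg :: "nat \<Rightarrow> ('a::real_inner \<Rightarrow> real) \<Rightarrow> bool" where
  pdeg_const: "pdeg n (\<lambda>_. c)"
| pdeg_inner_mult: "pdeg n f \<Longrightarrow> pdeg (Suc n) (\<lambda>x. (x \<bullet> v) * f x)"
| pdeg_add: "pdeg n f \<Longrightarrow> pdeg n g \<Longrightarrow> pdeg n (\<lambda>x. f x + g x)"

lemma pdeg_mono: "pdeg m f \<Longrightarrow> m \<le> n \<Longrightarrow> pdeg n f"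
proof (induction arbitrary: n rule: pdeg.induct)
  case (pdeg_const k c)
  show ?case by (rule pdeg.pdeg_const)
next
  case (pdeg_inner_mult k f v)
  then obtain n' where n': "n = Suc n'" "k \<le> n'" by (cases n) auto
  show ?case unfolding n'(1) by (rule pdeg.pdeg_inner_mult[OF pdeg_inner_mult.IH[OF n'(2)]])
next
  case (pdeg_add k f g)
  show ?case by (rule pdeg.pdeg_add[OF pdeg_add.IH(1) pdeg_add.IH(2)]) fact+
qed

lemma pdeg_cmult: "pdeg n f \<Longrightarrow> pdeg n (\<lambda>x. c * f x)"
proof (induction rule: pdeg.induct)
  case (pdeg_const k c)
  show ?case by (rule pdeg.pdeg_const)
next
  case (pdeg_inner_mult n f v)
  show ?case using pdeg.pdeg_inner_mult[OF pdeg_inner_mult.IH, of v] by (simp add: mult.left_commute)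
next
  case (pdeg_add k f g)
  show ?case using pdeg.pdeg_add[OF pdeg_add.IH] by (simp add: distrib_left)
qed

lemma pdeg_mult: "pdeg m f \<Longrightarrow> pdeg n g \<Longrightarrow> pdeg (m + n) (\<lambda>x. f x * g x)"
proof (induction rule: pdeg.induct)
  case (pdeg_const k c)
  show ?case by (rule pdeg_cmult[OF pdeg_mono[OF pdeg_const]]) simp
next
  case (pdeg_inner_mult k f v)
  show ?case
    using pdeg.pdeg_inner_mult[OF pdeg_inner_mult.IH[OF pdeg_inner_mult.prems], of v] by (simp add: mult.assoc)
next
  case (pdeg_add k f h)
  show ?case using pdeg.pdeg_add[OF pdeg_add.IH[OF pdeg_add.prems]] by (simp add: distrib_right)
qed

lemma pdeg_power: "pdeg m f \<Longrightarrow> pdeg (k * m) (\<lambda>x. f x ^ k)"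
proof (induction k)
  case 0
  show ?case using pdeg_const[of 0 1] by simp
next
  case (Suc k)
  show ?case using pdeg_mult[OF Suc.prems Suc.IH[OF Suc.prems]] by simp
qed

lemma pdeg_sum: "finite I \<Longrightarrow> (\<And>i. i \<in> I \<Longrightarrow> pdeg n (f i)) \<Longrightarrow> pdeg n (\<lambda>x. \<Sum>i\<in>I. f i x)"
proof (induction I rule: finite_induct)
  case empty
  show ?case using pdeg_const[of n 0] by simp
next
  case (insert i I)
  show ?case using pdeg_add[of n "f i" "\<lambda>x. \<Sum>i\<in>I. f i x"] insert by simp
qed

lemma pdeg_prod:
  "finite I \<Longrightarrow> (\<And>i. i \<in> I \<Longrightarrow> pdeg (n i) (f i)) \<Longrightarrow> pdeg (\<Sum>i\<in>I. n i) (\<lambda>x. \<Prod>i\<in>I. f i x)"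
proof (induction I rule: finite_induct)
  case empty
  show ?case using pdeg_const[of 0 1] by simp
next
  case (insert i I)
  show ?case using pdeg_mult[of "n i" "f i" _ "\<lambda>x. \<Prod>i\<in>I. f i x"] insert by simp
qed

lemma pdeg_inner: "pdeg 1 (\<lambda>x. x \<bullet> v)"
  using pdeg_inner_mult[OF pdeg_const[of 0 1], of v] by simp

lemma pdeg_diff: "pdeg n f \<Longrightarrow> pdeg n g \<Longrightarrow> pdeg n (\<lambda>x. f x - g x)"
  using pdeg_add[of n f "\<lambda>x. (-1) * g x"] pdeg_cmult[of n g "-1"] by simp

text \<open>Read on the ambient space of the sphere, a polynomial on the ball ignores the last
  coordinate. Its degree is unchanged, and it can be multiplied by kernels that do depend on that
  coordinate.\<close>

abbreviation ball_poly :: "nat \<Rightarrow> (real^'d \<Rightarrow> real) \<Rightarrow> bool" where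
  "ball_poly n f \<equiv> pdeg n (\<lambda>z :: (real^'d) \<times> real. f (fst z))"

lemma finite_multi_indices: "finite {\<alpha> :: 'd::finite \<Rightarrow> nat. (\<Sum>i\<in>UNIV. \<alpha> i) \<le> n}"
proof (rule finite_subset)
  show "{\<alpha> :: 'd \<Rightarrow> nat. (\<Sum>i\<in>UNIV. \<alpha> i) \<le> n} \<subseteq> PiE UNIV (\<lambda>_. {..n})"
  proof
    fix \<alpha> :: "'d \<Rightarrow> nat" assume "\<alpha> \<in> {\<alpha>. (\<Sum>i\<in>UNIV. \<alpha> i) \<le> n}"
    then have "\<alpha> i \<le> n" for i
      using member_le_sum[of i UNIV \<alpha>] by simp
    then show "\<alpha> \<in> PiE UNIV (\<lambda>_. {..n})" by (simp add: PiE_UNIV_domain)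
  qed
qed (auto intro: finite_PiE)

lemma Poly_le_pdeg:
  fixes f :: "real^'d \<Rightarrow> real"
  assumes "f \<in> Poly_le n"
  shows "ball_poly n f"
proof -
  obtain a where f: "f = (\<lambda>x. \<Sum>\<alpha> | (\<Sum>i\<in>UNIV. \<alpha> i) \<le> n. a \<alpha> * (\<Prod>i\<in>UNIV. (x $ i) ^ \<alpha> i))"
    using assms by (auto simp: Poly_le_def)
  have coord: "pdeg 1 (\<lambda>z :: (real^'d) \<times> real. fst z $ i)" for i
    using pdeg_inner[of "(axis i 1, 0) :: (real^'d) \<times> real"]
    by (simp add: inner_prod_def inner_axis)
  have mono: "pdeg n (\<lambda>z :: (real^'d) \<times> real. a \<alpha> * (\<Prod>i\<in>UNIV. (fst z $ i) ^ \<alpha> i))"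
    if "(\<Sum>i\<in>UNIV. \<alpha> i) \<le> n" for \<alpha>
  proof -
    have "pdeg (\<Sum>i\<in>UNIV. \<alpha> i) (\<lambda>z :: (real^'d) \<times> real. (\<Prod>i\<in>UNIV. (fst z $ i) ^ \<alpha> i))"
      using pdeg_power[OF coord] by (intro pdeg_prod) auto
    then show ?thesis using that pdeg_cmult[OF pdeg_mono] by blast
  qed
  show ?thesis
    unfolding f by (rule pdeg_sum[OF finite_multi_indices]) (use mono in auto)
qed

text \<open>The reversed polynomial \<open>z^m * q(1/z)\<close> is again a polynomial with the same
  moduli on the unit circle, so the maximum principle applies to it at \<open>1/w\<close>. The
  factor \<open>monom 1 (m - degree q)\<close> pads the reversal when the degree is below
  \<open>m\<close>.\<close>

lemma poly_growth_outside_disc: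
  fixes q :: "complex poly"
  assumes deg: "degree q \<le> m" and M: "\<And>z. norm z = 1 \<Longrightarrow> norm (poly q z) \<le> M"
    and w: "norm w \<ge> 1"
  shows "norm (poly q w) \<le> norm w ^ m * M"
proof -
  define r where "r = monom 1 (m - degree q) * reflect_poly q"
  have r: "poly r z = z ^ m * poly q (inverse z)" if "z \<noteq> 0" for z
    using that deg by (simp add: r_def poly_monom poly_reflect_poly_nz flip: power_add mult.assoc)
  have "norm (poly r (inverse w)) \<le> M"
  proof (rule maximum_modulus_frontier[of "poly r" "cball 0 1"])
    fix z :: complex assume "z \<in> frontier (cball 0 1)"
    then have z: "norm z = 1" by (simp add: frontier_cball)
    then have "norm (inverse z) = 1" by (simp add: norm_inverse)
    with M r[of z] z show "norm (poly r z) \<le> M"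
      by (metis mult_1 norm_mult norm_one norm_power norm_zero power_one zero_neq_one)
  qed (use w in \<open>auto intro!: holomorphic_intros continuous_intros simp: norm_inverse inverse_le_1_iff\<close>)
  moreover have "w \<noteq> 0" using w by auto
  moreover have "poly q w = w ^ m * poly r (inverse w)"
    using \<open>w \<noteq> 0\<close> r[of "inverse w"] by (simp add: field_simps)
  ultimately show ?thesis by (simp add: norm_mult norm_power mult_left_mono)
qed

text \<open>Cauchy's estimate on the circle of radius \<open>1/m\<close> about \<open>z\<close>. Up
  to that distance outside the disc the polynomial grows by at most
  \<open>(1 + 1/m)^m \<le> exp 1 \<le> 3\<close>.\<close>

lemma Bernstein_poly:
  fixes q :: "complex poly"
  assumes deg: "degree q \<le> m" and m: "m \<ge> 1"
    and M: "\<And>z. norm z = 1 \<Longrightarrow> norm (poly q z) \<le> M"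
    and z: "norm z = 1"
  shows "norm (poly (pderiv q) z) \<le> 3 * real m * M"
proof -
  have M0: "M \<ge> 0" using M[OF z] norm_ge_zero order_trans by blast
  have bound: "norm (poly q w) \<le> 3 * M" if "norm (z - w) = 1 / real m" for w
  proof (cases "norm w \<ge> 1")
    case True
    have "norm w \<le> 1 + 1 / real m"
      using that z norm_triangle_ineq2[of w z] by (simp add: norm_minus_commute)
    then have "norm w ^ m \<le> (1 + 1 / real m) ^ m" by (intro power_mono) auto
    also have "\<dots> \<le> exp 1"
      using exp_ge_one_plus_x_over_n_power_n[of m 1] m by auto
    also have "\<dots> \<le> 3" by (rule exp_le)
    finally have "norm w ^ m * M \<le> 3 * M" using M0 by (rule mult_right_mono)
    with poly_growth_outside_disc[OF deg M True] show ?thesis by linarith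
  next
    case False
    have "norm (poly q w) \<le> M"
    proof (rule maximum_modulus_frontier[of "poly q" "cball 0 1"])
      show "\<And>z. z \<in> frontier (cball 0 1) \<Longrightarrow> norm (poly q z) \<le> M"
        using M by (simp add: frontier_cball)
    qed (use False in \<open>auto intro!: holomorphic_intros continuous_intros\<close>)
    with M0 show ?thesis by linarith
  qed
  have "norm ((deriv ^^ 1) (poly q) z) \<le> fact 1 * (3 * M) / (1 / real m) ^ 1"
    using m bound by (intro Cauchy_inequality) (auto intro!: holomorphic_intros continuous_intros)
  moreover have "deriv (poly q) z = poly (pderiv q) z"
    by (rule DERIV_imp_deriv[OF poly_DERIV])
  ultimately show ?thesis using m by (simp add: field_simps)
qed

text \<open>Along a great circle a polynomial of degree \<open>n\<close> is a trigonometric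
  polynomial with frequencies between \<open>-n\<close> and \<open>n\<close>; the factor
  \<open>cis t ^ n\<close> shifts them to \<open>0..2n\<close>.\<close>

lemma pdeg_circle:
  assumes "pdeg n f"
  shows "\<exists>q :: complex poly. degree q \<le> 2 * n \<and>
    (\<forall>t. of_real (f (cos t *\<^sub>R X + sin t *\<^sub>R T)) * cis t ^ n = poly q (cis t))"
  using assms
proof (induction rule: pdeg.induct)
  case (pdeg_const n c)
  show ?case
    by (rule exI[of _ "monom (of_real c) n"]) (auto simp: poly_monom intro: order_trans[OF degree_monom_le])
next
  case (pdeg_inner_mult n f v)
  then obtain q where q: "degree q \<le> 2 * n"
    "\<And>t. of_real (f (cos t *\<^sub>R X + sin t *\<^sub>R T)) * cis t ^ n = poly q (cis t)" by blast
  define a b where "a = X \<bullet> v" and "b = T \<bullet> v"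
  \<comment> \<open>From \<open>a cos t + b sin t = (a + ib)/2 * cis(-t) + (a - ib)/2 * cis
    t\<close>, multiplied by \<open>cis t\<close>.\<close>
  define l where "l = [: Complex (a/2) (b/2), 0, Complex (a/2) (-b/2) :]"
  have l: "of_real ((cos t *\<^sub>R X + sin t *\<^sub>R T) \<bullet> v) * cis t = poly l (cis t)" for t
  proof -
    have 1: "cos t * cos t = 1 - sin t * sin t"
      using sin_cos_squared_add3[of t] by (simp add: algebra_simps)
    have "cos t * (cos t * x) + sin t * (sin t * x) = x" for x
      using 1 by (metis (no_types, opaque_lifting) add_diff_cancel_right' diff_add_cancel distrib_right mult.assoc mult_1)
    from this[of "(X \<bullet> v) * 2"] this[of "(T \<bullet> v) * 2"] show ?thesis
      by (simp add: l_def complex_eq_iff inner_add_left a_def b_def field_simps)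
  qed
  have "degree (l * q) \<le> 2 * Suc n"
    using q(1) degree_mult_le[of l q] by (simp add: l_def split: if_splits)
  moreover have "of_real (((cos t *\<^sub>R X + sin t *\<^sub>R T) \<bullet> v) * f (cos t *\<^sub>R X + sin t *\<^sub>R T)) * cis t ^ Suc n
      = poly (l * q) (cis t)" for t
    by (simp add: q(2)[symmetric] l[symmetric] mult_ac)
  ultimately show ?case by blast
next
  case (pdeg_add n f g)
  then obtain p q where "degree p \<le> 2 * n" "degree q \<le> 2 * n"
    "\<And>t. of_real (f (cos t *\<^sub>R X + sin t *\<^sub>R T)) * cis t ^ n = poly p (cis t)"
    "\<And>t. of_real (g (cos t *\<^sub>R X + sin t *\<^sub>R T)) * cis t ^ n = poly q (cis t)" by blast
  then show ?case
    by (intro exI[of _ "p + q"]) (auto simp: algebra_simps degree_add_le)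
qed

text \<open>Differentiating \<open>cis(-nt) * q(cis t)\<close> gives \<open>n * M\<close> from the
  first factor and \<open>3 * (2n) * M\<close> from the second, since \<open>q\<close> has degree
  \<open>2n\<close>. This is the constant 7.\<close>

lemma Bernstein_arc:
  fixes X T :: "'a::real_inner"
  assumes f: "pdeg n f" and M: "\<And>Z. norm Z = 1 \<Longrightarrow> \<bar>f Z\<bar> \<le> M"
    and X: "norm X = 1" and T: "norm T = 1" and orth: "X \<bullet> T = 0"
  shows "\<bar>f (cos t *\<^sub>R X + sin t *\<^sub>R T) - f X\<bar> \<le> 7 * real n * M * \<bar>t\<bar>"
proof (cases "n = 0")
  case True
  have "pdeg m g \<Longrightarrow> m = 0 \<Longrightarrow> g x = g y" for m and g :: "'a \<Rightarrow> real" and x y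
    by (induction rule: pdeg.induct) auto
  from this[OF f True, of "cos t *\<^sub>R X + sin t *\<^sub>R T" X] True show ?thesis by simp
next
  case False
  define c where "c = (\<lambda>t. cos t *\<^sub>R X + sin t *\<^sub>R T)"
  have c: "norm (c t) = 1" for t
    using X T orth by (simp add: c_def norm_eq_1 inner_add_left inner_add_right inner_commute flip: power2_eq_square)
  obtain q where q: "degree q \<le> 2 * n" "\<And>t. of_real (f (c t)) * cis t ^ n = poly q (cis t)"
    using pdeg_circle[OF f] unfolding c_def by blast
  have qM: "norm (poly q z) \<le> M" if "norm z = 1" for z
  proof -
    have "z \<noteq> 0" using that by auto
    then have z: "cis (Arg z) = z" using that by (simp add: cis_Arg sgn_eq)
    have "norm (poly q (cis (Arg z))) = \<bar>f (c (Arg z))\<bar>"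
      unfolding q(2)[symmetric] by (simp add: norm_mult norm_power)
    then show ?thesis using M[OF c[of "Arg z"]] by (simp add: z)
  qed
  define g where "g = (\<lambda>t::real. cis (- (real n * t)) * poly q (cis t))"
  have g: "g t = of_real (f (c t))" for t
  proof -
    have "g t = of_real (f (c t)) * (cis (- (real n * t)) * cis (real n * t))"
      by (simp only: g_def q(2)[of t, symmetric] Complex.DeMoivre mult_ac)
    then show ?thesis by (simp add: cis_mult)
  qed
  define g' where "g' = (\<lambda>t::real. cis (- (real n * t)) *
     ((- \<i> * of_nat n) * poly q (cis t) + poly (pderiv q) (cis t) * (\<i> * cis t)))"
  define G where "G = (\<lambda>z. exp (- \<i> * of_nat n * z) * poly q (exp (\<i> * z)))"
  have gG: "g = (\<lambda>t. G (of_real t))"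
    by (simp add: g_def G_def cis_conv_exp fun_eq_iff mult_ac)
  have "(G has_field_derivative (exp (- \<i> * of_nat n * z) * (- \<i> * of_nat n) * poly q (exp (\<i> * z)) +
      poly (pderiv q) (exp (\<i> * z)) * (exp (\<i> * z) * \<i>) * exp (- \<i> * of_nat n * z))) (at z)" for z
    unfolding G_def
    by (intro DERIV_mult' DERIV_chain2[OF poly_DERIV] derivative_eq_intros) (auto intro!: derivative_eq_intros)
  then have der: "(g has_vector_derivative g' t) (at t within UNIV)" for t
    unfolding gG g'_def
    by (rule has_vector_derivative_real_field[THEN has_vector_derivative_eq_rhs])
       (simp add: cis_conv_exp algebra_simps)
  have bd: "norm (g' t) \<le> 7 * real n * M" for t
  proof -
    have "norm (g' t) = norm ((- \<i> * of_nat n) * poly q (cis t) + poly (pderiv q) (cis t) * (\<i> * cis t))"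
      by (simp add: g'_def norm_mult)
    also have "\<dots> \<le> real n * norm (poly q (cis t)) + norm (poly (pderiv q) (cis t))"
      by (rule order_trans[OF norm_triangle_ineq]) (simp add: norm_mult)
    also have "\<dots> \<le> real n * M + 3 * real (2 * n) * M"
      using False by (intro add_mono mult_left_mono qM Bernstein_poly[OF q(1)]) auto
    finally show ?thesis by (simp add: algebra_simps)
  qed
  have M0: "0 \<le> 7 * real n * M" using norm_ge_zero order_trans bd by blast
  have "norm (g t - g 0) \<le> 7 * real n * M * norm (t - 0)"
  proof (rule differentiable_bound[of UNIV g "\<lambda>x h. h *\<^sub>R g' x"])
    show "onorm (\<lambda>h. h *\<^sub>R g' x) \<le> 7 * real n * M" for x
      using bd[of x] M0 by (intro onorm_bound) (auto simp: mult.commute[of _ "norm (g' x)"] mult_right_mono)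
  qed (use der in \<open>auto simp: has_vector_derivative_def\<close>)
  then show ?thesis by (simp add: g c_def flip: of_real_diff)
qed

section \<open>Chords and angles on the sphere\<close>

lemma sin_ge_half: "0 \<le> t \<Longrightarrow> t \<le> pi / 2 \<Longrightarrow> t / 2 \<le> sin t" for t :: real
proof (cases "t = 0")
  case False
  assume t: "0 \<le> t" "t \<le> pi / 2"
  have "convex_on {0..pi} (\<lambda>x. - sin x)"
    by (rule f''_ge0_imp_convex[where f' = "\<lambda>x. - cos x" and f'' = sin])
       (auto intro!: derivative_eq_intros sin_ge_zero)
  from convex_onD[OF this, of "2 * t / pi" 0 "pi / 2"] t
  have "2 * t / pi \<le> sin t" by (simp add: field_simps)
  moreover have "t / 2 \<le> 2 * t / pi" using mult_right_mono[of pi 4 t] t pi_less_4 by (simp add: field_simps)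
  ultimately show ?thesis by linarith
qed simp

lemma norm_diff_unit:
  fixes X Y :: "'a::real_inner"
  assumes "norm X = 1" "norm Y = 1"
  shows "norm (X - Y) = 2 * sin (arccos (X \<bullet> Y) / 2)"
proof -
  define \<theta> where "\<theta> = arccos (X \<bullet> Y)"
  have XY: "\<bar>X \<bullet> Y\<bar> \<le> 1" using Cauchy_Schwarz_ineq2[of X Y] assms by simp
  then have th: "cos \<theta> = X \<bullet> Y" "0 \<le> \<theta>" "\<theta> \<le> pi"
    using arccos_bounded[of "X \<bullet> Y"] by (auto simp: \<theta>_def cos_arccos_abs)
  have "cos \<theta> = 1 - 2 * (sin (\<theta> / 2))\<^sup>2" using cos_double_sin[of "\<theta> / 2"] by simp
  moreover have "(norm (X - Y))\<^sup>2 = 2 - 2 * (X \<bullet> Y)"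
    using assms by (simp add: power2_norm_eq_inner inner_diff_left inner_diff_right inner_commute norm_eq_1)
  ultimately have "(norm (X - Y))\<^sup>2 = (2 * sin (\<theta> / 2))\<^sup>2"
    using th(1) by (simp add: power_mult_distrib)
  moreover have "0 \<le> 2 * sin (\<theta> / 2)" using sin_ge_zero[of "\<theta> / 2"] th by simp
  ultimately show ?thesis unfolding \<theta>_def[symmetric] by (rule power2_eq_imp_eq[OF _ norm_ge_zero])
qed

lemma dist_le_arccos:
  fixes X Y :: "'a::real_inner"
  assumes "norm X = 1" "norm Y = 1"
  shows "dist X Y \<le> arccos (X \<bullet> Y)" "arccos (X \<bullet> Y) \<le> 2 * dist X Y" "0 \<le> arccos (X \<bullet> Y)" "arccos (X \<bullet> Y) \<le> pi"
proof -
  have XY: "\<bar>X \<bullet> Y\<bar> \<le> 1" using Cauchy_Schwarz_ineq2[of X Y] assms by simp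
  then show "0 \<le> arccos (X \<bullet> Y)" "arccos (X \<bullet> Y) \<le> pi" using arccos_bounded[of "X \<bullet> Y"] by auto
  then show "dist X Y \<le> arccos (X \<bullet> Y)" "arccos (X \<bullet> Y) \<le> 2 * dist X Y"
    using norm_diff_unit[OF assms] sin_x_le_x[of "arccos (X \<bullet> Y) / 2"] sin_ge_half[of "arccos (X \<bullet> Y) / 2"]
    by (auto simp: dist_norm)
qed

text \<open>Gram-Schmidt turns \<open>Y\<close> into a unit tangent \<open>T\<close> at
  \<open>X\<close>, so both points lie on one great circle. The angle is at most twice the chord,
  which doubles the constant 7. Antipodal points determine no tangent, but there the chord is 2 and
  the trivial bound \<open>2 * M\<close> suffices.\<close>

lemma Bernstein_sphere:
  fixes X Y :: "'a::real_inner"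
  assumes f: "pdeg n f" and M: "\<And>Z. norm Z = 1 \<Longrightarrow> \<bar>f Z\<bar> \<le> M" and n: "n \<ge> 1"
    and X: "norm X = 1" and Y: "norm Y = 1"
  shows "\<bar>f Y - f X\<bar> \<le> 14 * real n * M * dist X Y"
proof -
  define \<theta> where "\<theta> = arccos (X \<bullet> Y)"
  have XY: "\<bar>X \<bullet> Y\<bar> \<le> 1" using Cauchy_Schwarz_ineq2[of X Y] X Y by simp
  have th: "cos \<theta> = X \<bullet> Y" "0 \<le> \<theta>" "\<theta> \<le> pi" "\<theta> \<le> 2 * dist X Y"
    using XY dist_le_arccos[OF X Y] by (auto simp: \<theta>_def cos_arccos_abs)
  have M0: "M \<ge> 0" using M[OF X] by linarith
  show ?thesis
  proof (cases "sin \<theta> = 0")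
    case True
    then have "\<theta> = 0 \<or> \<theta> = pi" using th(2,3) sin_gt_zero[of \<theta>] by linarith
    then have "X \<bullet> Y = 1 \<or> X \<bullet> Y = -1" using th by auto
    then have "dist X Y ^ 2 = 0 \<or> dist X Y ^ 2 = 2 ^ 2"
      using X Y by (auto simp: dist_norm power2_norm_eq_inner inner_diff_left inner_diff_right inner_commute norm_eq_1)
    then have "dist X Y = 0 \<or> dist X Y = 2"
      using power2_eq_imp_eq[of "dist X Y" 2] by auto
    then show ?thesis
    proof
      assume d: "dist X Y = 2"
      have "M \<le> real n * M" using n M0 mult_right_mono[of 1 "real n" M] by simp
      moreover have "\<bar>f Y - f X\<bar> \<le> 2 * M" using M[OF X] M[OF Y] by linarith
      ultimately show ?thesis using M0 by (simp add: d mult.assoc)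
    qed auto
  next
    case False
    define T where "T = (1 / sin \<theta>) *\<^sub>R (Y - cos \<theta> *\<^sub>R X)"
    have XX: "X \<bullet> X = 1" and YY: "Y \<bullet> Y = 1" using X Y by (auto simp: norm_eq_1)
    have "X \<bullet> T = 0" using XX by (simp add: T_def inner_diff_right th)
    moreover have "(Y - cos \<theta> *\<^sub>R X) \<bullet> (Y - cos \<theta> *\<^sub>R X) = (sin \<theta>)\<^sup>2"
      unfolding sin_squared_eq th(1)
      using XX YY by (simp add: inner_diff_left inner_diff_right inner_commute power2_eq_square)
    then have "T \<bullet> T = 1" using False by (simp add: T_def power2_eq_square)
    then have "norm T = 1" by (simp add: norm_eq_1)
    ultimately have "\<bar>f (cos \<theta> *\<^sub>R X + sin \<theta> *\<^sub>R T) - f X\<bar> \<le> 7 * real n * M * \<bar>\<theta>\<bar>"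
      using Bernstein_arc[OF f M X] by blast
    also have "cos \<theta> *\<^sub>R X + sin \<theta> *\<^sub>R T = Y" using False by (simp add: T_def)
    also have "7 * real n * M * \<bar>\<theta>\<bar> \<le> 7 * real n * M * (2 * dist X Y)"
      using th M0 by (intro mult_left_mono) auto
    finally show ?thesis by (simp add: algebra_simps)
  qed
qed

section \<open>Fejer kernels\<close>

text \<open>The Chebyshev polynomials of the first kind.\<close>

fun cheb :: "nat \<Rightarrow> real \<Rightarrow> real" where
  "cheb 0 t = 1"
| "cheb (Suc 0) t = t"
| "cheb (Suc (Suc k)) t = 2 * t * cheb (Suc k) t - cheb k t"

lemma cheb_cos: "cheb k (cos \<theta>) = cos (real k * \<theta>)"
proof (induction k "cos \<theta>" rule: cheb.induct)
  case (3 k)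
  have "cos (\<theta> + real (Suc k) * \<theta>) + cos (real (Suc k) * \<theta> - \<theta>) = 2 * cos \<theta> * cos (real (Suc k) * \<theta>)"
    by (simp only: cos_add cos_diff) simp
  then show ?case unfolding cheb.simps 3 by (simp add: algebra_simps)
qed auto

lemma pdeg_cheb: "pdeg k (\<lambda>Y. cheb k (Y \<bullet> X))"
proof (induction k "0::real" rule: cheb.induct)
  case 1
  show ?case using pdeg_const[of 0 1] by simp
next
  case 2
  show ?case using pdeg_inner[of X] by simp
next
  case (3 k)
  have "pdeg (Suc (Suc k)) (\<lambda>Y. 2 * ((Y \<bullet> X) * cheb (Suc k) (Y \<bullet> X)))"
    by (rule pdeg_cmult[OF pdeg_inner_mult[OF 3(1)]])
  moreover have "pdeg (Suc (Suc k)) (\<lambda>Y. cheb k (Y \<bullet> X))"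
    by (rule pdeg_mono[OF 3(2)]) simp
  ultimately show ?case using pdeg_diff by (fastforce simp: mult.assoc)
qed

text \<open>The Fejer kernel in the variable \<open>t = cos \<theta>\<close>: the square of
  \<open>|sum of cis (k\<theta>)|\<close> expanded into cosines of \<open>(j - k)\<theta>\<close>.
  Dividing by \<open>n^2\<close> gives it the value 1 at \<open>t = 1\<close>. The conditional
  avoids truncated subtraction.\<close>

definition fejer :: "nat \<Rightarrow> real \<Rightarrow> real" where
  "fejer n t = (1 / (real n)\<^sup>2) * (\<Sum>j<n. \<Sum>k<n. cheb (if j \<le> k then k - j else j - k) t)"

lemma pdeg_fejer: "pdeg n (\<lambda>Y. fejer n (Y \<bullet> X))"
  unfolding fejer_def
  by (intro pdeg_cmult pdeg_sum finite_lessThan pdeg_mono[OF pdeg_cheb]) auto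

lemma fejer_cos: "fejer n (cos \<theta>) = (norm (\<Sum>k<n. cis (real k * \<theta>)))\<^sup>2 / (real n)\<^sup>2"
proof -
  have "(norm (\<Sum>k<n. cis (real k * \<theta>)))\<^sup>2 = (\<Sum>k<n. cos (real k * \<theta>))\<^sup>2 + (\<Sum>k<n. sin (real k * \<theta>))\<^sup>2"
    by (simp add: cmod_power2)
  also have "\<dots> = (\<Sum>j<n. \<Sum>k<n. cos (real j * \<theta>) * cos (real k * \<theta>) + sin (real j * \<theta>) * sin (real k * \<theta>))"
    by (simp add: power2_eq_square sum_product sum.distrib)
  also have "\<dots> = (\<Sum>j<n. \<Sum>k<n. cheb (if j \<le> k then k - j else j - k) (cos \<theta>))"
  proof (intro sum.cong refl)
    fix j k :: nat
    have "cos (real j * \<theta>) * cos (real k * \<theta>) + sin (real j * \<theta>) * sin (real k * \<theta>) = cos ((real j - real k) * \<theta>)"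
      by (simp add: cos_diff left_diff_distrib)
    also have "\<dots> = cos (\<bar>real j - real k\<bar> * \<theta>)"
      by (cases "j \<le> k") (auto simp: abs_if algebra_simps cos_diff)
    finally show "cos (real j * \<theta>) * cos (real k * \<theta>) + sin (real j * \<theta>) * sin (real k * \<theta>) =
        cheb (if j \<le> k then k - j else j - k) (cos \<theta>)"
      by (simp add: cheb_cos abs_if of_nat_diff)
  qed
  finally show ?thesis by (simp add: fejer_def)
qed

text \<open>The Fejer kernel decays quadratically in \<open>n * dist X Y\<close>. Only the linear
  decay \<open>F * (1 + t) \<le> 3\<close> is kept, in a form whose \<open>s\<close>-th power gives
  decay of order \<open>s\<close> at degree \<open>s * n\<close>.\<close>

lemma localized_polynomial:
  fixes X :: "'a::real_inner"
  assumes X: "norm X = 1" and n: "n \<ge> 1"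
  obtains Q where "pdeg (s * n) Q" "Q X = 1"
    "\<And>Y. norm Y = 1 \<Longrightarrow> 0 \<le> Q Y \<and> Q Y \<le> 1 \<and> Q Y * (1 + real n * dist X Y) ^ s \<le> 3 ^ s"
proof -
  define F where "F = (\<lambda>Y. fejer n (Y \<bullet> X))"
  have F: "0 \<le> F Y \<and> F Y \<le> 1 \<and> F Y * (1 + real n * dist X Y) \<le> 3" if Y: "norm Y = 1" for Y
  proof -
    define \<theta> where "\<theta> = arccos (Y \<bullet> X)"
    define z where "z = (\<Sum>k<n. cis (real k * \<theta>))"
    define t where "t = real n * dist X Y"
    have YX: "\<bar>Y \<bullet> X\<bar> \<le> 1" using Cauchy_Schwarz_ineq2[of Y X] X Y by simp
    then have th: "cos \<theta> = Y \<bullet> X" by (simp add: \<theta>_def cos_arccos_abs)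
    have Fz: "F Y = (norm z)\<^sup>2 / (real n)\<^sup>2"
      unfolding F_def z_def fejer_cos[symmetric] th ..
    have "norm z \<le> real n"
      unfolding z_def by (rule order_trans[OF norm_sum]) simp
    then have "(norm z)\<^sup>2 \<le> (real n)\<^sup>2" by (intro power_mono) auto
    then have F1: "F Y \<le> 1" unfolding Fz using n by (simp add: divide_le_eq)
    \<comment> \<open>The geometric sum has modulus at most \<open>2 / |cis \<theta> - 1|\<close>,
      and \<open>|cis \<theta> - 1|\<close> is exactly the chord between \<open>X\<close> and
      \<open>Y\<close>.\<close>
    have "(cis \<theta> - 1) * z = cis \<theta> ^ n - 1"
      unfolding z_def Complex.DeMoivre[symmetric] by (rule power_diff_1_eq[symmetric])
    then have "norm (cis \<theta> - 1) * norm z \<le> 2"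
      by (metis norm_mult norm_triangle_ineq4 norm_power norm_cis norm_one power_one one_add_one)
    then have "(norm (cis \<theta> - 1) * norm z)\<^sup>2 \<le> 2\<^sup>2" by (intro power_mono) auto
    moreover have "(norm (cis \<theta> - 1))\<^sup>2 = (dist X Y)\<^sup>2"
    proof -
      have "(norm (cis \<theta> - 1))\<^sup>2 = 2 - 2 * cos \<theta>"
        using sin_cos_squared_add[of \<theta>] by (simp add: cmod_power2 power2_diff)
      moreover have "(dist X Y)\<^sup>2 = 2 - 2 * (Y \<bullet> X)"
        using X Y by (simp add: dist_norm power2_norm_eq_inner inner_diff_left inner_diff_right inner_commute norm_eq_1)
      ultimately show ?thesis by (simp add: th)
    qed
    ultimately have F2: "F Y * t\<^sup>2 \<le> 4"
      using n by (simp add: Fz t_def power_mult_distrib field_simps)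
    have F0: "0 \<le> F Y" by (simp add: Fz)
    have "t \<ge> 0" by (simp add: t_def)
    \<comment> \<open>For \<open>t \<le> 2\<close> the bound \<open>F \<le> 1\<close> is enough.
      Beyond that, \<open>F * t^2 \<le> 4\<close> combines with \<open>4(1 + t) \<le> 3t^2\<close>,
      which is \<open>(t - 2)(3t + 2) \<ge> 0\<close>.\<close>
    have "F Y * (1 + t) \<le> 3"
    proof (cases "t \<le> 2")
      case True
      then have "F Y * (1 + t) \<le> 1 * 3" using F0 F1 \<open>t \<ge> 0\<close> by (intro mult_mono) auto
      then show ?thesis by simp
    next
      case False
      then have "4 * (1 + t) \<le> 3 * t\<^sup>2"
        using mult_nonneg_nonneg[of "t - 2" "3 * t + 2"] by (simp add: algebra_simps power2_eq_square)
      then have "F Y * (4 * (1 + t)) \<le> F Y * (3 * t\<^sup>2)" using F0 by (rule mult_left_mono)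
      then show ?thesis using F2 by (simp add: algebra_simps)
    qed
    with F0 F1 show ?thesis by (simp add: t_def)
  qed
  show thesis
  proof (rule that[of "\<lambda>Y. F Y ^ s"])
    show "pdeg (s * n) (\<lambda>Y. F Y ^ s)" unfolding F_def by (rule pdeg_power[OF pdeg_fejer])
    have "X \<bullet> X = cos 0" using X by (simp add: norm_eq_1)
    then show "F X ^ s = 1" unfolding F_def using n by (simp only: fejer_cos) simp
    show "0 \<le> F Y ^ s \<and> F Y ^ s \<le> 1 \<and> F Y ^ s * (1 + real n * dist X Y) ^ s \<le> 3 ^ s" if "norm Y = 1" for Y
      using F[OF that] by (auto simp flip: power_mult_distrib intro!: power_mono power_le_one)
  qed
qed

section \<open>The mass of caps\<close>

definition rho :: "real^'d \<Rightarrow> real" where "rho x = sqrt (1 - (norm x)\<^sup>2)"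

definition lift :: "real^'d \<Rightarrow> (real^'d) \<times> real" where "lift x = (x, rho x)"

abbreviation chord :: "real^'d \<Rightarrow> real^'d \<Rightarrow> real" where
  "chord x y \<equiv> dist (lift x) (lift y)"

definition cap :: "real^'d \<Rightarrow> real \<Rightarrow> (real^'d) set" where
  "cap x r = {y \<in> cball 0 1. chord x y \<le> r}"

text \<open>The indicator is essential: outside the ball the base of \<open>powr\<close> is negative
  and \<open>W\<close> need not vanish.\<close>

definition nu :: "real \<Rightarrow> (real^'d) measure" where
  "nu \<mu> = density lborel (\<lambda>x. ennreal (indicator (cball 0 1) x * W \<mu> x))"

abbreviation mass :: "real \<Rightarrow> (real^'d) set \<Rightarrow> real" where
  "mass \<mu> \<equiv> measure (nu \<mu>)"

lemma W_measurable [measurable]: "W \<mu> \<in> borel_measurable borel"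
  unfolding W_def by measurable

lemma W_nonneg: "0 \<le> W \<mu> x" by (simp add: W_def)

lemma sets_nu [measurable_cong, simp]: "sets (nu \<mu>) = sets borel" by (simp add: nu_def)
lemma space_nu [simp]: "space (nu \<mu>) = UNIV" by (simp add: nu_def)

lemma continuous_rho: "continuous_on S rho"
  unfolding rho_def by (intro continuous_intros)

lemma continuous_lift: "continuous_on S lift"
  unfolding lift_def by (intro continuous_intros continuous_rho)

lemma closed_cap: "closed (cap x r)"
proof -
  have "cap x r = cball 0 1 \<inter> {y. chord x y \<le> r}" by (auto simp: cap_def)
  moreover have "closed {y. chord x y \<le> r}"
    by (intro closed_Collect_le continuous_intros continuous_lift)
  ultimately show ?thesis by (simp add: closed_Int)
qed

lemma cap_borel [measurable, simp]: "cap x r \<in> sets borel"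
  by (intro borel_closed closed_cap)

lemma cap_subset: "cap x r \<subseteq> cball 0 1" by (auto simp: cap_def)

lemma emeasure_nu:
  "A \<in> sets borel \<Longrightarrow> A \<subseteq> cball 0 1 \<Longrightarrow> emeasure (nu \<mu>) A = (\<integral>\<^sup>+y. indicator A y * ennreal (W \<mu> y) \<partial>lborel)"
  unfolding nu_def
  by (subst emeasure_density) (auto intro!: nn_integral_cong simp: indicator_def)

lemma rho_sq: "norm x \<le> 1 \<Longrightarrow> (rho x)\<^sup>2 = 1 - (norm x)\<^sup>2"
  by (simp add: rho_def abs_square_le_1)

lemma rho_bounds: "norm x \<le> 1 \<Longrightarrow> 0 \<le> rho x" "norm x \<le> 1 \<Longrightarrow> rho x \<le> 1"
  by (auto simp: rho_def abs_square_le_1)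

lemma norm_lift: "norm x \<le> 1 \<Longrightarrow> norm (lift x) = 1"
  by (simp add: lift_def norm_Pair rho_sq)

lemma rho_lipschitz: "\<bar>rho x - rho y\<bar> \<le> chord x y"
  using norm_snd_le[of "rho x - rho y" "x - y"] by (simp add: lift_def dist_norm)

lemma dist_le_lift: "dist x y \<le> chord x y"
  using norm_fst_le[of "x - y" "rho x - rho y"] by (simp add: lift_def dist_norm)

lemma dist_lift_le: "chord x y \<le> dist x y + \<bar>rho x - rho y\<bar>"
  using sqrt_sum_squares_le_sum_abs[of "dist x y" "rho x - rho y"]
  by (simp add: lift_def dist_Pair_Pair dist_real_def)

text \<open>Fubini along one coordinate line without splitting the index type \<open>'d\<close>: averaging over
  translations in direction \<open>e\<close> replaces the missing isomorphism of \<open>real^'d\<close> with a product.\<close>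

lemma nn_integral_line_average:
  fixes F :: "'a::euclidean_space \<Rightarrow> ennreal" and A :: "real set"
  assumes F [measurable]: "F \<in> borel_measurable borel" and A [measurable]: "A \<in> sets borel"
  shows "emeasure lborel A * (\<integral>\<^sup>+y. F y \<partial>lborel) =
    (\<integral>\<^sup>+y. (\<integral>\<^sup>+t. indicator A t * F (y + t *\<^sub>R e) \<partial>lborel) \<partial>lborel)"
proof -
  have tr: "(\<integral>\<^sup>+y. F (y + c) \<partial>lborel) = (\<integral>\<^sup>+y. F y \<partial>lborel)" for c
  proof -
    have "(\<integral>\<^sup>+y. F y \<partial>lborel) = (\<integral>\<^sup>+y. F y \<partial>distr lborel borel ((+) c))"
      by (simp add: lborel_distr_plus)
    also have "\<dots> = (\<integral>\<^sup>+y. F (c + y) \<partial>lborel)" by (subst nn_integral_distr) auto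
    finally show ?thesis by (simp add: add.commute)
  qed
  have "(\<integral>\<^sup>+y. (\<integral>\<^sup>+t. indicator A t * F (y + t *\<^sub>R e) \<partial>lborel) \<partial>lborel) =
     (\<integral>\<^sup>+t. (\<integral>\<^sup>+y. indicator A t * F (y + t *\<^sub>R e) \<partial>lborel) \<partial>lborel)"
    by (rule lborel_pair.Fubini') measurable
  also have "\<dots> = (\<integral>\<^sup>+t. (\<integral>\<^sup>+y. F y \<partial>lborel) * indicator A t \<partial>lborel)"
    by (intro nn_integral_cong) (simp add: nn_integral_cmult tr mult.commute)
  also have "\<dots> = (\<integral>\<^sup>+y. F y \<partial>lborel) * emeasure lborel A"
    by (rule nn_integral_cmult_indicator) simp
  finally show ?thesis by (simp add: mult.commute)
qed

text \<open>On a coordinate line the substitution \<open>s = sqrt (a\<^sup>2 - t\<^sup>2)\<close> turns the weight into \<open>s powr (2 * \<mu>) ds\<close>;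
  the antiderivative fails to be differentiable at the end point \<open>t = a\<close> when \<open>\<mu> < 1/2\<close>.\<close>

lemma slice_integral:
  fixes a :: real
  assumes r: "0 \<le> r1" "r1 \<le> r2" "r2 \<le> a" and mu: "\<mu> \<ge> 0"
  shows "(\<integral>\<^sup>+t. indicator {sqrt (a\<^sup>2 - r2\<^sup>2)..sqrt (a\<^sup>2 - r1\<^sup>2)} t * ennreal (t * (a\<^sup>2 - t\<^sup>2) powr (\<mu> - 1/2)) \<partial>lborel)
    = ennreal ((r2 powr (2 * \<mu> + 1) - r1 powr (2 * \<mu> + 1)) / (2 * \<mu> + 1))"
proof -
  define b1 b2 where "b1 = sqrt (a\<^sup>2 - r2\<^sup>2)" and "b2 = sqrt (a\<^sup>2 - r1\<^sup>2)"
  define G where "G = (\<lambda>t. (- 1 / (2 * \<mu> + 1)) * (a\<^sup>2 - t\<^sup>2) powr (\<mu> + 1/2))"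
  have sq: "r1\<^sup>2 \<le> r2\<^sup>2" "r2\<^sup>2 \<le> a\<^sup>2" using r by (auto intro!: power_mono)
  then have b: "0 \<le> b1" "b1 \<le> b2" "b1\<^sup>2 = a\<^sup>2 - r2\<^sup>2" "b2\<^sup>2 = a\<^sup>2 - r1\<^sup>2" by (auto simp: b1_def b2_def)
  have pw: "(s\<^sup>2) powr (\<mu> + 1/2) = s powr (2 * \<mu> + 1)" if "s \<ge> 0" for s :: real
  proof (cases "s = 0")
    case False
    then have "s\<^sup>2 = s powr 2" using that by simp
    then show ?thesis by (simp only: powr_powr) (simp add: algebra_simps)
  qed auto
  have "((\<lambda>t. t * (a\<^sup>2 - t\<^sup>2) powr (\<mu> - 1/2)) has_integral G b2 - G b1) {b1..b2}"
  proof (rule fundamental_theorem_of_calculus_interior[OF b(2)])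
    have "t\<^sup>2 \<le> a\<^sup>2" if "t \<in> {b1..b2}" for t
    proof -
      have "t\<^sup>2 \<le> b2\<^sup>2" using that b(1) by (intro power_mono) auto
      then show ?thesis using b(4) zero_le_power2[of r1] by linarith
    qed
    then show "continuous_on {b1..b2} G"
      unfolding G_def using mu by (intro continuous_intros continuous_on_powr') auto
    fix t assume t: "t \<in> {b1<..<b2}"
    have "t\<^sup>2 < b2\<^sup>2" using t b(1) by (intro power_strict_mono) auto
    then have pos: "0 < a\<^sup>2 - t\<^sup>2" using b(4) zero_le_power2[of r1] by linarith
    have "((\<lambda>t. (a\<^sup>2 - t\<^sup>2) powr (\<mu> + 1/2)) has_real_derivative
        (\<mu> + 1/2) * (a\<^sup>2 - t\<^sup>2) powr (\<mu> - 1/2) * (- 2 * t)) (at t)"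
      using pos by (auto intro!: derivative_eq_intros)
    from DERIV_cmult[OF this, of "- 1 / (2 * \<mu> + 1)"]
    have "(G has_real_derivative t * (a\<^sup>2 - t\<^sup>2) powr (\<mu> - 1/2)) (at t)"
      unfolding G_def by (rule DERIV_cong) (use mu in \<open>simp add: field_simps\<close>)
    then show "(G has_vector_derivative t * (a\<^sup>2 - t\<^sup>2) powr (\<mu> - 1/2)) (at t)"
      by (simp add: has_real_derivative_iff_has_vector_derivative)
  qed
  \<comment> \<open>The passage from the gauge integral to the Lebesgue integral asks for a
    nonnegative function on the whole line, hence the \<open>max 0\<close>.\<close>
  then have hi: "((\<lambda>t. max 0 (t * (a\<^sup>2 - t\<^sup>2) powr (\<mu> - 1/2))) has_integral G b2 - G b1) {b1..b2}"
    by (rule has_integral_eq[rotated]) (use b(1) in auto)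
  have "(\<integral>\<^sup>+t. indicator {b1..b2} t * ennreal (t * (a\<^sup>2 - t\<^sup>2) powr (\<mu> - 1/2)) \<partial>lborel)
      = (\<integral>\<^sup>+t. ennreal (indicator {b1..b2} t * max 0 (t * (a\<^sup>2 - t\<^sup>2) powr (\<mu> - 1/2))) \<partial>lborel)"
    by (intro nn_integral_cong) (use b(1) in \<open>auto simp: indicator_def\<close>)
  also have "\<dots> = ennreal (G b2 - G b1)"
    by (rule nn_integral_has_integral_lebesgue[OF _ hi]) auto
  also have "G b2 - G b1 = (r2 powr (2 * \<mu> + 1) - r1 powr (2 * \<mu> + 1)) / (2 * \<mu> + 1)"
    using r by (simp add: G_def b pw diff_divide_distrib)
  finally show ?thesis by (simp add: b1_def b2_def)
qed

text \<open>Mean value theorem for \<open>t powr (p + 1)\<close>. With \<open>p = 2 * \<mu>\<close>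
  it bounds a slice integral by the width of the height interval times the weight at one of its
  ends.\<close>

lemma powr_diff_bounds:
  fixes r1 r2 p :: real
  assumes r: "0 \<le> r1" "r1 \<le> r2" and p: "p \<ge> 0"
  shows "(r2 powr (p + 1) - r1 powr (p + 1)) / (p + 1) \<le> (r2 - r1) * r2 powr p"
    and "(r2 - r1) * r1 powr p \<le> (r2 powr (p + 1) - r1 powr (p + 1)) / (p + 1)"
proof -
  have "\<exists>z. r1 \<le> z \<and> z \<le> r2 \<and> r2 powr (p + 1) - r1 powr (p + 1) = (r2 - r1) * ((p + 1) * z powr p)"
  proof (cases "r1 = r2")
    case False
    then have "r1 < r2" using r by simp
    then have "\<exists>l z. r1 < z \<and> z < r2 \<and>
      ((\<lambda>t. t powr (p + 1)) has_real_derivative l) (at z) \<and> r2 powr (p + 1) - r1 powr (p + 1) = (r2 - r1) * l"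
    proof (rule MVT)
      show "continuous_on {r1..r2} (\<lambda>t. t powr (p + 1))"
        using r p by (intro continuous_intros continuous_on_powr') auto
      fix t assume "r1 < t" "t < r2"
      then have "((\<lambda>t. t powr (p + 1)) has_real_derivative (p + 1) * t powr p) (at t)"
        using r by (auto intro!: derivative_eq_intros)
      then show "(\<lambda>t. t powr (p + 1)) differentiable (at t)" by (auto simp: real_differentiable_def)
    qed
    then obtain l z where z: "r1 < z" "z < r2"
      "((\<lambda>t. t powr (p + 1)) has_real_derivative l) (at z)" "r2 powr (p + 1) - r1 powr (p + 1) = (r2 - r1) * l"
      by blast
    have "((\<lambda>t. t powr (p + 1)) has_real_derivative (p + 1) * z powr p) (at z)"
      using z r by (auto intro!: derivative_eq_intros)
    then have "l = (p + 1) * z powr p" using z(3) DERIV_unique by blast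
    with z show ?thesis by (intro exI[of _ z]) auto
  qed auto
  then obtain z where z: "r1 \<le> z" "z \<le> r2" "r2 powr (p + 1) - r1 powr (p + 1) = (r2 - r1) * ((p + 1) * z powr p)"
    by blast
  have eq: "(r2 powr (p + 1) - r1 powr (p + 1)) / (p + 1) = (r2 - r1) * z powr p"
    unfolding z(3) using p by simp
  show "(r2 powr (p + 1) - r1 powr (p + 1)) / (p + 1) \<le> (r2 - r1) * r2 powr p"
    unfolding eq using z r p by (intro mult_left_mono powr_mono2) auto
  show "(r2 - r1) * r1 powr p \<le> (r2 powr (p + 1) - r1 powr (p + 1)) / (p + 1)"
    unfolding eq using z r p by (intro mult_left_mono powr_mono2) auto
qed

section \<open>Coordinate lines and boxes\<close>

definition upd :: "real^'d \<Rightarrow> 'd \<Rightarrow> real \<Rightarrow> real^'d" where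
  "upd y i t = (\<chi> j. if j = i then t else y $ j)"

lemma upd_nth [simp]: "upd y i t $ j = (if j = i then t else y $ j)" by (simp add: upd_def)

lemma add_axis_eq_upd: "y + t *\<^sub>R axis i 1 = upd y i (y $ i + t)"
  by (simp add: vec_eq_iff axis_def)

lemma norm_sq_vec: "(norm (x :: real^'d))\<^sup>2 = (\<Sum>j\<in>UNIV. (x $ j)\<^sup>2)"
  by (simp add: norm_vec_def L2_set_def sum_nonneg)

lemma norm_upd: "(norm (upd y i t))\<^sup>2 = (\<Sum>j\<in>UNIV - {i}. (y $ j)\<^sup>2) + t\<^sup>2"
  unfolding norm_sq_vec by (subst sum.remove[of UNIV i]) auto

lemma emeasure_slab:
  fixes x :: "real^'d" and r L :: real
  assumes "r \<ge> 0" "L \<ge> 0"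
  shows "emeasure lborel {y :: real^'d. (\<forall>j. j \<noteq> i \<longrightarrow> \<bar>y $ j - x $ j\<bar> \<le> r) \<and> \<bar>y $ i\<bar> \<le> L}
     = ennreal (2 * L * (2 * r) ^ (CARD('d) - 1))" (is "emeasure lborel ?S = _")
proof -
  define l u :: "real^'d" where "l = (\<chi> j. if j = i then - L else x $ j - r)" and "u = (\<chi> j. if j = i then L else x $ j + r)"
  have lu: "l \<bullet> b \<le> u \<bullet> b" if "b \<in> Basis" for b
    using that assms by (auto simp: Basis_vec_def inner_axis l_def u_def)
  have "?S = cbox l u"
    unfolding mem_box_cart set_eq_iff l_def u_def
    by (auto simp: abs_le_iff split: if_splits) (smt (verit))+
  then have "emeasure lborel ?S = ennreal (measure lborel (cbox l u))"
    by (simp add: emeasure_eq_measure2 emeasure_lborel_cbox_finite)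
  also have "measure lborel (cbox l u) = (\<Prod>j\<in>UNIV. u $ j - l $ j)"
    using lu by (intro content_cbox_cart) (simp add: box_ne_empty)
  also have "\<dots> = (u $ i - l $ i) * (\<Prod>j\<in>UNIV - {i}. u $ j - l $ j)" by (subst prod.remove[of UNIV i]) auto
  also have "(\<Prod>j\<in>UNIV - {i}. u $ j - l $ j) = (\<Prod>j\<in>UNIV - {i}. 2 * r)"
    by (intro prod.cong) (auto simp: u_def l_def)
  also have "\<dots> = (2 * r) ^ (CARD('d) - 1)" by (simp add: card_Diff_singleton)
  finally show ?thesis by (simp add: u_def l_def)
qed

lemma emeasure_cube:
  fixes x :: "real^'d"
  assumes "r \<ge> 0"
  shows "emeasure lborel (cbox (\<chi> j. x $ j - r) (\<chi> j. x $ j + r)) = ennreal ((2 * r) ^ CARD('d))"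
proof -
  define l u :: "real^'d" where "l = (\<chi> j. x $ j - r)" and "u = (\<chi> j. x $ j + r)"
  have lu: "l \<bullet> b \<le> u \<bullet> b" if "b \<in> Basis" for b
    using that assms by (auto simp: Basis_vec_def inner_axis l_def u_def)
  have "emeasure lborel (cbox l u) = ennreal (measure lborel (cbox l u))"
    by (simp add: emeasure_eq_measure2 emeasure_lborel_cbox_finite)
  also have "measure lborel (cbox l u) = (\<Prod>j\<in>UNIV. u $ j - l $ j)"
    using lu by (intro content_cbox_cart) (simp add: box_ne_empty)
  finally show ?thesis by (simp add: u_def l_def)
qed

lemma slab_borel:
  fixes x :: "real^'d"
  shows "{y :: real^'d. (\<forall>j. j \<noteq> i \<longrightarrow> \<bar>y $ j - x $ j\<bar> \<le> r) \<and> \<bar>y $ i\<bar> \<le> L} \<in> sets borel" (is "?S \<in> _")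
proof -
  have "closed ?S"
    by (intro closed_Collect_conj closed_Collect_all closed_Collect_imp closed_Collect_le continuous_intros) auto
  then show ?thesis by simp
qed

section \<open>Slicing caps by coordinate lines\<close>

definition cap_density :: "real \<Rightarrow> real^'d \<Rightarrow> real \<Rightarrow> real^'d \<Rightarrow> ennreal" where
  "cap_density \<mu> x r y = indicator (cap x r) y * ennreal (W \<mu> y)"

lemma cap_density_measurable [measurable]: "cap_density \<mu> x r \<in> borel_measurable borel"
  unfolding cap_density_def by measurable

lemma emeasure_nu_cap: "emeasure (nu \<mu>) (cap x r) = (\<integral>\<^sup>+y. cap_density \<mu> x r y \<partial>lborel)"
  by (simp add: emeasure_nu cap_subset cap_density_def)

lemma upd_measurable [measurable]: "upd y i \<in> borel_measurable borel"
proof -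
  have "upd y i = (\<lambda>t. y + (t - y $ i) *\<^sub>R axis i 1)" by (simp add: add_axis_eq_upd fun_eq_iff)
  then show ?thesis by simp
qed

lemma rho_upd:
  assumes "0 \<le> a" "a\<^sup>2 = 1 - (\<Sum>j\<in>UNIV - {i}. (y $ j)\<^sup>2)"
  shows "rho (upd y i t) = sqrt (a\<^sup>2 - t\<^sup>2)" "W \<mu> (upd y i t) = (a\<^sup>2 - t\<^sup>2) powr (\<mu> - 1/2)"
proof -
  have "1 - (norm (upd y i t))\<^sup>2 = a\<^sup>2 - t\<^sup>2" using assms by (simp add: norm_upd)
  then show "rho (upd y i t) = sqrt (a\<^sup>2 - t\<^sup>2)" "W \<mu> (upd y i t) = (a\<^sup>2 - t\<^sup>2) powr (\<mu> - 1/2)"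
    by (simp_all only: rho_def W_def)
qed

lemma cap_coord: "y \<in> cap x r \<Longrightarrow> \<bar>y $ j - x $ j\<bar> \<le> r"
  using component_le_norm_cart[of "y - x" j] dist_le_lift[of x y]
  by (auto simp: cap_def dist_norm norm_minus_commute)

lemma cap_rho: "y \<in> cap x r \<Longrightarrow> \<bar>rho y - rho x\<bar> \<le> r"
  using rho_lipschitz[of x y] by (auto simp: cap_def)

lemma norm_le_one_coord: "norm (y :: real^'d) \<le> 1 \<Longrightarrow> \<bar>y $ j\<bar> \<le> 1"
  using component_le_norm_cart[of y j] by linarith

lemma nn_integral_reflect:
  fixes f :: "real \<Rightarrow> ennreal"
  assumes [measurable]: "f \<in> borel_measurable borel"
  shows "(\<integral>\<^sup>+t. f (- t) \<partial>lborel) = (\<integral>\<^sup>+t. f t \<partial>lborel)"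
  using nn_integral_real_affine[of f "-1" 0] by simp

text \<open>On the slice \<open>|t| \<ge> \<kappa>/2\<close>, so the factor
  \<open>2|t|/\<kappa> \<ge> 1\<close> may be inserted; it is the Jacobian that makes the weight
  integrable in closed form. The heights met inside the cap fill an interval of length at most
  \<open>2r\<close>. The slice may meet either sign of \<open>t\<close>, hence
  \<open>g t + g (- t)\<close>.\<close>

lemma cap_slice_upper:
  fixes x y :: "real^'d"
  assumes x: "norm x \<le> 1" and k: "0 < \<kappa>" "\<kappa> \<le> \<bar>x $ i\<bar>" and r: "0 < r" "r \<le> \<kappa> / 2" and mu: "\<mu> \<ge> 0"
  shows "(\<integral>\<^sup>+t. cap_density \<mu> x r (upd y i t) \<partial>lborel) \<le> ennreal (8 / \<kappa> * r * (rho x + r) powr (2 * \<mu>))"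
proof (cases "\<exists>t. upd y i t \<in> cap x r")
  case False
  then have zero: "cap_density \<mu> x r (upd y i t) = 0" for t by (simp add: cap_density_def)
  show ?thesis by (simp only: zero) simp
next
  case True
  then obtain t0 where t0: "upd y i t0 \<in> cap x r" by blast
  define q where "q = (\<Sum>j\<in>UNIV - {i}. (y $ j)\<^sup>2)"
  have cap_norm: "q + t\<^sup>2 \<le> 1" if "upd y i t \<in> cap x r" for t
  proof -
    have "(norm (upd y i t))\<^sup>2 \<le> 1\<^sup>2" using that by (intro power_mono) (auto simp: cap_def)
    then show ?thesis by (simp add: norm_upd q_def)
  qed
  have "q \<le> 1" using cap_norm[OF t0] zero_le_power2[of t0] by linarith
  define a where "a = sqrt (1 - q)"
  have a: "0 \<le> a" "a\<^sup>2 = 1 - q" using \<open>q \<le> 1\<close> by (auto simp: a_def)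
  note upd_eq = rho_upd[OF a(1) a(2)[unfolded q_def]]
  \<comment> \<open>The heights within \<open>r\<close> of \<open>rho x\<close>, clipped to
    \<open>[0, a]\<close>, the range of heights on this line.\<close>
  define r1 r2 where "r1 = max 0 (rho x - r)" and "r2 = min a (rho x + r)"
  have between: "r1 \<le> sqrt (a\<^sup>2 - t\<^sup>2)" "sqrt (a\<^sup>2 - t\<^sup>2) \<le> r2" "t\<^sup>2 \<le> a\<^sup>2" if "upd y i t \<in> cap x r" for t
  proof -
    show "t\<^sup>2 \<le> a\<^sup>2" using cap_norm[OF that] a by simp
    then have "0 \<le> sqrt (a\<^sup>2 - t\<^sup>2)" "sqrt (a\<^sup>2 - t\<^sup>2) \<le> a" using a(1) by (auto intro: real_le_lsqrt)
    with cap_rho[OF that] show "r1 \<le> sqrt (a\<^sup>2 - t\<^sup>2)" "sqrt (a\<^sup>2 - t\<^sup>2) \<le> r2"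
      unfolding upd_eq r1_def r2_def by auto
  qed
  have r12: "0 \<le> r1" "r1 \<le> r2" "r2 \<le> a" "r2 - r1 \<le> 2 * r" "r2 \<le> rho x + r"
    using between[OF t0] rho_bounds[OF x] r a(1) by (auto simp: r1_def r2_def)
  define I where "I = {sqrt (a\<^sup>2 - r2\<^sup>2)..sqrt (a\<^sup>2 - r1\<^sup>2)}"
  define g where "g = (\<lambda>t. indicator I t * ennreal (t * (a\<^sup>2 - t\<^sup>2) powr (\<mu> - 1/2)))"
  have [measurable]: "g \<in> borel_measurable borel" unfolding g_def I_def by measurable
  have le: "cap_density \<mu> x r (upd y i t) \<le> ennreal (2 / \<kappa>) * (g t + g (- t))" for t
  proof (cases "upd y i t \<in> cap x r")
    case t: True
    define s where "s = sqrt (a\<^sup>2 - t\<^sup>2)"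
    have s: "r1 \<le> s" "s \<le> r2" "s\<^sup>2 = a\<^sup>2 - t\<^sup>2" using between[OF t] by (auto simp: s_def)
    have "\<bar>t\<bar> = sqrt (a\<^sup>2 - s\<^sup>2)" by (simp add: s)
    moreover have "r1\<^sup>2 \<le> s\<^sup>2" "s\<^sup>2 \<le> r2\<^sup>2" using s(1,2) r12 by (auto intro!: power_mono)
    ultimately have tI: "\<bar>t\<bar> \<in> I" by (auto simp: I_def)
    have "\<bar>t - x $ i\<bar> \<le> r" using cap_coord[OF t, of i] by simp
    then have "\<bar>t\<bar> \<ge> \<kappa> / 2" using k r by linarith
    then have "1 \<le> 2 / \<kappa> * \<bar>t\<bar>" using k by (simp add: field_simps)
    then have "1 * (a\<^sup>2 - t\<^sup>2) powr (\<mu> - 1/2) \<le> (2 / \<kappa> * \<bar>t\<bar>) * (a\<^sup>2 - t\<^sup>2) powr (\<mu> - 1/2)"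
      by (rule mult_right_mono) simp
    then have "cap_density \<mu> x r (upd y i t) \<le> ennreal (2 / \<kappa> * (\<bar>t\<bar> * (a\<^sup>2 - t\<^sup>2) powr (\<mu> - 1/2)))"
      unfolding cap_density_def upd_eq using t by (simp add: ennreal_leI mult.assoc)
    also have "\<dots> = ennreal (2 / \<kappa>) * g \<bar>t\<bar>" using tI k by (simp add: g_def flip: ennreal_mult)
    also have "\<dots> \<le> ennreal (2 / \<kappa>) * (g t + g (- t))"
      by (intro mult_left_mono) (auto simp: abs_if add_increasing add_increasing2)
    finally show ?thesis .
  qed (simp add: cap_density_def)
  have J: "(\<integral>\<^sup>+t. g t \<partial>lborel) \<le> ennreal (2 * r * (rho x + r) powr (2 * \<mu>))"
  proof -
    have "(\<integral>\<^sup>+t. g t \<partial>lborel) = ennreal ((r2 powr (2 * \<mu> + 1) - r1 powr (2 * \<mu> + 1)) / (2 * \<mu> + 1))"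
      unfolding g_def I_def by (rule slice_integral) (use r12 mu in auto)
    also have "\<dots> \<le> ennreal ((r2 - r1) * r2 powr (2 * \<mu>))"
      by (intro ennreal_leI powr_diff_bounds) (use r12 mu in auto)
    also have "\<dots> \<le> ennreal (2 * r * (rho x + r) powr (2 * \<mu>))"
      by (intro ennreal_leI mult_mono powr_mono2) (use r12 mu r in auto)
    finally show ?thesis .
  qed
  have "(\<integral>\<^sup>+t. cap_density \<mu> x r (upd y i t) \<partial>lborel) \<le> (\<integral>\<^sup>+t. ennreal (2 / \<kappa>) * (g t + g (- t)) \<partial>lborel)"
    by (intro nn_integral_mono le)
  also have "\<dots> = ennreal (2 / \<kappa>) * ((\<integral>\<^sup>+t. g t \<partial>lborel) + (\<integral>\<^sup>+t. g t \<partial>lborel))"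
    by (subst nn_integral_cmult) (simp_all add: nn_integral_add nn_integral_reflect)
  also have "\<dots> \<le> ennreal (2 / \<kappa>) * (ennreal (2 * r * (rho x + r) powr (2 * \<mu>)) + ennreal (2 * r * (rho x + r) powr (2 * \<mu>)))"
    by (intro mult_left_mono add_mono J) auto
  also have "\<dots> = ennreal (8 / \<kappa> * r * (rho x + r) powr (2 * \<mu>))"
    using k r by (simp flip: ennreal_plus ennreal_mult)
  finally show ?thesis .
qed

text \<open>Integrates the slice bound over the remaining coordinates by averaging over translations
  with \<open>|t| \<le> 1\<close>. A cap lies in \<open>|y_i| \<le> 1\<close>, so only base points
  with \<open>|y_i| \<le> 2\<close> contribute, and their slab has volume
  \<open>4 * (2r)^(d-1)\<close>.\<close>

lemma cap_upper_edge:
  fixes x :: "real^'d"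
  assumes x: "norm x \<le> 1" and k: "0 < \<kappa>" "\<kappa> \<le> \<bar>x $ i\<bar>" and r: "0 < r" "r \<le> \<kappa> / 2" and mu: "\<mu> \<ge> 0"
  shows "emeasure (nu \<mu>) (cap x r) \<le> ennreal (8 / \<kappa> * (2 * r) ^ CARD('d) * (rho x + r) powr (2 * \<mu>))"
proof -
  define B where "B = 8 / \<kappa> * r * (rho x + r) powr (2 * \<mu>)"
  have B0: "B \<ge> 0" using k r by (simp add: B_def)
  define S where "S = {y :: real^'d. (\<forall>j. j \<noteq> i \<longrightarrow> \<bar>y $ j - x $ j\<bar> \<le> r) \<and> \<bar>y $ i\<bar> \<le> 2}"
  have eS: "emeasure lborel S = ennreal (4 * (2 * r) ^ (CARD('d) - 1))"
    unfolding S_def using emeasure_slab[of r 2 i x] r by simp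
  have S [measurable]: "S \<in> sets borel" unfolding S_def by (rule slab_borel)
  have inner: "(\<integral>\<^sup>+t. indicator {-1..1} t * cap_density \<mu> x r (y + t *\<^sub>R axis i 1) \<partial>lborel) \<le> ennreal B * indicator S y" for y
  proof (cases "y \<in> S")
    case True
    have "(\<integral>\<^sup>+t. indicator {-1..1} t * cap_density \<mu> x r (y + t *\<^sub>R axis i 1) \<partial>lborel)
        \<le> (\<integral>\<^sup>+t. cap_density \<mu> x r (upd y i (y $ i + t)) \<partial>lborel)"
      by (intro nn_integral_mono) (auto simp: add_axis_eq_upd indicator_def)
    also have "\<dots> = (\<integral>\<^sup>+t. cap_density \<mu> x r (upd y i t) \<partial>lborel)"
      using nn_integral_real_affine[of "\<lambda>t. cap_density \<mu> x r (upd y i t)" 1 "y $ i"] by simp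
    also have "\<dots> \<le> ennreal B" unfolding B_def by (rule cap_slice_upper[OF assms])
    finally show ?thesis using True by simp
  next
    case False
    have zero: "indicator {-1..1} t * cap_density \<mu> x r (y + t *\<^sub>R axis i 1) = 0" for t
    proof (rule ccontr)
      assume "\<not> ?thesis"
      then have t: "\<bar>t\<bar> \<le> 1" "upd y i (y $ i + t) \<in> cap x r"
        by (auto simp: cap_density_def add_axis_eq_upd indicator_def split: if_splits)
      then have "\<bar>y $ i + t\<bar> \<le> 1" using norm_le_one_coord[of "upd y i (y $ i + t)" i] by (auto simp: cap_def)
      then have "\<bar>y $ i\<bar> \<le> 2" using t(1) by linarith
      moreover have "\<bar>y $ j - x $ j\<bar> \<le> r" if "j \<noteq> i" for j
        using cap_coord[OF t(2), of j] that by simp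
      ultimately show False using False by (simp add: S_def)
    qed
    show ?thesis by (simp only: zero) simp
  qed
  have "2 * emeasure (nu \<mu>) (cap x r) = emeasure lborel {-1..1::real} * (\<integral>\<^sup>+y. cap_density \<mu> x r y \<partial>lborel)"
    by (simp add: emeasure_nu_cap)
  also have "\<dots> = (\<integral>\<^sup>+y. (\<integral>\<^sup>+t. indicator {-1..1} t * cap_density \<mu> x r (y + t *\<^sub>R axis i 1) \<partial>lborel) \<partial>lborel)"
    by (rule nn_integral_line_average) auto
  also have "\<dots> \<le> (\<integral>\<^sup>+y. ennreal B * indicator S y \<partial>lborel)"
    by (intro nn_integral_mono inner)
  also have "\<dots> = ennreal B * ennreal (4 * (2 * r) ^ (CARD('d) - 1))"
    by (simp add: nn_integral_cmult_indicator eS)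
  also have "\<dots> = 2 * ennreal (8 / \<kappa> * (2 * r) ^ CARD('d) * (rho x + r) powr (2 * \<mu>))"
  proof -
    have "(2 * r) ^ CARD('d) = 2 * r * (2 * r) ^ (CARD('d) - 1)"
      by (metis One_nat_def Suc_pred power_Suc zero_less_card_finite)
    then have "B * (4 * (2 * r) ^ (CARD('d) - 1)) = 2 * (8 / \<kappa> * (2 * r) ^ CARD('d) * (rho x + r) powr (2 * \<mu>))"
      by (simp add: B_def)
    then show ?thesis using B0 r k by (metis (no_types, opaque_lifting) ennreal_mult ennreal_numeral mult_nonneg_nonneg zero_le_numeral zero_le_power less_imp_le ennreal_mult' )
  qed
  finally show ?thesis by (simp add: ennreal_mult_le_mult_iff)
qed

text \<open>Far from the boundary \<open>W \<le> 2\<close>, so the volume of a cube around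
  \<open>x\<close> is enough. The factor \<open>4 powr \<mu>\<close> compensates
  \<open>(rho x + r) powr (2 * \<mu>)\<close>, whose base is at least \<open>1/2\<close>.\<close>

lemma cap_upper_center:
  fixes x :: "real^'d"
  assumes x: "norm x \<le> 1/2" and r: "0 < r" "r \<le> 1/4" and mu: "\<mu> \<ge> 0"
  shows "emeasure (nu \<mu>) (cap x r) \<le> ennreal (2 * 4 powr \<mu> * (2 * r) ^ CARD('d) * (rho x + r) powr (2 * \<mu>))"
proof -
  define l u :: "real^'d" where "l = (\<chi> j. x $ j - r)" and "u = (\<chi> j. x $ j + r)"
  have sub: "cap x r \<subseteq> cbox l u"
    using cap_coord[of _ x r] by (auto simp: mem_box_cart l_def u_def abs_le_iff) (smt (verit))+
  have box: "emeasure lborel (cbox l u) = ennreal ((2 * r) ^ CARD('d))"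
    unfolding l_def u_def by (rule emeasure_cube) (use r in simp)
  have "(norm x)\<^sup>2 \<le> (1/2)\<^sup>2" using x by (intro power_mono) auto
  then have "(3/4)\<^sup>2 \<le> 1 - (norm x)\<^sup>2" by (simp add: power2_eq_square)
  then have rx: "3/4 \<le> rho x" unfolding rho_def by (rule real_le_rsqrt)
  have W: "W \<mu> y \<le> 2" if "y \<in> cap x r" for y
  proof -
    have ny: "norm y \<le> 1" using that by (auto simp: cap_def)
    have "1/2 \<le> rho y" using cap_rho[OF that] rx r by linarith
    then have "(1/2)\<^sup>2 \<le> (rho y)\<^sup>2" by (intro power_mono) auto
    then have p: "1/4 \<le> 1 - (norm y)\<^sup>2" unfolding rho_sq[OF ny] by (simp add: power2_eq_square)
    have "W \<mu> y \<le> (1 - (norm y)\<^sup>2) powr (- (1/2))"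
      unfolding W_def using p mu by (intro powr_mono') auto
    also have "\<dots> \<le> (1/4) powr (- (1/2))" using p by (intro powr_mono2') auto
    also have "\<dots> = 2" by (simp add: powr_minus powr_half_sqrt real_sqrt_divide)
    finally show ?thesis .
  qed
  have "emeasure (nu \<mu>) (cap x r) \<le> (\<integral>\<^sup>+y. 2 * indicator (cbox l u) y \<partial>lborel)"
    unfolding emeasure_nu_cap cap_density_def
    using sub W by (intro nn_integral_mono) (auto simp: indicator_def ennreal_le_iff2 simp flip: ennreal_numeral intro!: ennreal_leI)
  also have "\<dots> = 2 * ennreal ((2 * r) ^ CARD('d))" by (simp add: nn_integral_cmult_indicator box)
  also have "\<dots> = ennreal (2 * (2 * r) ^ CARD('d))" using r by (simp add: ennreal_mult)
  also have "\<dots> \<le> ennreal (2 * 4 powr \<mu> * (2 * r) ^ CARD('d) * (rho x + r) powr (2 * \<mu>))"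
  proof (rule ennreal_leI)
    have "1 = 4 powr \<mu> * (1/2) powr (2 * \<mu>)"
      using powr_powr[of "1/2" 2 \<mu>] by (simp add: powr_divide)
    also have "\<dots> \<le> 4 powr \<mu> * (rho x + r) powr (2 * \<mu>)"
      using rx r mu by (intro mult_left_mono powr_mono2) auto
    finally have "2 * (2 * r) ^ CARD('d) * 1 \<le> 2 * (2 * r) ^ CARD('d) * (4 powr \<mu> * (rho x + r) powr (2 * \<mu>))"
      using r by (intro mult_left_mono) auto
    then show "2 * (2 * r) ^ CARD('d) \<le> 2 * 4 powr \<mu> * (2 * r) ^ CARD('d) * (rho x + r) powr (2 * \<mu>)"
      by (simp add: mult_ac)
  qed
  finally show ?thesis .
qed

text \<open>Let the other coordinates vary by \<open>h = \<eta> * r\<close> and take heights between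
  \<open>rho x + h/2\<close> and \<open>rho x + h\<close>. Then \<open>t^2\<close> differs from
  \<open>x_i^2\<close> by at most \<open>3dh\<close>, so \<open>t\<close> differs from
  \<open>x_i\<close> by at most \<open>3dh/\<kappa>\<close>. Coordinate differences and height
  difference add up to \<open>dh(1 + 3/\<kappa>)\<close>; the value of \<open>\<eta>\<close> makes
  this equal to \<open>r\<close>.\<close>

lemma cap_lower_edge:
  fixes x :: "real^'d"
  assumes x: "norm x \<le> 1" and k: "0 < \<kappa>" "\<kappa> \<le> \<bar>x $ i\<bar>" and r: "0 < r" "r \<le> \<kappa>" and mu: "\<mu> \<ge> 0"
    and \<eta>: "\<eta> = \<kappa> / (real CARD('d) * (\<kappa> + 3))"
  shows "emeasure (nu \<mu>) (cap x r) \<ge> ennreal ((2 * \<eta> * r) ^ CARD('d) / 8 * (rho x + \<eta> * r / 2) powr (2 * \<mu>))"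
proof -
  define d where "d = real CARD('d)"
  have d1: "d \<ge> 1" using zero_less_card_finite[where 'a='d] by (simp add: d_def)
  have k1: "\<kappa> \<le> 1" using k norm_le_one_coord[OF x, of i] by linarith
  have dn: "d * \<eta> * (\<kappa> + 3) = \<kappa>" using \<eta> d1 k by (simp add: d_def)
  have n0: "\<eta> > 0" using \<eta> d1 k by (simp add: d_def)
  have "d * \<eta> * 3 \<le> d * \<eta> * (\<kappa> + 3)" using d1 n0 k by (intro mult_left_mono) auto
  then have dn3: "3 * (d * \<eta>) \<le> \<kappa>" using dn by simp
  have n1: "\<eta> \<le> 1"
  proof -
    have "1 * \<eta> \<le> d * \<eta>" using d1 n0 by (intro mult_right_mono) auto
    then show ?thesis using dn3 k1 k by linarith
  qed
  define h where "h = \<eta> * r"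
  have h: "0 < h" "h \<le> 1" using n0 n1 r k1 mult_mono[of \<eta> 1 r 1] by (auto simp: h_def)
  have dh: "3 * (d * h) \<le> \<kappa> * \<kappa>" "d * h * (1 + 3 / \<kappa>) = r"
  proof -
    have "3 * (d * \<eta>) * r \<le> \<kappa> * \<kappa>" using dn3 r k by (intro mult_mono) auto
    then show "3 * (d * h) \<le> \<kappa> * \<kappa>" by (simp add: h_def mult_ac)
    have "d * h * (1 + 3 / \<kappa>) = d * \<eta> * (\<kappa> + 3) / \<kappa> * r" using k by (simp add: h_def field_simps)
    then show "d * h * (1 + 3 / \<kappa>) = r" unfolding dn using k by simp
  qed
  define B where "B = h / 2 * (rho x + h / 2) powr (2 * \<mu>)"
  have B0: "B \<ge> 0" using h by (simp add: B_def)
  define S where "S = {y :: real^'d. (\<forall>j. j \<noteq> i \<longrightarrow> \<bar>y $ j - x $ j\<bar> \<le> h) \<and> \<bar>y $ i\<bar> \<le> 1}"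
  have eS: "emeasure lborel S = ennreal (2 * (2 * h) ^ (CARD('d) - 1))"
    unfolding S_def using emeasure_slab[of h 1 i x] h by simp
  have S [measurable]: "S \<in> sets borel" unfolding S_def by (rule slab_borel)
  have inner: "ennreal B \<le> (\<integral>\<^sup>+t. indicator {-2..2} t * cap_density \<mu> x r (y + t *\<^sub>R axis i 1) \<partial>lborel)"
    if y: "y \<in> S" for y
  proof -
    define q where "q = (\<Sum>j\<in>UNIV - {i}. (y $ j)\<^sup>2)"
    define qx where "qx = (\<Sum>j\<in>UNIV - {i}. (x $ j)\<^sup>2)"
    have "upd x i (x $ i) = x" by (simp add: vec_eq_iff)
    then have qx: "(rho x)\<^sup>2 = 1 - qx - (x $ i)\<^sup>2" using norm_upd[of x i "x $ i"] rho_sq[OF x] by (simp add: qx_def)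
    have rx: "0 \<le> rho x" "rho x \<le> 1" using rho_bounds[OF x] by auto
    have yx: "\<bar>y $ j - x $ j\<bar> \<le> h" if "j \<noteq> i" for j using y that by (simp add: S_def)
    have qq: "\<bar>q - qx\<bar> \<le> 3 * h * (d - 1)"
    proof -
      have "\<bar>q - qx\<bar> \<le> (\<Sum>j\<in>UNIV - {i}. \<bar>(y $ j)\<^sup>2 - (x $ j)\<^sup>2\<bar>)"
        unfolding q_def qx_def sum_subtractf[symmetric] by (rule sum_abs)
      also have "\<dots> \<le> (\<Sum>j\<in>UNIV - {i}. 3 * h)"
      proof (rule sum_mono)
        fix j assume "j \<in> UNIV - {i}"
        then have 1: "\<bar>y $ j - x $ j\<bar> \<le> h" using yx by auto
        then have "\<bar>y $ j + x $ j\<bar> \<le> 3" using norm_le_one_coord[OF x, of j] h by linarith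
        then have "\<bar>y $ j - x $ j\<bar> * \<bar>y $ j + x $ j\<bar> \<le> h * 3" using 1 h by (intro mult_mono) auto
        moreover have "(y $ j)\<^sup>2 - (x $ j)\<^sup>2 = (y $ j - x $ j) * (y $ j + x $ j)"
          by (simp add: power2_eq_square algebra_simps)
        ultimately show "\<bar>(y $ j)\<^sup>2 - (x $ j)\<^sup>2\<bar> \<le> 3 * h" by (simp add: abs_mult)
      qed
      also have "\<dots> = 3 * h * (d - 1)"
        by (simp add: d_def card_Diff_singleton of_nat_diff Suc_leI)
      finally show ?thesis .
    qed
    \<comment> \<open>Heights above \<open>rho x\<close> keep the weight at least of order
      \<open>h powr (2 * \<mu>)\<close> even when \<open>rho x = 0\<close>.\<close>
    define r1 r2 where "r1 = rho x + h / 2" and "r2 = rho x + h"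
    have r12: "0 \<le> r1" "r1 \<le> r2" "r2 - r1 = h / 2" using rx h by (auto simp: r1_def r2_def)
    have r2sq: "r2\<^sup>2 \<le> (rho x)\<^sup>2 + 3 * h"
    proof -
      have "r2\<^sup>2 = (rho x)\<^sup>2 + h * (2 * rho x + h)" by (simp add: r2_def power2_eq_square algebra_simps)
      moreover have "h * (2 * rho x + h) \<le> h * 3" using rx h by (intro mult_left_mono) auto
      ultimately show ?thesis by simp
    qed
    have "\<kappa> * \<kappa> \<le> (x $ i)\<^sup>2" using power_mono[OF k(2), of 2] k by (simp add: power2_eq_square)
    moreover have "3 * h * (d - 1) + 3 * h = 3 * (d * h)" by (simp add: algebra_simps)
    ultimately have r2a: "r2\<^sup>2 \<le> 1 - q" using r2sq qq qx dh(1) by linarith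
    then have "q \<le> 1" using zero_le_power2[of r2] by linarith
    define a where "a = sqrt (1 - q)"
    have a: "0 \<le> a" "a\<^sup>2 = 1 - q" using \<open>q \<le> 1\<close> by (auto simp: a_def)
    have r2a': "r2 \<le> a" unfolding a_def by (rule real_le_rsqrt[OF r2a])
    note upd_eq = rho_upd[OF a(1) a(2)[unfolded q_def]]
    define I where "I = {sqrt (a\<^sup>2 - r2\<^sup>2)..sqrt (a\<^sup>2 - r1\<^sup>2)}"
    define g where "g = (\<lambda>t. indicator I t * ennreal (t * (a\<^sup>2 - t\<^sup>2) powr (\<mu> - 1/2)))"
    have [measurable]: "g \<in> borel_measurable borel" unfolding g_def I_def by measurable
    \<comment> \<open>Selects the half of the line on the side of \<open>x\<close>; points on the
      other half may be far from \<open>x\<close>.\<close>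
    define \<sigma> where "\<sigma> = (if x $ i \<ge> 0 then 1 else -1 :: real)"
    have sg: "\<sigma> * \<sigma> = 1" "\<bar>\<sigma>\<bar> = 1" "\<sigma> * x $ i = \<bar>x $ i\<bar>" by (auto simp: \<sigma>_def)
    have le: "g (\<sigma> * s) \<le> indicator {-2..2} (s - y $ i) * cap_density \<mu> x r (upd y i s)" for s
    proof (cases "\<sigma> * s \<in> I")
      case True
      have r2a2: "0 \<le> a\<^sup>2 - r2\<^sup>2" using r2a a by simp
      then have "0 \<le> sqrt (a\<^sup>2 - r2\<^sup>2)" by simp
      then have s0: "0 \<le> \<sigma> * s" using True unfolding I_def by (simp only: atLeastAtMost_iff) linarith
      have s2: "(\<sigma> * s)\<^sup>2 = s\<^sup>2" using sg by (simp add: power_mult_distrib power2_eq_square)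
      have "(sqrt (a\<^sup>2 - r2\<^sup>2))\<^sup>2 \<le> (\<sigma> * s)\<^sup>2" using True r2a2 unfolding I_def by (intro power_mono) auto
      moreover have "r1\<^sup>2 \<le> r2\<^sup>2" using r12 by (intro power_mono) auto
      moreover have "(\<sigma> * s)\<^sup>2 \<le> (sqrt (a\<^sup>2 - r1\<^sup>2))\<^sup>2" using True s0 unfolding I_def by (intro power_mono) auto
      ultimately have s3: "a\<^sup>2 - r2\<^sup>2 \<le> s\<^sup>2" "s\<^sup>2 \<le> a\<^sup>2 - r1\<^sup>2" "0 \<le> a\<^sup>2 - r1\<^sup>2"
        unfolding s2 using r2a2 by auto
      define v where "v = sqrt (a\<^sup>2 - s\<^sup>2)"
      have vv: "0 \<le> a\<^sup>2 - s\<^sup>2" using s3 zero_le_power2[of r1] by linarith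
      then have v: "v\<^sup>2 = a\<^sup>2 - s\<^sup>2" by (simp add: v_def)
      have "r1 \<le> v" unfolding v_def by (rule real_le_rsqrt) (use s3 in auto)
      moreover have "v \<le> r2" unfolding v_def by (rule real_le_lsqrt) (use s3 r12 in auto)
      ultimately have vr: "\<bar>v - rho x\<bar> \<le> h" "0 \<le> v" using r12 rx h unfolding r1_def r2_def by auto
      have vsq: "(rho x)\<^sup>2 \<le> v\<^sup>2" "v\<^sup>2 \<le> r2\<^sup>2"
        using \<open>r1 \<le> v\<close> \<open>v \<le> r2\<close> rx h by (auto intro!: power_mono simp: r1_def)
      have "s\<^sup>2 - (x $ i)\<^sup>2 = (qx - q) + ((rho x)\<^sup>2 - v\<^sup>2)" using v a qx by simp
      then have sx2: "\<bar>s\<^sup>2 - (x $ i)\<^sup>2\<bar> \<le> 3 * (d * h)"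
        using qq vsq r2sq \<open>3 * h * (d - 1) + 3 * h = 3 * (d * h)\<close> by linarith
      have sx: "\<bar>s - x $ i\<bar> \<le> 3 * (d * h) / \<kappa>"
      proof -
        have "\<bar>s - x $ i\<bar> = \<bar>\<sigma> * s - \<bar>x $ i\<bar>\<bar>"
          using sg by (metis abs_mult mult_1 right_diff_distrib)
        moreover have "\<bar>\<sigma> * s - \<bar>x $ i\<bar>\<bar> * (\<sigma> * s + \<bar>x $ i\<bar>) = \<bar>s\<^sup>2 - (x $ i)\<^sup>2\<bar>"
        proof -
          have "(\<sigma> * s - \<bar>x $ i\<bar>) * (\<sigma> * s + \<bar>x $ i\<bar>) = (\<sigma> * s)\<^sup>2 - (x $ i)\<^sup>2"
            by (simp add: algebra_simps power2_eq_square)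
          then show ?thesis using s0 unfolding s2 by (metis abs_mult abs_of_nonneg add_nonneg_nonneg abs_ge_zero)
        qed
        moreover have "\<bar>\<sigma> * s - \<bar>x $ i\<bar>\<bar> * \<kappa> \<le> \<bar>\<sigma> * s - \<bar>x $ i\<bar>\<bar> * (\<sigma> * s + \<bar>x $ i\<bar>)"
          using s0 k by (intro mult_left_mono) auto
        ultimately have "\<bar>s - x $ i\<bar> * \<kappa> \<le> 3 * (d * h)" using sx2 by (metis order_trans)
        then show ?thesis using k by (simp add: field_simps)
      qed
      define z where "z = upd y i s"
      have nz: "norm z \<le> 1"
      proof -
        have "(norm z)\<^sup>2 \<le> 1\<^sup>2" using vv a by (simp add: z_def norm_upd q_def)
        then show ?thesis by (rule power2_le_imp_le) simp
      qed
      have "dist x z \<le> (\<Sum>j\<in>UNIV. \<bar>(x - z) $ j\<bar>)" unfolding dist_norm by (rule norm_le_l1_cart)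
      also have "\<dots> = \<bar>x $ i - s\<bar> + (\<Sum>j\<in>UNIV - {i}. \<bar>(x - z) $ j\<bar>)"
        by (subst sum.remove[of UNIV i]) (auto simp: z_def)
      also have "(\<Sum>j\<in>UNIV - {i}. \<bar>(x - z) $ j\<bar>) \<le> (\<Sum>j\<in>UNIV - {i}. h)"
        using yx by (intro sum_mono) (auto simp: z_def abs_minus_commute)
      also have "\<dots> = (d - 1) * h" by (simp add: d_def card_Diff_singleton of_nat_diff Suc_leI)
      finally have "dist x z \<le> 3 * (d * h) / \<kappa> + (d - 1) * h" using sx by (simp add: abs_minus_commute)
      moreover have "\<bar>rho x - rho z\<bar> \<le> h" using vr(1) upd_eq(1)[of s] by (simp add: z_def v_def abs_minus_commute)
      ultimately have "chord x z \<le> 3 * (d * h) / \<kappa> + (d - 1) * h + h"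
        using dist_lift_le[of x z] by linarith
      also have "\<dots> = d * h * (1 + 3 / \<kappa>)" by (simp add: algebra_simps)
      finally have zc: "z \<in> cap x r" using nz dh(2) by (simp add: cap_def)
      have "\<bar>s\<bar> \<le> 1" using norm_le_one_coord[OF nz, of i] by (simp add: z_def)
      then have ss: "\<sigma> * s \<le> 1" "s - y $ i \<in> {-2..2}"
        using sg y by (auto simp: S_def abs_le_iff \<sigma>_def split: if_splits)
      have "g (\<sigma> * s) = ennreal (\<sigma> * s * (a\<^sup>2 - s\<^sup>2) powr (\<mu> - 1/2))"
        using True s2 by (simp add: g_def)
      also have "\<dots> \<le> ennreal (1 * (a\<^sup>2 - s\<^sup>2) powr (\<mu> - 1/2))"
        using ss(1) by (intro ennreal_leI mult_right_mono) auto
      also have "\<dots> = indicator {-2..2} (s - y $ i) * cap_density \<mu> x r (upd y i s)"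
        using zc ss(2) by (simp add: cap_density_def z_def upd_eq)
      finally show ?thesis .
    qed (simp add: g_def)
    have "ennreal B = ennreal ((r2 - r1) * r1 powr (2 * \<mu>))" unfolding B_def r12 by (simp add: r1_def)
    also have "\<dots> \<le> ennreal ((r2 powr (2 * \<mu> + 1) - r1 powr (2 * \<mu> + 1)) / (2 * \<mu> + 1))"
      by (intro ennreal_leI powr_diff_bounds) (use r12 mu in auto)
    also have "\<dots> = (\<integral>\<^sup>+t. g t \<partial>lborel)"
      unfolding g_def I_def by (rule slice_integral[symmetric]) (use r12 r2a' mu in auto)
    also have "\<dots> = (\<integral>\<^sup>+s. g (\<sigma> * s) \<partial>lborel)"
      by (auto simp: \<sigma>_def nn_integral_reflect)
    also have "\<dots> \<le> (\<integral>\<^sup>+s. indicator {-2..2} (s - y $ i) * cap_density \<mu> x r (upd y i s) \<partial>lborel)"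
      by (intro nn_integral_mono le)
    also have "\<dots> = (\<integral>\<^sup>+t. indicator {-2..2} t * cap_density \<mu> x r (upd y i (y $ i + t)) \<partial>lborel)"
      using nn_integral_real_affine[of "\<lambda>s. indicator {-2..2} (s - y $ i) * cap_density \<mu> x r (upd y i s)" 1 "y $ i"] by simp
    finally show ?thesis by (simp add: add_axis_eq_upd)
  qed
  have "ennreal B * ennreal (2 * (2 * h) ^ (CARD('d) - 1)) = (\<integral>\<^sup>+y. ennreal B * indicator S y \<partial>lborel)"
    by (simp add: nn_integral_cmult_indicator eS)
  also have "\<dots> \<le> (\<integral>\<^sup>+y. (\<integral>\<^sup>+t. indicator {-2..2} t * cap_density \<mu> x r (y + t *\<^sub>R axis i 1) \<partial>lborel) \<partial>lborel)"
    using inner by (intro nn_integral_mono) (auto simp: indicator_def)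
  also have "\<dots> = emeasure lborel {-2..2::real} * (\<integral>\<^sup>+y. cap_density \<mu> x r y \<partial>lborel)"
    by (rule nn_integral_line_average[symmetric]) auto
  also have "\<dots> = 4 * emeasure (nu \<mu>) (cap x r)" by (simp add: emeasure_nu_cap)
  finally have "ennreal B * ennreal (2 * (2 * h) ^ (CARD('d) - 1)) \<le> 4 * emeasure (nu \<mu>) (cap x r)" .
  moreover have "ennreal B * ennreal (2 * (2 * h) ^ (CARD('d) - 1)) =
      4 * ennreal ((2 * \<eta> * r) ^ CARD('d) / 8 * (rho x + \<eta> * r / 2) powr (2 * \<mu>))"
  proof -
    have "(2 * h) ^ CARD('d) = 2 * h * (2 * h) ^ (CARD('d) - 1)"
      by (metis One_nat_def Suc_pred power_Suc zero_less_card_finite)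
    then have "B * (2 * (2 * h) ^ (CARD('d) - 1)) = 4 * ((2 * h) ^ CARD('d) / 8 * (rho x + h / 2) powr (2 * \<mu>))"
      by (simp add: B_def)
    then have "ennreal B * ennreal (2 * (2 * h) ^ (CARD('d) - 1)) = 4 * ennreal ((2 * h) ^ CARD('d) / 8 * (rho x + h / 2) powr (2 * \<mu>))"
      using B0 h by (metis (no_types, opaque_lifting) ennreal_mult' ennreal_numeral zero_le_numeral)
    then show ?thesis by (simp add: h_def mult.assoc)
  qed
  ultimately have "4 * ennreal ((2 * \<eta> * r) ^ CARD('d) / 8 * (rho x + \<eta> * r / 2) powr (2 * \<mu>)) \<le> 4 * emeasure (nu \<mu>) (cap x r)"
    by simp
  then show ?thesis by (simp add: ennreal_mult_le_mult_iff)
qed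

text \<open>Far from the boundary the height is Lipschitz with constant 4, so the chord is at most 5
  times the distance. A cube of half side \<open>r/(5d)\<close> therefore fits into the cap. One
  factor \<open>(1/4) powr \<mu>\<close> bounds \<open>W\<close> from below, the other pays for
  \<open>rho x + r \<le> 2\<close>.\<close>

lemma cap_lower_center:
  fixes x :: "real^'d"
  assumes x: "norm x \<le> 1/2" and r: "0 < r" "r \<le> 1" and mu: "\<mu> \<ge> 0" and \<eta>: "\<eta> = 1 / (5 * real CARD('d))"
  shows "emeasure (nu \<mu>) (cap x r) \<ge> ennreal ((1/16) powr \<mu> * (2 * \<eta> * r) ^ CARD('d) * (rho x + r) powr (2 * \<mu>))"
proof -
  define h where "h = \<eta> * r"
  define l u :: "real^'d" where "l = (\<chi> j. x $ j - h)" and "u = (\<chi> j. x $ j + h)"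
  have n0: "\<eta> > 0" using \<eta> by simp
  then have h: "h > 0" using r by (simp add: h_def)
  have box: "emeasure lborel (cbox l u) = ennreal ((2 * h) ^ CARD('d))"
    unfolding l_def u_def by (rule emeasure_cube) (use h in simp)
  have rx: "1/2 \<le> rho x" "rho x \<le> 1"
  proof -
    have "(norm x)\<^sup>2 \<le> (1/2)\<^sup>2" using x by (intro power_mono) auto
    then have "(1/2)\<^sup>2 \<le> 1 - (norm x)\<^sup>2" by (simp add: power2_eq_square)
    then show "1/2 \<le> rho x" unfolding rho_def by (rule real_le_rsqrt)
    show "rho x \<le> 1" using rho_bounds x by force
  qed
  have sub: "y \<in> cap x r \<and> norm y \<le> 3/4" if y: "y \<in> cbox l u" for y
  proof -
    have "dist x y \<le> (\<Sum>j\<in>UNIV. \<bar>(x - y) $ j\<bar>)" unfolding dist_norm by (rule norm_le_l1_cart)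
    also have "\<dots> \<le> (\<Sum>j\<in>(UNIV :: 'd set). h)"
      using y by (intro sum_mono) (auto simp: mem_box_cart l_def u_def abs_le_iff, (smt (verit))+)
    also have "\<dots> = r / 5" by (simp add: h_def \<eta>)
    finally have d: "dist x y \<le> r / 5" .
    then have "norm y \<le> norm x + r / 5" using norm_triangle_ineq2[of y x] by (simp add: dist_norm norm_minus_commute)
    then have ny: "norm y \<le> 3/4" using x r by linarith
    have "\<bar>rho x - rho y\<bar> * (1/2) \<le> \<bar>rho x - rho y\<bar> * \<bar>rho x + rho y\<bar>"
      using rx rho_bounds(1)[of y] ny by (intro mult_left_mono) auto
    also have "\<dots> = \<bar>(rho x)\<^sup>2 - (rho y)\<^sup>2\<bar>"
      by (simp add: power2_eq_square algebra_simps flip: abs_mult)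
    also have "\<dots> = \<bar>norm y - norm x\<bar> * \<bar>norm y + norm x\<bar>"
    proof -
      have "(rho x)\<^sup>2 - (rho y)\<^sup>2 = (norm y - norm x) * (norm y + norm x)"
        using rho_sq[of x] rho_sq[of y] ny x by (simp add: power2_eq_square algebra_simps)
      then show ?thesis by (simp only: abs_mult)
    qed
    also have "\<dots> \<le> dist x y * 2"
      using norm_triangle_ineq3[of y x] ny x by (intro mult_mono) (auto simp: dist_norm norm_minus_commute)
    finally have "\<bar>rho x - rho y\<bar> \<le> 4 * dist x y" by simp
    with dist_lift_le[of x y] have "chord x y \<le> 5 * dist x y" by simp
    then show ?thesis using d ny by (simp add: cap_def)
  qed
  have W: "(1/4) powr \<mu> \<le> W \<mu> y" if "norm y \<le> 3/4" for y :: "real^'d"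
  proof -
    have "(norm y)\<^sup>2 \<le> (3/4)\<^sup>2" using that by (intro power_mono) auto
    then have p: "1/4 \<le> 1 - (norm y)\<^sup>2" by (simp add: power2_eq_square)
    have "(1/4) powr \<mu> \<le> (1 - (norm y)\<^sup>2) powr \<mu>" using p mu by (intro powr_mono2) auto
    also have "\<dots> \<le> W \<mu> y" unfolding W_def using p by (intro powr_mono') auto
    finally show ?thesis .
  qed
  have "ennreal ((1/16) powr \<mu> * (2 * h) ^ CARD('d) * (rho x + r) powr (2 * \<mu>)) \<le> ennreal ((1/4) powr \<mu> * (2 * h) ^ CARD('d))"
  proof (rule ennreal_leI)
    have "(rho x + r) powr (2 * \<mu>) \<le> 2 powr (2 * \<mu>)" using rx r mu by (intro powr_mono2) auto
    also have "\<dots> = 4 powr \<mu>" using powr_powr[of 2 2 \<mu>] by simp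
    finally have "(1/16) powr \<mu> * (rho x + r) powr (2 * \<mu>) \<le> (1/16) powr \<mu> * 4 powr \<mu>"
      by (intro mult_left_mono) auto
    also have "\<dots> = (1/4) powr \<mu>" by (simp flip: powr_mult)
    finally have "(1/16) powr \<mu> * (rho x + r) powr (2 * \<mu>) * (2 * h) ^ CARD('d) \<le> (1/4) powr \<mu> * (2 * h) ^ CARD('d)"
      using h by (intro mult_right_mono) auto
    then show "(1/16) powr \<mu> * (2 * h) ^ CARD('d) * (rho x + r) powr (2 * \<mu>) \<le> (1/4) powr \<mu> * (2 * h) ^ CARD('d)"
      by (simp add: mult_ac)
  qed
  also have "\<dots> = (\<integral>\<^sup>+y. ennreal ((1/4) powr \<mu>) * indicator (cbox l u) y \<partial>lborel)"
    using h by (simp add: nn_integral_cmult_indicator box ennreal_mult)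
  also have "\<dots> \<le> emeasure (nu \<mu>) (cap x r)"
    unfolding emeasure_nu_cap cap_density_def
    using sub W by (intro nn_integral_mono) (auto simp: indicator_def intro!: ennreal_leI)
  finally show ?thesis by (simp add: h_def mult.assoc)
qed

text \<open>Separates the points that have a direction for slicing, with a coordinate bounded away
  from 0, from those in the half ball, where the weight is harmless.\<close>

lemma coordinate_cases:
  fixes x :: "real^'d"
  obtains (edge) i where "1 / (2 * real CARD('d)) \<le> \<bar>x $ i\<bar>" | (center) "norm x \<le> 1/2"
proof (cases "\<exists>i. 1 / (2 * real CARD('d)) \<le> \<bar>x $ i\<bar>")
  case False
  then have "\<bar>x $ i\<bar> \<le> 1 / (2 * real CARD('d))" for i by (simp add: not_le less_imp_le)
  then have "(\<Sum>i\<in>UNIV. \<bar>x $ i\<bar>) \<le> (\<Sum>i\<in>(UNIV :: 'd set). 1 / (2 * real CARD('d)))" by (intro sum_mono)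
  then have "norm x \<le> 1/2" using norm_le_l1_cart[of x] by simp
  then show ?thesis by (rule center)
qed (use edge in blast)

section \<open>Uniform two-sided bounds for caps\<close>

lemma cap_upper_small:
  assumes mu: "\<mu> \<ge> 0"
  obtains C r0 where "C > 0" "r0 > 0"
    "\<And>(x :: real^'d) r. norm x \<le> 1 \<Longrightarrow> 0 < r \<Longrightarrow> r \<le> r0 \<Longrightarrow>
      emeasure (nu \<mu>) (cap x r) \<le> ennreal (C * r ^ CARD('d) * (rho x + r) powr (2 * \<mu>))"
proof -
  define \<kappa> where "\<kappa> = 1 / (2 * real CARD('d))"
  have k: "0 < \<kappa>" "\<kappa> \<le> 1/2"
    using zero_less_card_finite[where 'a='d] by (auto simp: \<kappa>_def field_simps simp del: zero_less_card_finite)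
  define C1 where "C1 = 8 / \<kappa> * 2 ^ CARD('d)"
  define C2 where "C2 = 2 * 4 powr \<mu> * 2 ^ CARD('d)"
  have C: "C1 > 0" "C2 > 0" using k by (auto simp: C1_def C2_def)
  have "emeasure (nu \<mu>) (cap x r) \<le> ennreal ((C1 + C2) * r ^ CARD('d) * (rho x + r) powr (2 * \<mu>))"
    if x: "norm x \<le> 1" and r: "0 < r" "r \<le> \<kappa> / 2" for x :: "real^'d" and r
  proof -
    define A where "A = r ^ CARD('d) * (rho x + r) powr (2 * \<mu>)"
    have A: "A \<ge> 0" using r by (simp add: A_def)
    have "emeasure (nu \<mu>) (cap x r) \<le> ennreal (C1 * A) \<or> emeasure (nu \<mu>) (cap x r) \<le> ennreal (C2 * A)"
    proof (cases x rule: coordinate_cases)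
      case (edge i)
      then show ?thesis using cap_upper_edge[OF x k(1) edge[folded \<kappa>_def] r mu]
        by (auto simp: C1_def A_def power_mult_distrib mult_ac)
    next
      case center
      have "r \<le> 1/4" using r k by linarith
      then show ?thesis using cap_upper_center[OF center r(1) _ mu]
        by (auto simp: C2_def A_def power_mult_distrib mult_ac)
    qed
    moreover have "C1 * A \<le> (C1 + C2) * A" "C2 * A \<le> (C1 + C2) * A" using A C by (auto intro!: mult_right_mono)
    ultimately have "emeasure (nu \<mu>) (cap x r) \<le> ennreal ((C1 + C2) * A)"
      by (meson ennreal_leI order_trans)
    then show ?thesis by (simp add: A_def mult.assoc)
  qed
  then show thesis using that[of "C1 + C2" "\<kappa> / 2"] C k by simp
qed

text \<open>For \<open>\<mu> < 1/2\<close> the density is unbounded at the sphere. Finiteness comes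
  from covering the compact ball by finitely many small caps, each of finite mass.\<close>

lemma finite_measure_nu:
  assumes mu: "\<mu> \<ge> 0"
  shows "finite_measure (nu \<mu> :: (real^'d) measure)"
proof -
  obtain C r0 where C: "C > 0" "r0 > 0"
    "\<And>(x :: real^'d) r. norm x \<le> 1 \<Longrightarrow> 0 < r \<Longrightarrow> r \<le> r0 \<Longrightarrow>
      emeasure (nu \<mu>) (cap x r) \<le> ennreal (C * r ^ CARD('d) * (rho x + r) powr (2 * \<mu>))"
    using cap_upper_small[OF mu] by metis
  have "open {y. chord x y < r0}" for x :: "real^'d"
    by (intro open_Collect_less continuous_intros continuous_lift)
  moreover have "cball 0 1 \<subseteq> (\<Union>x\<in>cball 0 1. {y :: real^'d. chord x y < r0})" using C by auto
  ultimately obtain X :: "(real^'d) set" where X: "X \<subseteq> cball 0 1" "finite X" "cball 0 1 \<subseteq> (\<Union>x\<in>X. {y. chord x y < r0})"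
    using compactE_image[OF compact_cball] by (metis (no_types, lifting))
  then have "cball 0 1 \<subseteq> (\<Union>x\<in>X. cap x r0)" by (force simp: cap_def)
  then have "emeasure (nu \<mu>) (cball 0 1 :: (real^'d) set) \<le> emeasure (nu \<mu>) (\<Union>x\<in>X. cap x r0)"
    using X(2) by (intro emeasure_mono) (auto intro!: sets.finite_UN)
  also have "\<dots> \<le> (\<Sum>x\<in>X. emeasure (nu \<mu>) (cap x r0))"
    using X by (intro emeasure_subadditive_finite) auto
  also have "\<dots> < \<infinity>"
  proof -
    have "emeasure (nu \<mu>) (cap x r0) < \<infinity>" if "x \<in> X" for x
    proof -
      have "norm x \<le> 1" using X(1) that by auto
      from C(3)[OF this C(2) order_refl] show ?thesis by (rule le_less_trans) simp
    qed
    then show ?thesis using X by (simp add: ennreal_sum_less_top)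
  qed
  finally have "emeasure (nu \<mu>) (cball 0 1 :: (real^'d) set) < \<infinity>" .
  moreover have "emeasure (nu \<mu>) (UNIV :: (real^'d) set) = emeasure (nu \<mu>) (cball 0 1 :: (real^'d) set)"
    unfolding nu_def by (subst (1 2) emeasure_density) (auto intro!: nn_integral_cong simp: indicator_def)
  ultimately show ?thesis by (intro finite_measureI) (simp add: less_top)
qed

text \<open>Caps of radius above \<open>r0\<close> are bounded by the total mass; \<open>C2\<close>
  is the constant for which this already suffices at \<open>r = r0\<close> and height 0.\<close>

lemma cap_upper:
  assumes mu: "\<mu> \<ge> 0"
  obtains C where "C > 0"
    "\<And>(x :: real^'d) r. norm x \<le> 1 \<Longrightarrow> 0 < r \<Longrightarrow>
      mass \<mu> (cap x r) \<le> C * r ^ CARD('d) * (rho x + r) powr (2 * \<mu>)"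
proof -
  interpret finite_measure "nu \<mu> :: (real^'d) measure" by (rule finite_measure_nu[OF mu])
  obtain C1 r0 where C1: "C1 > 0" "r0 > 0"
    "\<And>(x :: real^'d) r. norm x \<le> 1 \<Longrightarrow> 0 < r \<Longrightarrow> r \<le> r0 \<Longrightarrow>
      emeasure (nu \<mu>) (cap x r) \<le> ennreal (C1 * r ^ CARD('d) * (rho x + r) powr (2 * \<mu>))"
    using cap_upper_small[OF mu] by metis
  define m where "m = mass \<mu> (UNIV :: (real^'d) set)"
  define C2 where "C2 = m / (r0 ^ CARD('d) * r0 powr (2 * \<mu>))"
  have m: "m \<ge> 0" and C2: "C2 \<ge> 0" using C1 by (auto simp: C2_def m_def)
  have "mass \<mu> (cap x r) \<le> (C1 + C2) * (r ^ CARD('d) * (rho x + r) powr (2 * \<mu>))"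
    if x: "norm x \<le> 1" and r: "0 < r" for x :: "real^'d" and r
  proof (cases "r \<le> r0")
    case True
    have "mass \<mu> (cap x r) \<le> C1 * (r ^ CARD('d) * (rho x + r) powr (2 * \<mu>))"
      using C1(3)[OF x r True] C1(1) r by (simp add: emeasure_eq_measure mult.assoc)
    also have "\<dots> \<le> (C1 + C2) * (r ^ CARD('d) * (rho x + r) powr (2 * \<mu>))"
      using C2 r by (intro mult_right_mono) auto
    finally show ?thesis .
  next
    case False
    have "mass \<mu> (cap x r) \<le> m"
      unfolding m_def by (rule finite_measure_mono) auto
    also have "m = C2 * (r0 ^ CARD('d) * r0 powr (2 * \<mu>))" using C1 by (simp add: C2_def)
    also have "\<dots> \<le> (C1 + C2) * (r ^ CARD('d) * (rho x + r) powr (2 * \<mu>))"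
      using False C1 C2 rho_bounds[OF x] mu by (intro mult_mono power_mono powr_mono2) auto
    finally show ?thesis .
  qed
  then show thesis using that[of "C1 + C2"] C1 C2 by (simp add: mult.assoc)
qed

lemma cap_lower:
  assumes mu: "\<mu> \<ge> 0"
  obtains c r0 where "c > 0" "r0 > 0" "r0 \<le> 1"
    "\<And>(x :: real^'d) r. norm x \<le> 1 \<Longrightarrow> 0 < r \<Longrightarrow> r \<le> r0 \<Longrightarrow>
      c * r ^ CARD('d) * (rho x + r) powr (2 * \<mu>) \<le> mass \<mu> (cap x r)"
proof -
  interpret finite_measure "nu \<mu> :: (real^'d) measure" by (rule finite_measure_nu[OF mu])
  define \<kappa> where "\<kappa> = 1 / (2 * real CARD('d))"
  have k: "0 < \<kappa>" "\<kappa> \<le> 1/2"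
    using zero_less_card_finite[where 'a='d] by (auto simp: \<kappa>_def field_simps simp del: zero_less_card_finite)
  define \<eta>1 where "\<eta>1 = \<kappa> / (real CARD('d) * (\<kappa> + 3))"
  define \<eta>2 where "\<eta>2 = 1 / (5 * real CARD('d))"
  have n: "\<eta>1 > 0" "\<eta>2 > 0" using k by (auto simp: \<eta>1_def \<eta>2_def)
  \<comment> \<open>Trades \<open>rho x + \<eta>1 * r / 2\<close> for
    \<open>e * (rho x + r)\<close>, so that both cases end with the same expression.\<close>
  define e where "e = min 1 (\<eta>1 / 2)"
  have e: "0 < e" "e \<le> 1" "e \<le> \<eta>1 / 2" using n by (auto simp: e_def)
  define c1 where "c1 = (2 * \<eta>1) ^ CARD('d) / 8 * e powr (2 * \<mu>)"
  define c2 where "c2 = (1/16) powr \<mu> * (2 * \<eta>2) ^ CARD('d)"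
  have c: "c1 > 0" "c2 > 0" using n e by (auto simp: c1_def c2_def)
  have "min c1 c2 * (r ^ CARD('d) * (rho x + r) powr (2 * \<mu>)) \<le> mass \<mu> (cap x r)"
    if x: "norm x \<le> 1" and r: "0 < r" "r \<le> \<kappa>" for x :: "real^'d" and r
  proof -
    define A where "A = r ^ CARD('d) * (rho x + r) powr (2 * \<mu>)"
    have A: "A \<ge> 0" using r by (simp add: A_def)
    have "c1 * A \<le> mass \<mu> (cap x r) \<or> c2 * A \<le> mass \<mu> (cap x r)"
    proof (cases x rule: coordinate_cases)
      case (edge i)
      have "e * (rho x + r) \<le> rho x + \<eta>1 * r / 2"
        using add_mono[OF mult_right_mono[of e 1 "rho x"] mult_right_mono[of e "\<eta>1 / 2" r]] e rho_bounds[OF x] r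
        by (simp add: distrib_left)
      then have "(e * (rho x + r)) powr (2 * \<mu>) \<le> (rho x + \<eta>1 * r / 2) powr (2 * \<mu>)"
        using e rho_bounds[OF x] r mu by (intro powr_mono2) auto
      then have "(2 * \<eta>1 * r) ^ CARD('d) / 8 * (e * (rho x + r)) powr (2 * \<mu>) \<le>
         (2 * \<eta>1 * r) ^ CARD('d) / 8 * (rho x + \<eta>1 * r / 2) powr (2 * \<mu>)"
        using n r by (intro mult_left_mono) auto
      also have "\<dots> \<le> mass \<mu> (cap x r)"
        using cap_lower_edge[OF x k(1) edge[folded \<kappa>_def] r mu \<eta>1_def]
        by (simp add: emeasure_eq_measure)
      finally have "c1 * A \<le> mass \<mu> (cap x r)"
        using e rho_bounds[OF x] r by (simp add: c1_def A_def power_mult_distrib powr_mult mult_ac)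
      then show ?thesis ..
    next
      case center
      have "r \<le> 1" using r k by linarith
      then show ?thesis using cap_lower_center[OF center r(1) _ mu \<eta>2_def]
        by (auto simp: c2_def A_def power_mult_distrib mult_ac emeasure_eq_measure)
    qed
    moreover have "min c1 c2 * A \<le> c1 * A" "min c1 c2 * A \<le> c2 * A" using A by (auto intro!: mult_right_mono)
    ultimately show ?thesis unfolding A_def[symmetric] by linarith
  qed
  then show thesis using that[of "min c1 c2" \<kappa>] c k by (simp add: mult.assoc)
qed

section \<open>Weighted local bounds\<close>

text \<open>Distance in units of \<open>1/n\<close>; the shift by 1 makes it submultiplicative, so
  its powers can serve as weights.\<close>

definition sdist :: "nat \<Rightarrow> real^'d \<Rightarrow> real^'d \<Rightarrow> real" where
  "sdist n x y = 1 + real n * chord x y"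

lemma sdist_ge_1: "1 \<le> sdist n x y" by (simp add: sdist_def)
lemma sdist_pos: "0 < sdist n x y" using sdist_ge_1[of n x y] by linarith
lemma sdist_commute: "sdist n x y = sdist n y x" by (simp add: sdist_def dist_commute)

lemma sdist_submult: "sdist n x z \<le> sdist n x y * sdist n y z"
proof -
  have "real n * chord x z \<le> real n * (chord x y + chord y z)"
    by (intro mult_left_mono dist_triangle) auto
  moreover have "0 \<le> (real n * chord x y) * (real n * chord y z)" by simp
  moreover have "sdist n x y * sdist n y z = 1 + real n * (chord x y + chord y z) +
      (real n * chord x y) * (real n * chord y z)"
    by (simp add: sdist_def algebra_simps)
  ultimately show ?thesis unfolding sdist_def by linarith
qed

lemma continuous_sdist [continuous_intros]: "continuous_on S (\<lambda>y. sdist n x y)"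
  unfolding sdist_def by (intro continuous_intros continuous_lift)

lemma W_n_rho: "W_n \<mu> n x = (rho x + 1 / real n) powr (2 * \<mu>)"
  by (simp add: W_n_def rho_def)

lemma W_n_pos: "n \<ge> 1 \<Longrightarrow> norm x \<le> 1 \<Longrightarrow> 0 < W_n \<mu> n x"
  using rho_bounds[of x] by (simp add: W_n_rho add_nonneg_eq_0_iff)

text \<open>A natural exponent dominating \<open>2 * \<mu>\<close>, so that growth of the weight can
  be paid for with powers of \<open>sdist\<close>.\<close>

definition wexp :: "real \<Rightarrow> nat" where "wexp \<mu> = nat \<lceil>2 * \<mu>\<rceil>"

lemma powr_le_wexp: "1 \<le> t \<Longrightarrow> t powr (2 * \<mu>) \<le> t ^ wexp \<mu>"
proof -
  assume t: "1 \<le> t"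
  have "2 * \<mu> \<le> real (wexp \<mu>)" unfolding wexp_def by (rule real_nat_ceiling_ge)
  then have "t powr (2 * \<mu>) \<le> t powr real (wexp \<mu>)" using t by (intro powr_mono) auto
  then show ?thesis using t by (simp add: powr_realpow)
qed

text \<open>The height is 1-Lipschitz for the chord, so passing from \<open>y\<close> to
  \<open>x\<close> multiplies \<open>rho + 1/n\<close> by at most
  \<open>sdist n x y\<close>.\<close>

lemma W_n_doubling:
  assumes n: "n \<ge> 1" and mu: "\<mu> \<ge> 0" and x: "norm x \<le> 1" and y: "norm y \<le> 1"
  shows "W_n \<mu> n x \<le> sdist n x y ^ wexp \<mu> * W_n \<mu> n y"
proof -
  have "(rho y + 1 / real n) * sdist n x y =
      rho y + 1 / real n + chord x y + rho y * (real n * chord x y)"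
    using n by (simp add: sdist_def field_simps)
  moreover have "0 \<le> rho y * (real n * chord x y)" using rho_bounds[OF y] by simp
  ultimately have "rho x + 1 / real n \<le> (rho y + 1 / real n) * sdist n x y"
    using rho_lipschitz[of x y] by linarith
  then have "W_n \<mu> n x \<le> ((rho y + 1 / real n) * sdist n x y) powr (2 * \<mu>)"
    unfolding W_n_rho using rho_bounds[OF x] mu n by (intro powr_mono2) auto
  also have "\<dots> = W_n \<mu> n y * sdist n x y powr (2 * \<mu>)"
    using rho_bounds[OF y] n sdist_ge_1[of n x y] by (simp add: powr_mult W_n_rho)
  also have "\<dots> \<le> W_n \<mu> n y * sdist n x y ^ wexp \<mu>"
    using powr_le_wexp[OF sdist_ge_1] by (intro mult_left_mono) (auto simp: W_n_def)
  finally show ?thesis by (simp add: mult.commute)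
qed

text \<open>The kernels are not even in the last coordinate, so products with them live on the whole sphere;
  reflecting a point to the upper hemisphere only brings it closer to \<open>lift x\<close>.\<close>

lemma dist_lift_fst_le:
  assumes Y: "norm Y = 1" and x: "norm x \<le> 1"
  shows "norm (fst Y) \<le> 1" "dist (lift x) (lift (fst Y)) \<le> dist (lift x) Y"
proof -
  obtain y t where yt: "Y = (y, t)" by (cases Y)
  have "(norm y)\<^sup>2 + t\<^sup>2 = 1" using Y by (simp add: yt norm_Pair)
  then have t: "t\<^sup>2 = 1 - (norm y)\<^sup>2" by simp
  then have "(norm y)\<^sup>2 \<le> 1\<^sup>2" using zero_le_power2[of t] by simp
  then have y: "norm y \<le> 1" by (rule power2_le_imp_le) simp
  then show "norm (fst Y) \<le> 1" by (simp add: yt)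
  have "rho y = \<bar>t\<bar>" by (simp add: rho_def t[symmetric])
  then have "\<bar>rho x - rho y\<bar> \<le> \<bar>rho x - t\<bar>" using rho_bounds[OF x] by linarith
  then have "(rho x - rho y)\<^sup>2 \<le> (rho x - t)\<^sup>2" by (simp add: abs_le_square_iff)
  then show "dist (lift x) (lift (fst Y)) \<le> dist (lift x) Y"
    by (simp add: yt lift_def dist_Pair_Pair dist_real_def)
qed

text \<open>By submultiplicativity the growth of \<open>sdist n x0\<close> away from any
  \<open>x\<close> is cancelled by the decay of a kernel centred at \<open>x\<close>. The kernel at
  \<open>x1\<close> yields the lower bound for \<open>|f|\<close> near \<open>x1\<close>; the kernel
  at \<open>x0\<close> yields the oscillation near \<open>x0\<close>, with constant \<open>S\<close>
  and not the possibly much larger \<open>|f x1|\<close>.\<close>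

lemma slow_maximum:
  fixes f :: "real^'d \<Rightarrow> real"
  assumes n: "n \<ge> 1" and f: "ball_poly n f" and cf: "continuous_on UNIV f"
    and x0: "norm x0 \<le> 1"
  obtains x1 S where "norm x1 \<le> 1" "S \<ge> 0" "S * sdist n x0 x1 ^ s = \<bar>f x1\<bar>"
    "\<And>x. norm x \<le> 1 \<Longrightarrow> real n * chord x1 x \<le> 1 / (28 * (real s + 1) * 3 ^ s) \<Longrightarrow> \<bar>f x1\<bar> / 2 \<le> \<bar>f x\<bar>"
    "\<And>x. norm x \<le> 1 \<Longrightarrow> real n * chord x0 x \<le> 1 \<Longrightarrow>
       \<bar>f x - f x0\<bar> \<le> 14 * (real s + 1) * (3 ^ s + 2 ^ s) * (real n * chord x0 x) * S"
proof -
  define \<Phi> where "\<Phi> = (\<lambda>x. \<bar>f x\<bar> / sdist n x0 x ^ s)"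
  have "continuous_on (cball 0 1) \<Phi>"
    unfolding \<Phi>_def using sdist_pos[of n x0]
    by (intro continuous_intros continuous_on_subset[OF cf]) (auto simp: less_imp_neq[symmetric])
  then obtain x1 where x1: "x1 \<in> cball 0 1" "\<And>x. x \<in> cball 0 1 \<Longrightarrow> \<Phi> x \<le> \<Phi> x1"
    using continuous_attains_sup[of "cball 0 1" \<Phi>] by (auto simp: compact_cball)
  define S where "S = \<Phi> x1"
  have nx1: "norm x1 \<le> 1" using x1 by simp
  have S0: "S \<ge> 0" using sdist_pos[of n x0 x1] by (simp add: S_def \<Phi>_def)
  have Sx1: "S * sdist n x0 x1 ^ s = \<bar>f x1\<bar>" using sdist_pos[of n x0 x1] by (simp add: S_def \<Phi>_def)
  have Sx: "\<bar>f x\<bar> \<le> S * sdist n x0 x ^ s" if "norm x \<le> 1" for x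
  proof -
    have "\<Phi> x \<le> S" using x1(2)[of x] that by (simp add: S_def)
    then show ?thesis using sdist_pos[of n x0 x] by (simp add: \<Phi>_def divide_le_eq)
  qed
  define N where "N = n + s * n"
  have N: "N \<ge> 1" "real N = (real s + 1) * real n" using n by (auto simp: N_def algebra_simps)
  \<comment> \<open>Used with \<open>x = x1\<close>, where the bound is \<open>3^s * |f x1|\<close>,
    and with \<open>x = x0\<close>, where \<open>sdist n x0 x0 = 1\<close> and it is
    \<open>3^s * S\<close>.\<close>
  have PB: "\<bar>f (fst Y) * Q Y\<bar> \<le> 3 ^ s * (S * sdist n x0 x ^ s)"
    if Y: "norm Y = 1" and x: "norm x \<le> 1" and Q: "0 \<le> Q Y" "Q Y * (1 + real n * dist (lift x) Y) ^ s \<le> 3 ^ s"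
    for Q :: "(real^'d) \<times> real \<Rightarrow> real" and Y x
  proof -
    note Y' = dist_lift_fst_le[OF Y x]
    have "sdist n x (fst Y) \<le> 1 + real n * dist (lift x) Y"
      unfolding sdist_def using Y'(2) by (simp add: mult_left_mono)
    then have "sdist n x0 (fst Y) \<le> sdist n x0 x * (1 + real n * dist (lift x) Y)"
      using sdist_submult[of n x0 "fst Y" x] sdist_pos[of n x0 x] by (meson mult_left_mono less_imp_le order_trans)
    then have "sdist n x0 (fst Y) ^ s \<le> sdist n x0 x ^ s * (1 + real n * dist (lift x) Y) ^ s"
      using sdist_pos[of n x0 "fst Y"] by (subst power_mult_distrib[symmetric]) (intro power_mono, auto)
    then have "S * sdist n x0 (fst Y) ^ s \<le> S * (sdist n x0 x ^ s * (1 + real n * dist (lift x) Y) ^ s)"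
      using S0 by (intro mult_left_mono)
    then have "\<bar>f (fst Y)\<bar> \<le> S * (sdist n x0 x ^ s * (1 + real n * dist (lift x) Y) ^ s)"
      using Sx[OF Y'(1)] by linarith
    then have "\<bar>f (fst Y)\<bar> * Q Y \<le> S * (sdist n x0 x ^ s * (1 + real n * dist (lift x) Y) ^ s) * Q Y"
      using Q(1) by (rule mult_right_mono)
    also have "\<dots> = S * sdist n x0 x ^ s * (Q Y * (1 + real n * dist (lift x) Y) ^ s)" by (simp add: mult_ac)
    also have "\<dots> \<le> S * sdist n x0 x ^ s * 3 ^ s"
      using Q(2) S0 sdist_pos[of n x0 x] by (intro mult_left_mono) auto
    finally show ?thesis using Q(1) by (simp add: abs_mult mult_ac)
  qed
  have near: "\<bar>f x1\<bar> / 2 \<le> \<bar>f x\<bar>"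
    if x: "norm x \<le> 1" and d: "real n * chord x1 x \<le> 1 / (28 * (real s + 1) * 3 ^ s)" for x
  proof -
    obtain Q where Q: "pdeg (s * n) Q" "Q (lift x1) = 1"
      "\<And>Y. norm Y = 1 \<Longrightarrow> 0 \<le> Q Y \<and> Q Y \<le> 1 \<and> Q Y * (1 + real n * dist (lift x1) Y) ^ s \<le> 3 ^ s"
      using localized_polynomial[OF norm_lift[OF nx1] n] by metis
    have "\<bar>f (fst (lift x)) * Q (lift x) - f (fst (lift x1)) * Q (lift x1)\<bar>
       \<le> 14 * real N * (3 ^ s * \<bar>f x1\<bar>) * chord x1 x"
    proof (rule Bernstein_sphere[OF _ _ N(1) norm_lift[OF nx1] norm_lift[OF x]])
      show "pdeg N (\<lambda>Y. f (fst Y) * Q Y)" unfolding N_def by (rule pdeg_mult[OF f Q(1)])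
      show "\<bar>f (fst Y) * Q Y\<bar> \<le> 3 ^ s * \<bar>f x1\<bar>" if "norm Y = 1" for Y
        using PB[OF that nx1, of Q] Q(3)[OF that] Sx1 by simp
    qed
    also have "\<dots> = (14 * (real s + 1) * 3 ^ s * \<bar>f x1\<bar>) * (real n * chord x1 x)"
      by (simp add: N(2) mult_ac)
    also have "\<dots> \<le> (14 * (real s + 1) * 3 ^ s * \<bar>f x1\<bar>) * (1 / (28 * (real s + 1) * 3 ^ s))"
      using d by (intro mult_left_mono) auto
    also have "\<dots> = \<bar>f x1\<bar> / 2"
    proof -
      define K where "K = (real s + 1) * 3 ^ s"
      have "K > 0" by (simp add: K_def add_nonneg_pos)
      then have "(14 * K * \<bar>f x1\<bar>) * (1 / (28 * K)) = \<bar>f x1\<bar> / 2" by simp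
      then show ?thesis by (simp only: K_def mult.assoc)
    qed
    finally have "\<bar>f x * Q (lift x) - f x1\<bar> \<le> \<bar>f x1\<bar> / 2" by (simp add: lift_def[of x] lift_def[of x1] Q(2)[unfolded lift_def])
    moreover have "\<bar>f x * Q (lift x)\<bar> \<le> \<bar>f x\<bar> * 1"
      using Q(3)[OF norm_lift[OF x]] unfolding abs_mult by (intro mult_left_mono) auto
    ultimately show ?thesis by linarith
  qed
  have osc: "\<bar>f x - f x0\<bar> \<le> 14 * (real s + 1) * (3 ^ s + 2 ^ s) * (real n * chord x0 x) * S"
    if x: "norm x \<le> 1" and d: "real n * chord x0 x \<le> 1" for x
  proof -
    obtain Q where Q: "pdeg (s * n) Q" "Q (lift x0) = 1"
      "\<And>Y. norm Y = 1 \<Longrightarrow> 0 \<le> Q Y \<and> Q Y \<le> 1 \<and> Q Y * (1 + real n * dist (lift x0) Y) ^ s \<le> 3 ^ s"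
      using localized_polynomial[OF norm_lift[OF x0] n] by metis
    define D where "D = real n * chord x0 x"
    have D0: "D \<ge> 0" by (simp add: D_def)
    have fl: "fst (lift z) = z" for z :: "real^'d" by (simp add: lift_def)
    have "\<bar>f (fst (lift x)) * Q (lift x) - f (fst (lift x0)) * Q (lift x0)\<bar>
       \<le> 14 * real N * (3 ^ s * S) * chord x0 x"
    proof (rule Bernstein_sphere[OF _ _ N(1) norm_lift[OF x0] norm_lift[OF x]])
      show "pdeg N (\<lambda>Y. f (fst Y) * Q Y)" unfolding N_def by (rule pdeg_mult[OF f Q(1)])
      show "\<bar>f (fst Y) * Q Y\<bar> \<le> 3 ^ s * S" if "norm Y = 1" for Y
        using PB[OF that x0, of Q] Q(3)[OF that] by (simp add: sdist_def)
    qed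
    then have 1: "\<bar>f x * Q (lift x) - f x0\<bar> \<le> 14 * (real s + 1) * 3 ^ s * D * S"
      by (simp add: fl Q(2) N(2) D_def mult_ac)
    \<comment> \<open>Removing the kernel leaves the error \<open>f x * (1 - Q)\<close>. Bernstein's
      inequality for \<open>Q\<close> itself makes it of the same order as the main term, and
      \<open>|f x| \<le> 2^s * S\<close> because \<open>sdist n x0 x \<le> 2\<close>.\<close>
    have "\<bar>Q (lift x) - Q (lift x0)\<bar> \<le> 14 * real N * 1 * chord x0 x"
    proof (rule Bernstein_sphere[OF _ _ N(1) norm_lift[OF x0] norm_lift[OF x]])
      show "pdeg N Q" by (rule pdeg_mono[OF Q(1)]) (simp add: N_def)
      show "\<bar>Q Y\<bar> \<le> 1" if "norm Y = 1" for Y using Q(3)[OF that] by auto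
    qed
    then have 2: "\<bar>1 - Q (lift x)\<bar> \<le> 14 * (real s + 1) * D"
      by (simp add: Q(2) N(2) D_def mult_ac abs_minus_commute)
    have "\<bar>f x\<bar> \<le> S * sdist n x0 x ^ s" by (rule Sx[OF x])
    also have "\<dots> \<le> S * 2 ^ s" using d S0 sdist_pos[of n x0 x] by (intro mult_left_mono power_mono) (auto simp: sdist_def)
    finally have "\<bar>f x\<bar> * \<bar>1 - Q (lift x)\<bar> \<le> (S * 2 ^ s) * (14 * (real s + 1) * D)"
      using 2 S0 by (intro mult_mono) auto
    moreover have "f x - f x0 = (f x * Q (lift x) - f x0) + f x * (1 - Q (lift x))" by (simp add: algebra_simps)
    ultimately have "\<bar>f x - f x0\<bar> \<le> 14 * (real s + 1) * 3 ^ s * D * S + (S * 2 ^ s) * (14 * (real s + 1) * D)"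
      using 1 abs_triangle_ineq[of "f x * Q (lift x) - f x0" "f x * (1 - Q (lift x))"] by (simp only: abs_mult)
    then show ?thesis by (simp add: D_def[symmetric] algebra_simps)
  qed
  show thesis by (rule that[OF nx1 S0 Sx1 near osc])
qed

text \<open>On the unit sphere the density is zero by the convention
  \<open>0 powr a = 0\<close>.\<close>

lemma AE_nu_ball: "AE x :: real^'d in nu \<mu>. norm x < 1"
proof -
  have [measurable]: "(\<lambda>x :: real^'d. ennreal (indicator (cball 0 1) x * W \<mu> x)) \<in> borel_measurable lborel"
    unfolding measurable_lborel1
    by (intro measurable_compose[OF _ measurable_ennreal] borel_measurable_times borel_measurable_indicator W_measurable) auto
  show ?thesis unfolding nu_def
    by (subst AE_density) (auto simp: indicator_def W_def less_le split: if_splits)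
qed

lemma AE_nu_cball: "AE x :: real^'d in nu \<mu>. norm x \<le> 1"
  using AE_nu_ball by (rule eventually_mono) simp

lemma integrable_nu_continuous:
  fixes f :: "real^'d \<Rightarrow> real"
  assumes mu: "\<mu> \<ge> 0" and f: "continuous_on UNIV f"
  shows "integrable (nu \<mu>) f"
proof -
  interpret finite_measure "nu \<mu> :: (real^'d) measure" by (rule finite_measure_nu[OF mu])
  have "compact (f ` cball 0 1)"
    by (intro compact_continuous_image continuous_on_subset[OF f]) auto
  then obtain B where B: "\<And>x. norm x \<le> 1 \<Longrightarrow> norm (f x) \<le> B"
    using compact_imp_bounded bounded_iff by (metis (no_types, lifting) imageI mem_cball_0)
  have "f \<in> borel_measurable borel" using f by (rule borel_measurable_continuous_onI)
  then show ?thesis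
    using AE_nu_cball[of \<mu>] B by (intro integrable_const_bound[of _ B]) auto
qed

text \<open>The same \<open>S\<close>, the damped maximum of \<open>f\<close> seen from
  \<open>x0\<close>, must serve in both estimates: it controls the oscillation and is itself
  controlled by a weighted average.\<close>

definition local_bound :: "real \<Rightarrow> nat \<Rightarrow> real \<Rightarrow> real \<Rightarrow> nat \<Rightarrow> (real^'d \<Rightarrow> real) \<Rightarrow> real^'d \<Rightarrow> bool" where
  "local_bound \<mu> m C1 C2 n f x0 \<longleftrightarrow> (\<exists>S\<ge>0. (\<forall>x. norm x \<le> 1 \<longrightarrow> real n * chord x0 x \<le> 1 \<longrightarrow>
         \<bar>f x - f x0\<bar> \<le> C1 * (real n * chord x0 x) * S) \<and>
       S * W_n \<mu> n x0 \<le> C2 * real n ^ CARD('d) * (LINT y|nu \<mu>. \<bar>f y\<bar> / sdist n x0 y ^ m))"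

text \<open>The lower bound near the maximum point \<open>x1\<close> turns \<open>|f x1|\<close>
  into an average of \<open>|f|\<close> over a cap there. Of the \<open>p + m\<close> powers of
  damping, \<open>p\<close> move the weight from \<open>x0\<close> to \<open>x1\<close> and
  \<open>m\<close> remain as decay in the integral.\<close>

lemma weighted_local_bound:
  assumes mu: "\<mu> \<ge> 0"
  obtains C1 C2 where "C1 > 0" "C2 > 0"
    "\<And>(f :: real^'d \<Rightarrow> real) n x0. n \<ge> 1 \<Longrightarrow> ball_poly n f \<Longrightarrow> continuous_on UNIV f \<Longrightarrow> norm x0 \<le> 1 \<Longrightarrow>
      local_bound \<mu> m C1 C2 n f x0"
proof -
  interpret finite_measure "nu \<mu> :: (real^'d) measure" by (rule finite_measure_nu[OF mu])
  obtain c r0 where c: "c > 0" "r0 > 0" "r0 \<le> 1"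
    "\<And>(x :: real^'d) r. norm x \<le> 1 \<Longrightarrow> 0 < r \<Longrightarrow> r \<le> r0 \<Longrightarrow>
      c * r ^ CARD('d) * (rho x + r) powr (2 * \<mu>) \<le> mass \<mu> (cap x r)"
    using cap_lower[OF mu] by metis
  define p where "p = wexp \<mu>"
  define s where "s = p + m"
  \<comment> \<open>Radius in units of \<open>1/n\<close>: small enough for \<open>|f|\<close> to
    stay above \<open>|f x1| / 2\<close> and for the lower cap bound to apply.\<close>
  define e where "e = min r0 (1 / (28 * (real s + 1) * 3 ^ s))"
  have e: "0 < e" "e \<le> r0" "e \<le> 1" "e \<le> 1 / (28 * (real s + 1) * 3 ^ s)" using c by (auto simp: e_def)
  define c' where "c' = c * e ^ CARD('d) * e powr (2 * \<mu>)"
  have c': "c' > 0" using c e by (simp add: c'_def)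
  define C1 where "C1 = 14 * (real s + 1) * (3 ^ s + 2 ^ s)"
  define C2 where "C2 = 2 ^ Suc m / c'"
  have C: "C1 > 0" "C2 > 0" using c' by (auto simp: C1_def C2_def add_pos_pos)
  have main: "local_bound \<mu> m C1 C2 n f x0"
    if n: "n \<ge> 1" and f: "ball_poly n f" and cf: "continuous_on UNIV f" and x0: "norm x0 \<le> 1"
    for f :: "real^'d \<Rightarrow> real" and n x0
  proof -
    obtain x1 S where S: "norm x1 \<le> 1" "S \<ge> 0" "S * sdist n x0 x1 ^ s = \<bar>f x1\<bar>"
      "\<And>x. norm x \<le> 1 \<Longrightarrow> real n * chord x1 x \<le> 1 / (28 * (real s + 1) * 3 ^ s) \<Longrightarrow> \<bar>f x1\<bar> / 2 \<le> \<bar>f x\<bar>"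
      "\<And>x. norm x \<le> 1 \<Longrightarrow> real n * chord x0 x \<le> 1 \<Longrightarrow>
       \<bar>f x - f x0\<bar> \<le> C1 * (real n * chord x0 x) * S"
      unfolding C1_def using slow_maximum[OF n f cf x0, of s] by metis
    define K where "K = cap x1 (e / real n)"
    have npos: "real n > 0" using n by simp
    have en: "0 < e / real n" "e / real n \<le> r0"
    proof -
      have "e / real n \<le> e / 1" using n e by (intro divide_left_mono) auto
      then show "e / real n \<le> r0" using e by simp
    qed (use npos e in simp)
    have K: "norm y \<le> 1" "real n * chord x1 y \<le> e" if "y \<in> K" for y
      using that npos by (auto simp: K_def cap_def field_simps)
    have mK: "c' / real n ^ CARD('d) * W_n \<mu> n x1 \<le> mass \<mu> K"
    proof -
      have "e * (rho x1 + 1 / real n) \<le> rho x1 + e / real n"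
        using mult_right_mono[of e 1 "rho x1"] e rho_bounds[OF S(1)] by (simp add: distrib_left)
      then have "(e * (rho x1 + 1 / real n)) powr (2 * \<mu>) \<le> (rho x1 + e / real n) powr (2 * \<mu>)"
        using e rho_bounds[OF S(1)] mu by (intro powr_mono2) auto
      then have "e powr (2 * \<mu>) * W_n \<mu> n x1 \<le> (rho x1 + e / real n) powr (2 * \<mu>)"
        using e rho_bounds[OF S(1)] by (simp add: powr_mult W_n_rho)
      then have "c * (e / real n) ^ CARD('d) * (e powr (2 * \<mu>) * W_n \<mu> n x1) \<le> c * (e / real n) ^ CARD('d) * (rho x1 + e / real n) powr (2 * \<mu>)"
        using c e by (intro mult_left_mono) auto
      also have "\<dots> \<le> mass \<mu> K" unfolding K_def by (rule c(4)[OF S(1) en])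
      finally show ?thesis by (simp add: c'_def power_divide mult_ac)
    qed
    define U where "U = sdist n x0 x1"
    have U: "U \<ge> 1" using sdist_ge_1 by (simp add: U_def)
    have int: "integrable (nu \<mu>) (\<lambda>y. \<bar>f y\<bar> / sdist n x0 y ^ m)"
      using sdist_pos[of n x0] by (intro integrable_nu_continuous[OF mu] continuous_intros cf) (auto simp: less_imp_neq[symmetric])
    have "\<bar>f x1\<bar> / U ^ m * mass \<mu> K = (LINT y|nu \<mu>. indicator K y * (\<bar>f x1\<bar> / U ^ m))"
      by (simp add: K_def)
    also have "\<dots> \<le> (LINT y|nu \<mu>. 2 ^ Suc m * (\<bar>f y\<bar> / sdist n x0 y ^ m))"
    proof (rule integral_mono)
      show "integrable (nu \<mu>) (\<lambda>y. indicator K y * (\<bar>f x1\<bar> / U ^ m))" by (simp add: K_def emeasure_eq_measure)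
      show "integrable (nu \<mu>) (\<lambda>y. 2 ^ Suc m * (\<bar>f y\<bar> / sdist n x0 y ^ m))" by (rule integrable_mult_right[OF int])
      fix y :: "real^'d"
      show "indicator K y * (\<bar>f x1\<bar> / U ^ m) \<le> 2 ^ Suc m * (\<bar>f y\<bar> / sdist n x0 y ^ m)"
      proof (cases "y \<in> K")
        case True
        have fy: "\<bar>f x1\<bar> \<le> 2 * \<bar>f y\<bar>"
          using S(4)[OF K(1)[OF True]] K(2)[OF True] e(4) by linarith
        have "sdist n x1 y \<le> 2" using K(2)[OF True] e by (simp add: sdist_def)
        \<comment> \<open>On the cap, \<open>sdist n x0 y\<close> is at most twice \<open>U\<close>.
          Its \<open>m\<close>-th power and the loss \<open>|f x1| \<le> 2 * |f y|\<close> make up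
          the factor \<open>2 ^ Suc m\<close>.\<close>
        then have "U * sdist n x1 y \<le> U * 2" using U by (intro mult_left_mono) auto
        then have "sdist n x0 y \<le> U * 2"
          using sdist_submult[of n x0 y x1] unfolding U_def by linarith
        then have "sdist n x0 y ^ m \<le> (U * 2) ^ m" using sdist_pos[of n x0 y] by (intro power_mono) auto
        then have "\<bar>f x1\<bar> * sdist n x0 y ^ m \<le> (2 * \<bar>f y\<bar>) * (U * 2) ^ m"
          using fy sdist_pos[of n x0 y] by (intro mult_mono) auto
        then have "\<bar>f x1\<bar> / U ^ m \<le> 2 ^ Suc m * (\<bar>f y\<bar> / sdist n x0 y ^ m)"
          using sdist_pos[of n x0 y] U by (simp add: power_mult_distrib field_simps)
        then show ?thesis using True by simp
      qed (use sdist_pos[of n x0 y] in simp)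
    qed
    also have "\<dots> = 2 ^ Suc m * (LINT y|nu \<mu>. \<bar>f y\<bar> / sdist n x0 y ^ m)" by (rule integral_mult_right_zero)
    finally have fK: "\<bar>f x1\<bar> / U ^ m * mass \<mu> K \<le> 2 ^ Suc m * (LINT y|nu \<mu>. \<bar>f y\<bar> / sdist n x0 y ^ m)" .
    have "S * W_n \<mu> n x0 \<le> S * (U ^ p * W_n \<mu> n x1)"
      unfolding U_def p_def by (intro mult_left_mono W_n_doubling n mu x0 S)
    also have "\<dots> = \<bar>f x1\<bar> / U ^ m * W_n \<mu> n x1"
      using U by (simp add: S(3)[symmetric] s_def power_add U_def[symmetric])
    also have "\<dots> \<le> \<bar>f x1\<bar> / U ^ m * (real n ^ CARD('d) / c' * mass \<mu> K)"
      using mK c' U npos by (intro mult_left_mono) (auto simp: field_simps)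
    also have "\<dots> = real n ^ CARD('d) / c' * (\<bar>f x1\<bar> / U ^ m * mass \<mu> K)" by (simp add: mult_ac)
    also have "\<dots> \<le> real n ^ CARD('d) / c' * (2 ^ Suc m * (LINT y|nu \<mu>. \<bar>f y\<bar> / sdist n x0 y ^ m))"
      using fK c' by (intro mult_left_mono) auto
    finally have "S * W_n \<mu> n x0 \<le> C2 * real n ^ CARD('d) * (LINT y|nu \<mu>. \<bar>f y\<bar> / sdist n x0 y ^ m)"
      by (simp add: C2_def mult_ac)
    with S(2,5) show ?thesis unfolding local_bound_def by blast
  qed
  show thesis by (rule that[OF C]) (rule main)
qed

text \<open>Split into annuli \<open>j \<le> n * chord < j + 1\<close>. The cap of radius
  \<open>(j + 1)/n\<close> costs \<open>(j + 1)^(d + p)\<close> relative to scale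
  \<open>1/n\<close>, so the chosen exponent leaves the summable \<open>1/(j + 1)^2\<close>.\<close>

lemma decay_integral:
  assumes mu: "\<mu> \<ge> 0"
  obtains C where "C > 0"
    "\<And>(y :: real^'d) n. n \<ge> 1 \<Longrightarrow> norm y \<le> 1 \<Longrightarrow>
      (LINT x|nu \<mu>. 1 / sdist n x y ^ (CARD('d) + wexp \<mu> + 2)) \<le> C / real n ^ CARD('d) * W_n \<mu> n y"
proof -
  interpret finite_measure "nu \<mu> :: (real^'d) measure" by (rule finite_measure_nu[OF mu])
  obtain C0 where C0: "C0 > 0"
    "\<And>(x :: real^'d) r. norm x \<le> 1 \<Longrightarrow> 0 < r \<Longrightarrow>
      mass \<mu> (cap x r) \<le> C0 * r ^ CARD('d) * (rho x + r) powr (2 * \<mu>)"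
    using cap_upper[OF mu] by metis
  define p where "p = wexp \<mu>"
  define q where "q = CARD('d) + p + 2"
  have summ: "summable (\<lambda>j. 1 / (real j + 1)\<^sup>2)"
    using inverse_power_summable[of 2, where 'a=real] summable_Suc_iff[of "\<lambda>j. inverse ((real j)\<^sup>2)"]
    by (simp add: inverse_eq_divide add.commute)
  define Z where "Z = (\<Sum>j. 1 / (real j + 1)\<^sup>2)"
  have Z: "(\<Sum>j<N. 1 / (real j + 1)\<^sup>2) \<le> Z" for N
    unfolding Z_def by (rule sum_le_suminf[OF summ]) auto
  have Z1: "Z \<ge> 1" using Z[of 1] by simp
  have "(LINT x|nu \<mu>. 1 / sdist n x y ^ q) \<le> C0 * Z / real n ^ CARD('d) * W_n \<mu> n y"
    if n: "n \<ge> 1" and y: "norm y \<le> 1" for y :: "real^'d" and n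
  proof -
    \<comment> \<open>Chords are at most 2, so \<open>j\<close> runs up to \<open>2 * n\<close>
      inclusive.\<close>
    define N where "N = 2 * n + 1"
    define T where "T = (\<lambda>x. \<Sum>j<N. 1 / (real j + 1) ^ q * indicator (cap y ((real j + 1) / real n)) x)"
    have npos: "real n > 0" using n by simp
    have "(LINT x|nu \<mu>. 1 / sdist n x y ^ q) \<le> (LINT x|nu \<mu>. T x)"
    proof (rule integral_mono_AE)
      show "integrable (nu \<mu>) (\<lambda>x. 1 / sdist n x y ^ q)"
        unfolding sdist_commute[of n _ y]
        using sdist_pos[of n y] by (intro integrable_nu_continuous[OF mu] continuous_intros) (auto simp: less_imp_neq[symmetric])
      show "integrable (nu \<mu>) T"
        unfolding T_def
        by (intro Bochner_Integration.integrable_sum integrable_mult_right) (simp add: emeasure_eq_measure)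
      show "AE x in nu \<mu>. 1 / sdist n x y ^ q \<le> T x"
        using AE_nu_cball[of \<mu>]
      proof eventually_elim
        fix x :: "real^'d" assume x: "norm x \<le> 1"
        define t where "t = real n * chord y x"
        define j where "j = nat \<lfloor>t\<rfloor>"
        have t0: "0 \<le> t" by (simp add: t_def)
        have "chord y x \<le> 2"
          using norm_triangle_ineq4[of "lift y" "lift x"] norm_lift[OF x] norm_lift[OF y] by (simp add: dist_norm)
        then have "t \<le> real n * 2" unfolding t_def by (intro mult_left_mono) auto
        moreover have j: "real j \<le> t" "t \<le> real j + 1" using t0 unfolding j_def by linarith+
        ultimately have "real j \<le> real (2 * n)" by simp
        then have jN: "j < N" by (simp add: N_def)
        have "x \<in> cap y ((real j + 1) / real n)" using x j npos by (simp add: cap_def t_def field_simps)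
        moreover have "1 / sdist n x y ^ q \<le> 1 / (real j + 1) ^ q"
          using j by (intro divide_left_mono power_mono) (auto simp: sdist_def t_def dist_commute add_pos_nonneg)
        ultimately have "1 / sdist n x y ^ q \<le> 1 / (real j + 1) ^ q * indicator (cap y ((real j + 1) / real n)) x" by simp
        also have "\<dots> \<le> T x"
          unfolding T_def using jN by (intro member_le_sum[where f = "\<lambda>j. 1 / (real j + 1) ^ q * indicator (cap y ((real j + 1) / real n)) x"]) auto
        finally show "1 / sdist n x y ^ q \<le> T x" .
      qed
    qed
    also have "\<dots> = (\<Sum>j<N. 1 / (real j + 1) ^ q * mass \<mu> (cap y ((real j + 1) / real n)))"
      unfolding T_def by (subst Bochner_Integration.integral_sum) (auto simp: emeasure_eq_measure)
    also have "\<dots> \<le> (\<Sum>j<N. C0 / real n ^ CARD('d) * W_n \<mu> n y * (1 / (real j + 1)\<^sup>2))"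
    proof (rule sum_mono)
      fix j
      define J where "J = real j + 1"
      have J: "J \<ge> 1" by (simp add: J_def)
      have "rho y + J / real n \<le> J * (rho y + 1 / real n)"
        using mult_right_mono[OF J rho_bounds(1)[OF y]] by (simp add: distrib_left)
      then have "(rho y + J / real n) powr (2 * \<mu>) \<le> (J * (rho y + 1 / real n)) powr (2 * \<mu>)"
        using rho_bounds[OF y] J mu by (intro powr_mono2) auto
      also have "\<dots> = J powr (2 * \<mu>) * W_n \<mu> n y" using J rho_bounds[OF y] by (simp add: powr_mult W_n_rho)
      also have "\<dots> \<le> J ^ p * W_n \<mu> n y"
        unfolding p_def using powr_le_wexp[OF J] by (intro mult_right_mono) (auto simp: W_n_def)
      finally have "C0 * (J / real n) ^ CARD('d) * (rho y + J / real n) powr (2 * \<mu>)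
          \<le> C0 * (J / real n) ^ CARD('d) * (J ^ p * W_n \<mu> n y)"
        using C0 J by (intro mult_left_mono) auto
      moreover have "mass \<mu> (cap y (J / real n)) \<le> C0 * (J / real n) ^ CARD('d) * (rho y + J / real n) powr (2 * \<mu>)"
        using C0(2)[OF y, of "J / real n"] J npos by simp
      ultimately have "1 / J ^ q * mass \<mu> (cap y (J / real n)) \<le> 1 / J ^ q * (C0 * (J / real n) ^ CARD('d) * (J ^ p * W_n \<mu> n y))"
        using J by (intro mult_left_mono) auto
      also have "\<dots> = C0 / real n ^ CARD('d) * W_n \<mu> n y * (1 / J\<^sup>2)"
        using J by (simp add: q_def power_add power_divide power2_eq_square)
      finally show "1 / (real j + 1) ^ q * mass \<mu> (cap y ((real j + 1) / real n))
          \<le> C0 / real n ^ CARD('d) * W_n \<mu> n y * (1 / (real j + 1)\<^sup>2)"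
        by (simp only: J_def)
    qed
    also have "\<dots> = C0 / real n ^ CARD('d) * W_n \<mu> n y * (\<Sum>j<N. 1 / (real j + 1)\<^sup>2)"
      by (simp add: sum_distrib_left)
    also have "\<dots> \<le> C0 / real n ^ CARD('d) * W_n \<mu> n y * Z"
      using C0 by (intro mult_left_mono Z) (auto simp: W_n_def)
    finally show ?thesis by (simp add: mult_ac)
  qed
  then show thesis using that[of "C0 * Z"] C0 Z1 by (simp add: q_def p_def)
qed

section \<open>The Marcinkiewicz-Zygmund inequality\<close>

text \<open>The sets \<open>A z\<close> are not the cells themselves: closed cells may overlap outside their interiors.\<close>

definition subordinate :: "real \<Rightarrow> (real^'d) set \<Rightarrow> (real^'d \<Rightarrow> (real^'d) set) \<Rightarrow> bool" where
  "subordinate \<epsilon> X A \<longleftrightarrow> finite X \<and> X \<subseteq> cball 0 1 \<and> disjoint_family_on A X \<and>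
     (\<forall>z\<in>X. A z \<in> sets borel \<and> A z \<subseteq> cap z \<epsilon>)"

text \<open>Each cell contributes a local average of \<open>|f|\<close>; summing under the integral
  leaves, at each \<open>y\<close>, a Riemann sum of the decaying kernel. Cells have radius at most
  \<open>1/n\<close>, so the kernel varies by at most \<open>2^q\<close> on a cell and the Riemann
  sum is bounded by the integral. The small factor \<open>n * \<epsilon>\<close> comes from the
  oscillation estimate.\<close>

lemma Marcinkiewicz_Zygmund:
  assumes mu: "\<mu> \<ge> 0"
  obtains C where "C > 0"
    "\<And>(f :: real^'d \<Rightarrow> real) n \<epsilon> (X :: (real^'d) set) A. n \<ge> 1 \<Longrightarrow> ball_poly n f \<Longrightarrow>
      continuous_on UNIV f \<Longrightarrow> 0 \<le> \<epsilon> \<Longrightarrow> real n * \<epsilon> \<le> 1 \<Longrightarrow> subordinate \<epsilon> X A \<Longrightarrow>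
      (\<Sum>z\<in>X. LINT x|nu \<mu>. indicator (A z) x * \<bar>f x - f z\<bar>) \<le> C * (real n * \<epsilon>) * (LINT x|nu \<mu>. \<bar>f x\<bar>)"
proof -
  interpret finite_measure "nu \<mu> :: (real^'d) measure" by (rule finite_measure_nu[OF mu])
  define p where "p = wexp \<mu>"
  define q where "q = CARD('d) + p + 2"
  obtain C1 C2 where C12: "C1 > 0" "C2 > 0"
    and loc: "\<And>(f :: real^'d \<Rightarrow> real) n x0. n \<ge> 1 \<Longrightarrow> ball_poly n f \<Longrightarrow> continuous_on UNIV f \<Longrightarrow> norm x0 \<le> 1 \<Longrightarrow>
      local_bound \<mu> (q + p) C1 C2 n f x0"
    by (rule weighted_local_bound[OF mu, of "q + p"]) (rule that)
  obtain C3 where C3': "C3 > 0"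
    "\<And>(y :: real^'d) n. n \<ge> 1 \<Longrightarrow> norm y \<le> 1 \<Longrightarrow>
      (LINT x|nu \<mu>. 1 / sdist n x y ^ (CARD('d) + wexp \<mu> + 2)) \<le> C3 / real n ^ CARD('d) * W_n \<mu> n y"
    by (rule decay_integral[OF mu]) (rule that)
  note C3 = C3'[folded p_def, folded q_def]
  define C where "C = C1 * C2 * (2 ^ q * C3)"
  have C0: "C > 0" using C12 C3 by (simp add: C_def)
  have main: "(\<Sum>z\<in>X. LINT x|nu \<mu>. indicator (A z) x * \<bar>f x - f z\<bar>) \<le> C * (real n * \<epsilon>) * (LINT x|nu \<mu>. \<bar>f x\<bar>)"
    if n: "n \<ge> 1" and f: "ball_poly n f" and cf: "continuous_on UNIV f"
      and eps: "0 \<le> \<epsilon>" "real n * \<epsilon> \<le> 1" and sub: "subordinate \<epsilon> X A"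
    for f :: "real^'d \<Rightarrow> real" and n \<epsilon> and X :: "(real^'d) set" and A
  proof -
    have X: "finite X" "X \<subseteq> cball 0 1"
      and A: "\<And>z. z \<in> X \<Longrightarrow> A z \<in> sets borel" "\<And>z. z \<in> X \<Longrightarrow> A z \<subseteq> cap z \<epsilon>" "disjoint_family_on A X"
      using sub by (auto simp: subordinate_def)
    define a where "a = (\<lambda>z. mass \<mu> (A z))"
    define G where "G = (\<lambda>z y. \<bar>f y\<bar> / sdist n z y ^ (q + p))"
    have npos: "real n > 0" using n by simp
    have nX: "norm z \<le> 1" if "z \<in> X" for z using X that by auto
    have intG: "integrable (nu \<mu>) (G z)" for z
      unfolding G_def using sdist_pos[of n z]
      by (intro integrable_nu_continuous[OF mu] continuous_intros cf) (auto simp: less_imp_neq[symmetric])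
    have Abd: "norm x \<le> 1 \<and> real n * chord z x \<le> real n * \<epsilon>" if "z \<in> X" "x \<in> A z" for z x
      using A(2)[OF that(1)] that(2) by (auto simp: cap_def intro: mult_left_mono)
    have single: "(LINT x|nu \<mu>. indicator (A z) x * \<bar>f x - f z\<bar>)
        \<le> C1 * (real n * \<epsilon>) * (C2 * real n ^ CARD('d)) * (a z / W_n \<mu> n z * (LINT y|nu \<mu>. G z y))"
      if xi: "z \<in> X" for z
    proof -
      obtain S where S: "S \<ge> 0"
        "\<And>x. norm x \<le> 1 \<Longrightarrow> real n * chord z x \<le> 1 \<Longrightarrow> \<bar>f x - f z\<bar> \<le> C1 * (real n * chord z x) * S"
        "S * W_n \<mu> n z \<le> C2 * real n ^ CARD('d) * (LINT y|nu \<mu>. G z y)"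
        using loc[OF n f cf nX[OF xi]] unfolding G_def local_bound_def by blast
      have Wpos: "W_n \<mu> n z > 0" by (rule W_n_pos[OF n nX[OF xi]])
      have "(LINT x|nu \<mu>. indicator (A z) x * \<bar>f x - f z\<bar>) \<le> (LINT x|nu \<mu>. indicator (A z) x * (C1 * (real n * \<epsilon>) * S))"
      proof (rule integral_mono)
        show "integrable (nu \<mu>) (\<lambda>x. indicator (A z) x * \<bar>f x - f z\<bar>)"
          using A(1)[OF xi]
          by (intro integrable_mult_indicator[where 'b=real, unfolded real_scaleR_def] integrable_nu_continuous[OF mu] continuous_intros cf) auto
        show "integrable (nu \<mu>) (\<lambda>x. indicator (A z) x * (C1 * (real n * \<epsilon>) * S))"
          using A(1)[OF xi] by (simp add: emeasure_eq_measure)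
        fix x
        show "indicator (A z) x * \<bar>f x - f z\<bar> \<le> indicator (A z) x * (C1 * (real n * \<epsilon>) * S)"
        proof (cases "x \<in> A z")
          case True
          have "\<bar>f x - f z\<bar> \<le> C1 * (real n * chord z x) * S"
            using Abd[OF xi True] eps by (intro S(2)) auto
          also have "\<dots> \<le> C1 * (real n * \<epsilon>) * S"
            using Abd[OF xi True] C12(1) S(1) npos by (intro mult_right_mono mult_left_mono) auto
          finally show ?thesis using True by simp
        qed simp
      qed
      also have "\<dots> = C1 * (real n * \<epsilon>) * (a z * S)"
        using A(1)[OF xi] by (simp add: a_def)
      also have "\<dots> \<le> C1 * (real n * \<epsilon>) * (a z * (C2 * real n ^ CARD('d) * (LINT y|nu \<mu>. G z y) / W_n \<mu> n z))"
        using C12 eps S(3) Wpos by (intro mult_left_mono) (auto simp: a_def field_simps)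
      finally show ?thesis by (simp add: mult_ac)
    qed
    have "(\<Sum>z\<in>X. LINT x|nu \<mu>. indicator (A z) x * \<bar>f x - f z\<bar>)
        \<le> C1 * (real n * \<epsilon>) * (C2 * real n ^ CARD('d)) * (\<Sum>z\<in>X. a z / W_n \<mu> n z * (LINT y|nu \<mu>. G z y))"
      unfolding sum_distrib_left by (intro sum_mono single)
    also have "(\<Sum>z\<in>X. a z / W_n \<mu> n z * (LINT y|nu \<mu>. G z y)) = (LINT y|nu \<mu>. (\<Sum>z\<in>X. a z / W_n \<mu> n z * G z y))"
      using intG by (subst Bochner_Integration.integral_sum) auto
    also have "\<dots> \<le> (LINT y|nu \<mu>. (2 ^ q * C3 / real n ^ CARD('d)) * \<bar>f y\<bar>)"
    proof (rule integral_mono_AE)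
      show "integrable (nu \<mu>) (\<lambda>y. \<Sum>z\<in>X. a z / W_n \<mu> n z * G z y)"
        using intG by (intro Bochner_Integration.integrable_sum integrable_mult_right)
      show "integrable (nu \<mu>) (\<lambda>y. (2 ^ q * C3 / real n ^ CARD('d)) * \<bar>f y\<bar>)"
        by (intro integrable_mult_right integrable_nu_continuous[OF mu] continuous_intros cf)
      show "AE y in nu \<mu>. (\<Sum>z\<in>X. a z / W_n \<mu> n z * G z y) \<le> (2 ^ q * C3 / real n ^ CARD('d)) * \<bar>f y\<bar>"
        using AE_nu_cball[of \<mu>]
      proof eventually_elim
        fix y :: "real^'d" assume y: "norm y \<le> 1"
        have Wy: "W_n \<mu> n y > 0" by (rule W_n_pos[OF n y])
        define T where "T = (\<lambda>x. 2 ^ q * (1 / sdist n x y ^ q))"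
        have intu: "integrable (nu \<mu>) (\<lambda>x. 1 / sdist n x y ^ q)"
          unfolding sdist_commute[of n _ y]
          using sdist_pos[of n y] by (intro integrable_nu_continuous[OF mu] continuous_intros) (auto simp: less_imp_neq[symmetric])
        have intAu: "integrable (nu \<mu>) (\<lambda>x. indicator (A z) x * T x)" if "z \<in> X" for z
          unfolding T_def using A(1)[OF that] intu
          by (intro integrable_mult_indicator[where 'b=real, unfolded real_scaleR_def] integrable_mult_right) auto
        have one: "a z / sdist n z y ^ q \<le> (LINT x|nu \<mu>. indicator (A z) x * T x)" if xi: "z \<in> X" for z
        proof -
          have "a z / sdist n z y ^ q = (LINT x|nu \<mu>. indicator (A z) x * (1 / sdist n z y ^ q))"
            using A(1)[OF xi] by (simp add: a_def)
          also have "\<dots> \<le> (LINT x|nu \<mu>. indicator (A z) x * T x)"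
          proof (rule integral_mono)
            show "integrable (nu \<mu>) (\<lambda>x. indicator (A z) x * (1 / sdist n z y ^ q))"
              using A(1)[OF xi] by (simp add: emeasure_eq_measure)
            show "integrable (nu \<mu>) (\<lambda>x. indicator (A z) x * T x)" by (rule intAu[OF xi])
            fix x
            show "indicator (A z) x * (1 / sdist n z y ^ q) \<le> indicator (A z) x * T x"
            proof (cases "x \<in> A z")
              case True
              have "sdist n x z \<le> 2" using Abd[OF xi True] eps by (simp add: sdist_def dist_commute)
              then have "sdist n x z * sdist n z y \<le> 2 * sdist n z y" using sdist_pos[of n z y] by (intro mult_right_mono) auto
              then have "sdist n x y \<le> 2 * sdist n z y" using sdist_submult[of n x y z] by linarith
              then have "sdist n x y ^ q \<le> (2 * sdist n z y) ^ q" using sdist_pos[of n x y] by (intro power_mono) auto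
              then show ?thesis using True sdist_pos[of n x y] sdist_pos[of n z y]
                by (simp add: T_def power_mult_distrib field_simps)
            qed simp
          qed
          finally show ?thesis .
        qed
        have "(\<Sum>z\<in>X. a z / sdist n z y ^ q) \<le> (\<Sum>z\<in>X. LINT x|nu \<mu>. indicator (A z) x * T x)"
          by (intro sum_mono one)
        also have "\<dots> = (LINT x|nu \<mu>. (\<Sum>z\<in>X. indicator (A z) x * T x))"
          using intAu by (subst Bochner_Integration.integral_sum) auto
        also have "\<dots> \<le> (LINT x|nu \<mu>. T x)"
        proof (rule integral_mono)
          show "integrable (nu \<mu>) (\<lambda>x. \<Sum>z\<in>X. indicator (A z) x * T x)"
            using intAu by (intro Bochner_Integration.integrable_sum)
          show "integrable (nu \<mu>) (\<lambda>x. T x)" unfolding T_def using intu by (intro integrable_mult_right)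
          fix x
          have "(\<Sum>z\<in>X. indicator (A z) x * T x) = indicator (\<Union>z\<in>X. A z) x * T x"
            by (simp only: sum_distrib_right[symmetric] indicator_UN_disjoint[OF X(1) A(3)])
          also have "\<dots> \<le> 1 * T x"
            using sdist_pos[of n x y] by (intro mult_right_mono) (auto simp: T_def indicator_def)
          finally show "(\<Sum>z\<in>X. indicator (A z) x * T x) \<le> T x" by simp
        qed
        also have "\<dots> = 2 ^ q * (LINT x|nu \<mu>. 1 / sdist n x y ^ q)" unfolding T_def by (rule integral_mult_right_zero)
        also have "\<dots> \<le> 2 ^ q * (C3 / real n ^ CARD('d) * W_n \<mu> n y)"
          by (intro mult_left_mono C3(2)[OF n y]) auto
        finally have key: "(\<Sum>z\<in>X. a z / sdist n z y ^ q) \<le> 2 ^ q * (C3 / real n ^ CARD('d) * W_n \<mu> n y)" .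
        \<comment> \<open>Of the \<open>q + p\<close> powers in \<open>G\<close>, \<open>p\<close>
          replace the weight at \<open>z\<close> by the weight at \<open>y\<close>; the remaining
          \<open>q\<close> form the Riemann sum estimated above.\<close>
        have "(\<Sum>z\<in>X. a z / W_n \<mu> n z * G z y) \<le> (\<Sum>z\<in>X. \<bar>f y\<bar> / W_n \<mu> n y * (a z / sdist n z y ^ q))"
        proof (rule sum_mono)
          fix z assume xi: "z \<in> X"
          have Wx: "W_n \<mu> n z > 0" by (rule W_n_pos[OF n nX[OF xi]])
          have "W_n \<mu> n y \<le> sdist n z y ^ p * W_n \<mu> n z"
            using W_n_doubling[OF n mu y nX[OF xi]] by (simp add: p_def sdist_commute)
          then have "1 / (W_n \<mu> n z * sdist n z y ^ p) \<le> 1 / W_n \<mu> n y"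
            using Wy Wx sdist_pos[of n z y] by (intro divide_left_mono) (auto simp: mult.commute)
          then have "(a z * \<bar>f y\<bar> / sdist n z y ^ q) * (1 / (W_n \<mu> n z * sdist n z y ^ p)) \<le> (a z * \<bar>f y\<bar> / sdist n z y ^ q) * (1 / W_n \<mu> n y)"
            using sdist_pos[of n z y] by (intro mult_left_mono) (auto simp: a_def)
          then show "a z / W_n \<mu> n z * G z y \<le> \<bar>f y\<bar> / W_n \<mu> n y * (a z / sdist n z y ^ q)"
            by (simp add: G_def power_add mult_ac)
        qed
        also have "\<dots> = \<bar>f y\<bar> / W_n \<mu> n y * (\<Sum>z\<in>X. a z / sdist n z y ^ q)" by (simp add: sum_distrib_left)
        also have "\<dots> \<le> \<bar>f y\<bar> / W_n \<mu> n y * (2 ^ q * (C3 / real n ^ CARD('d) * W_n \<mu> n y))"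
          using key Wy by (intro mult_left_mono) auto
        also have "\<dots> = (2 ^ q * C3 / real n ^ CARD('d)) * \<bar>f y\<bar>" using Wy by simp
        finally show "(\<Sum>z\<in>X. a z / W_n \<mu> n z * G z y) \<le> (2 ^ q * C3 / real n ^ CARD('d)) * \<bar>f y\<bar>" .
      qed
    qed
    also have "\<dots> = (2 ^ q * C3 / real n ^ CARD('d)) * (LINT y|nu \<mu>. \<bar>f y\<bar>)" by (rule integral_mult_right_zero)
    finally have "(\<Sum>z\<in>X. LINT x|nu \<mu>. indicator (A z) x * \<bar>f x - f z\<bar>) \<le>
        C1 * (real n * \<epsilon>) * (C2 * real n ^ CARD('d)) * ((2 ^ q * C3 / real n ^ CARD('d)) * (LINT y|nu \<mu>. \<bar>f y\<bar>))"
      using C12 eps by (simp add: mult_left_mono)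
    also have "\<dots> = C * (real n * \<epsilon>) * (LINT x|nu \<mu>. \<bar>f x\<bar>)"
      using npos by (simp add: C_def)
    finally show ?thesis .
  qed
  show thesis by (rule that[OF C0]) (rule main)
qed

section \<open>Positive weights\<close>

text \<open>At a minimizer of the squared residual, \<open>key\<close> applied to minus the residual
  \<open>r\<close> supplies an admissible \<open>l\<close>. Moving towards \<open>l\<close> stays in
  the box by convexity and has initial slope at most \<open>-2|r|^2\<close>, so minimality forces
  \<open>r = 0\<close>.\<close>

lemma box_solution:
  fixes M :: "'b \<Rightarrow> 'a \<Rightarrow> real" and t :: "'b \<Rightarrow> real" and lo hi :: "'a \<Rightarrow> real"
  assumes X: "finite X" and I: "finite I" and le: "\<And>z. z \<in> X \<Longrightarrow> lo z \<le> hi z"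
    and key: "\<And>r :: 'b \<Rightarrow> real. \<exists>l. (\<forall>z\<in>X. lo z \<le> l z \<and> l z \<le> hi z) \<and>
      (\<Sum>\<alpha>\<in>I. r \<alpha> * t \<alpha>) \<le> (\<Sum>z\<in>X. l z * (\<Sum>\<alpha>\<in>I. r \<alpha> * M \<alpha> z))"
  shows "\<exists>l. (\<forall>z\<in>X. lo z \<le> l z \<and> l z \<le> hi z) \<and> (\<forall>\<alpha>\<in>I. (\<Sum>z\<in>X. l z * M \<alpha> z) = t \<alpha>)"
proof -
  \<comment> \<open>Coordinates off \<open>X\<close> are pinned to 0, which makes the box a compact
    product inside the full function space.\<close>
  define K where "K = (\<lambda>z. if z \<in> X then {lo z..hi z} else {0})"
  define B where "B = PiE UNIV K"
  have B: "l \<in> B \<longleftrightarrow> (\<forall>z. if z \<in> X then lo z \<le> l z \<and> l z \<le> hi z else l z = 0)" for l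
    unfolding B_def K_def PiE_UNIV_domain Pi_def by auto
  have comp: "compact B"
  proof -
    have "compactin (product_topology (\<lambda>_. euclidean) UNIV) (PiE UNIV K)"
      by (subst compactin_PiE) (auto simp: K_def)
    then show ?thesis by (simp add: B_def euclidean_product_topology)
  qed
  have "(\<lambda>z. if z \<in> X then lo z else 0) \<in> B" using le by (auto simp: B)
  then have ne: "B \<noteq> {}" by blast
  define res where "res = (\<lambda>l \<alpha>. (\<Sum>z\<in>X. l z * M \<alpha> z) - t \<alpha>)"
  define \<Phi> where "\<Phi> = (\<lambda>l. \<Sum>\<alpha>\<in>I. (res l \<alpha>)\<^sup>2)"
  have "continuous_on B \<Phi>"
    unfolding \<Phi>_def res_def
    by (intro continuous_intros continuous_on_subset[OF continuous_on_product_coordinates]) auto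
  then obtain l0 where l0: "l0 \<in> B" "\<And>l. l \<in> B \<Longrightarrow> \<Phi> l0 \<le> \<Phi> l"
    using continuous_attains_inf[OF comp ne] by metis
  define r where "r = res l0"
  obtain l where l: "\<forall>z\<in>X. lo z \<le> l z \<and> l z \<le> hi z"
    "(\<Sum>\<alpha>\<in>I. - r \<alpha> * t \<alpha>) \<le> (\<Sum>z\<in>X. l z * (\<Sum>\<alpha>\<in>I. - r \<alpha> * M \<alpha> z))"
    using key[of "\<lambda>\<alpha>. - r \<alpha>"] by blast
  define D where "D = (\<lambda>\<alpha>. \<Sum>z\<in>X. (l z - l0 z) * M \<alpha> z)"
  have rD: "(\<Sum>\<alpha>\<in>I. r \<alpha> * D \<alpha>) \<le> - (\<Sum>\<alpha>\<in>I. (r \<alpha>)\<^sup>2)"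
  proof -
    have D: "D \<alpha> = (\<Sum>z\<in>X. l z * M \<alpha> z) - (r \<alpha> + t \<alpha>)" for \<alpha>
      by (simp add: D_def r_def res_def left_diff_distrib sum_subtractf)
    have "(\<Sum>z\<in>X. l z * (\<Sum>\<alpha>\<in>I. - r \<alpha> * M \<alpha> z)) = - (\<Sum>\<alpha>\<in>I. r \<alpha> * (\<Sum>z\<in>X. l z * M \<alpha> z))"
      by (simp add: sum_distrib_left sum_negf mult.left_commute) (rule sum.swap)
    then have "(\<Sum>\<alpha>\<in>I. r \<alpha> * (\<Sum>z\<in>X. l z * M \<alpha> z)) \<le> (\<Sum>\<alpha>\<in>I. r \<alpha> * t \<alpha>)"
      using l(2) by (simp add: sum_negf)
    then show ?thesis
      by (simp add: D algebra_simps sum_subtractf sum.distrib power2_eq_square)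
  qed
  have quad: "0 \<le> 2 * s * (\<Sum>\<alpha>\<in>I. r \<alpha> * D \<alpha>) + s\<^sup>2 * (\<Sum>\<alpha>\<in>I. (D \<alpha>)\<^sup>2)" if s: "0 \<le> s" "s \<le> 1" for s
  proof -
    define ls where "ls = (\<lambda>z. if z \<in> X then (1 - s) * l0 z + s * l z else 0)"
    have "ls \<in> B"
    proof -
      have "lo z \<le> ls z \<and> ls z \<le> hi z" if "z \<in> X" for z
      proof -
        have "lo z \<le> l0 z" "l0 z \<le> hi z" using l0(1) that unfolding B by metis+
        then have "(1 - s) * lo z + s * lo z \<le> ls z" "ls z \<le> (1 - s) * hi z + s * hi z"
          using l(1) that s unfolding ls_def by (auto intro!: add_mono mult_left_mono)
        then show ?thesis by (simp add: algebra_simps)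
      qed
      then show ?thesis by (simp add: B) (simp add: ls_def)
    qed
    then have "\<Phi> l0 \<le> \<Phi> ls" by (rule l0(2))
    moreover have "res ls \<alpha> = r \<alpha> + s * D \<alpha>" for \<alpha>
    proof -
      have "(\<Sum>z\<in>X. ls z * M \<alpha> z) = (\<Sum>z\<in>X. l0 z * M \<alpha> z + s * ((l z - l0 z) * M \<alpha> z))"
        by (intro sum.cong) (auto simp: ls_def algebra_simps)
      then show ?thesis by (simp add: res_def r_def D_def sum.distrib sum_distrib_left)
    qed
    then have "\<Phi> ls = \<Phi> l0 + 2 * s * (\<Sum>\<alpha>\<in>I. r \<alpha> * D \<alpha>) + s\<^sup>2 * (\<Sum>\<alpha>\<in>I. (D \<alpha>)\<^sup>2)"
      by (simp add: \<Phi>_def r_def[symmetric] power2_sum power_mult_distrib sum.distrib sum_distrib_left mult_ac)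
    ultimately show ?thesis by linarith
  qed
  have "(\<Sum>\<alpha>\<in>I. (r \<alpha>)\<^sup>2) \<le> 0"
  proof (rule ccontr)
    assume neg: "\<not> ?thesis"
    define a b where "a = (\<Sum>\<alpha>\<in>I. (r \<alpha>)\<^sup>2)" and "b = (\<Sum>\<alpha>\<in>I. (D \<alpha>)\<^sup>2)"
    have a: "a > 0" using neg by (simp add: a_def)
    have b: "b \<ge> 0" unfolding b_def by (intro sum_nonneg) auto
    \<comment> \<open>A step with \<open>s * b \<le> a\<close>, so the quadratic term cannot
      compensate the linear decrease \<open>-2 * s * a\<close>.\<close>
    define s where "s = a / (a + b)"
    have s: "0 < s" "s \<le> 1" using a b by (auto simp: s_def divide_le_eq)
    have "0 \<le> 2 * s * (\<Sum>\<alpha>\<in>I. r \<alpha> * D \<alpha>) + s\<^sup>2 * b" unfolding b_def by (rule quad) (use s in auto)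
    also have "\<dots> \<le> 2 * s * (- a) + s\<^sup>2 * b"
      using rD s unfolding a_def by (intro add_mono mult_left_mono) auto
    also have "\<dots> = s * (s * b - 2 * a)" by (simp add: power2_eq_square algebra_simps)
    finally have "0 \<le> s * b - 2 * a" using s by (simp add: zero_le_mult_iff)
    moreover have "s * b \<le> a" using a b by (simp add: s_def divide_le_eq algebra_simps)
    ultimately show False using a by linarith
  qed
  then have "\<forall>\<alpha>\<in>I. (r \<alpha>)\<^sup>2 = 0"
    using I sum_nonneg_eq_0_iff[of I "\<lambda>\<alpha>. (r \<alpha>)\<^sup>2"] sum_nonneg[of I "\<lambda>\<alpha>. (r \<alpha>)\<^sup>2"] by force
  then have "\<forall>\<alpha>\<in>I. (\<Sum>z\<in>X. l0 z * M \<alpha> z) = t \<alpha>" by (simp add: r_def res_def)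
  moreover have "\<forall>z\<in>X. lo z \<le> l0 z \<and> l0 z \<le> hi z" using l0(1) unfolding B by metis
  ultimately show ?thesis by blast
qed

lemma continuous_monomial: "continuous_on UNIV (\<lambda>x :: real^'d. \<Prod>i\<in>UNIV. (x $ i) ^ \<alpha> i)"
  by (intro continuous_intros)

lemma continuous_Poly_le: "f \<in> Poly_le n \<Longrightarrow> continuous_on UNIV f"
  unfolding Poly_le_def by (auto intro!: continuous_intros)

definition cell_weights ::
  "real \<Rightarrow> nat \<Rightarrow> (real^'d) set \<Rightarrow> (real^'d \<Rightarrow> (real^'d) set) \<Rightarrow> (real^'d \<Rightarrow> real) \<Rightarrow> bool" where
  "cell_weights \<mu> n X A l \<longleftrightarrow> (\<forall>z\<in>X. mass \<mu> (A z) / 2 \<le> l z \<and> l z \<le> 3 / 2 * mass \<mu> (A z)) \<and>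
        (\<forall>f\<in>Poly_le n. (LINT x|nu \<mu>. f x) = (\<Sum>z\<in>X. l z * f z))"

text \<open>The summand \<open>3 * C0\<close> of the constant makes the discretization error at most
  a third of the integral of \<open>|f|\<close>, and the \<open>+ 1\<close> ensures
  \<open>n * \<epsilon> \<le> 1\<close>. One third is what leads to the relative perturbation
  \<open>1/2\<close> of the cell masses.\<close>

lemma cubature_of_partition:
  assumes mu: "\<mu> \<ge> 0"
  obtains C where "C > 0"
    "\<And>n \<epsilon> (X :: (real^'d) set) A. n \<ge> 1 \<Longrightarrow> 0 \<le> \<epsilon> \<Longrightarrow> C * (real n * \<epsilon>) \<le> 1 \<Longrightarrow> subordinate \<epsilon> X A \<Longrightarrow>
      (\<Union>z\<in>X. A z) = cball 0 1 \<Longrightarrow>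
      \<exists>l. cell_weights \<mu> n X A l"
proof -
  interpret finite_measure "nu \<mu> :: (real^'d) measure" by (rule finite_measure_nu[OF mu])
  obtain C0 where C0: "C0 > 0"
    and MZ: "\<And>(f :: real^'d \<Rightarrow> real) n \<epsilon> (X :: (real^'d) set) A. n \<ge> 1 \<Longrightarrow> ball_poly n f \<Longrightarrow>
      continuous_on UNIV f \<Longrightarrow> 0 \<le> \<epsilon> \<Longrightarrow> real n * \<epsilon> \<le> 1 \<Longrightarrow> subordinate \<epsilon> X A \<Longrightarrow>
      (\<Sum>z\<in>X. LINT x|nu \<mu>. indicator (A z) x * \<bar>f x - f z\<bar>) \<le> C0 * (real n * \<epsilon>) * (LINT x|nu \<mu>. \<bar>f x\<bar>)"
    by (rule Marcinkiewicz_Zygmund[OF mu]) (rule that)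
  define C where "C = 3 * C0 + 1"
  have C: "C > 0" using C0 by (simp add: C_def)
  have main: "\<exists>l. cell_weights \<mu> n X A l"
    if n: "n \<ge> 1" and eps: "0 \<le> \<epsilon>" "C * (real n * \<epsilon>) \<le> 1" and sub: "subordinate \<epsilon> X A"
      and cover: "(\<Union>z\<in>X. A z) = cball 0 1"
    for n \<epsilon> and X :: "(real^'d) set" and A
  proof -
    have X: "finite X" and A: "\<And>z. z \<in> X \<Longrightarrow> A z \<in> sets borel" "disjoint_family_on A X"
      using sub by (auto simp: subordinate_def)
    define a where "a = (\<lambda>z. mass \<mu> (A z))"
    have a0: "a z \<ge> 0" for z by (simp add: a_def)
    have ne: "0 \<le> real n * \<epsilon>" using eps by simp
    have eps': "real n * \<epsilon> \<le> 1" "C0 * (real n * \<epsilon>) \<le> 1 / 3"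
    proof -
      have "C * (real n * \<epsilon>) = 3 * (C0 * (real n * \<epsilon>)) + real n * \<epsilon>" by (simp add: C_def algebra_simps)
      moreover have "0 \<le> C0 * (real n * \<epsilon>)" using C0 ne by simp
      ultimately show "real n * \<epsilon> \<le> 1" "C0 * (real n * \<epsilon>) \<le> 1 / 3" using eps ne by linarith+
    qed
    have intA: "integrable (nu \<mu>) (\<lambda>x. indicator (A z) x * g x)" if "z \<in> X" "continuous_on UNIV g"
      for z and g :: "real^'d \<Rightarrow> real"
      using A(1)[OF that(1)] integrable_nu_continuous[OF mu that(2)]
      by (intro integrable_mult_indicator[where 'b=real, unfolded real_scaleR_def]) auto
    have split: "(LINT x|nu \<mu>. g x) = (\<Sum>z\<in>X. LINT x|nu \<mu>. indicator (A z) x * g x)"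
      if g: "continuous_on UNIV g" for g :: "real^'d \<Rightarrow> real"
    proof -
      have "(LINT x|nu \<mu>. g x) = (LINT x|nu \<mu>. (\<Sum>z\<in>X. indicator (A z) x * g x))"
      proof (rule integral_cong_AE)
        have "g \<in> borel_measurable borel" using g by (rule borel_measurable_continuous_onI)
        then show "g \<in> borel_measurable (nu \<mu>)" by simp
        show "(\<lambda>x. \<Sum>z\<in>X. indicator (A z) x * g x) \<in> borel_measurable (nu \<mu>)"
          using intA[OF _ g] by (intro borel_measurable_sum borel_measurable_integrable)
        show "AE x in nu \<mu>. g x = (\<Sum>z\<in>X. indicator (A z) x * g x)"
          using AE_nu_cball[of \<mu>]
        proof eventually_elim
          fix x :: "real^'d" assume "norm x \<le> 1"
          then have "x \<in> (\<Union>z\<in>X. A z)" unfolding cover by simp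
          then have "indicator (\<Union>z\<in>X. A z) x = (1::real)" by simp
          then show "g x = (\<Sum>z\<in>X. indicator (A z) x * g x)"
            by (simp only: sum_distrib_right[symmetric] indicator_UN_disjoint[OF X A(2), symmetric] mult_1)
        qed
      qed
      also have "\<dots> = (\<Sum>z\<in>X. LINT x|nu \<mu>. indicator (A z) x * g x)"
        using intA[OF _ g] by (intro Bochner_Integration.integral_sum)
      finally show ?thesis .
    qed
    define mono where "mono = (\<lambda>\<alpha> (x :: real^'d). \<Prod>i\<in>UNIV. (x $ i) ^ \<alpha> i)"
    define I where "I = {\<alpha> :: 'd \<Rightarrow> nat. (\<Sum>i\<in>UNIV. \<alpha> i) \<le> n}"
    define t where "t = (\<lambda>\<alpha>. LINT x|nu \<mu>. mono \<alpha> x)"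
    have I: "finite I" unfolding I_def by (rule finite_multi_indices)
    have Lint: "(LINT x|nu \<mu>. (\<Sum>\<alpha>\<in>I. r \<alpha> * mono \<alpha> x)) = (\<Sum>\<alpha>\<in>I. r \<alpha> * t \<alpha>)" for r
    proof -
      have "integrable (nu \<mu>) (mono \<alpha>)" for \<alpha>
        unfolding mono_def by (rule integrable_nu_continuous[OF mu continuous_monomial])
      then show ?thesis by (subst Bochner_Integration.integral_sum) (auto simp: t_def)
    qed
    have "\<exists>l. (\<forall>z\<in>X. a z / 2 \<le> l z \<and> l z \<le> 3 / 2 * a z) \<and> (\<forall>\<alpha>\<in>I. (\<Sum>z\<in>X. l z * mono \<alpha> z) = t \<alpha>)"
    proof (rule box_solution[OF X I])
      show "a z / 2 \<le> 3 / 2 * a z" for z using a0[of z] by simp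
      fix r :: "('d \<Rightarrow> nat) \<Rightarrow> real"
      define f where "f = (\<lambda>x. \<Sum>\<alpha>\<in>I. r \<alpha> * mono \<alpha> x)"
      have fP: "f \<in> Poly_le n" unfolding f_def I_def mono_def Poly_le_def by blast
      have cf: "continuous_on UNIV f" by (rule continuous_Poly_le[OF fP])
      define F where "F = (LINT x|nu \<mu>. \<bar>f x\<bar>)"
      define T where "T = (\<Sum>z\<in>X. LINT x|nu \<mu>. indicator (A z) x * \<bar>f x - f z\<bar>)"
      define Z where "Z = (\<Sum>z\<in>X. a z * \<bar>f z\<bar>)"
      have F0: "F \<ge> 0" by (simp add: F_def)
      have T: "T \<le> F / 3"
      proof -
        have "T \<le> C0 * (real n * \<epsilon>) * F"
          unfolding T_def F_def by (rule MZ[OF n Poly_le_pdeg[OF fP] cf eps(1) eps'(1) sub])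
        also have "\<dots> \<le> 1 / 3 * F" using eps'(2) F0 by (rule mult_right_mono)
        finally show ?thesis by simp
      qed
      have const: "(LINT x|nu \<mu>. indicator (A z) x * v) = a z * v" if "z \<in> X" for z v
        using A(1)[OF that] by (simp add: a_def)
      have diff: "(LINT x|nu \<mu>. indicator (A z) x * g x) \<le> a z * v + (LINT x|nu \<mu>. indicator (A z) x * \<bar>f x - f z\<bar>)"
        if xi: "z \<in> X" and g: "continuous_on UNIV g" and gv: "\<And>x. g x \<le> v + \<bar>f x - f z\<bar>" for z g v
      proof -
        have c1: "continuous_on UNIV (\<lambda>x. \<bar>f x - f z\<bar>)" by (intro continuous_intros cf)
        have c2: "continuous_on UNIV (\<lambda>x :: real^'d. v)" by (intro continuous_intros)
        have "(LINT x|nu \<mu>. indicator (A z) x * g x) \<le> (LINT x|nu \<mu>. indicator (A z) x * v + indicator (A z) x * \<bar>f x - f z\<bar>)"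
        proof (rule integral_mono)
          show "integrable (nu \<mu>) (\<lambda>x. indicator (A z) x * g x)" by (rule intA[OF xi g])
          show "integrable (nu \<mu>) (\<lambda>x. indicator (A z) x * v + indicator (A z) x * \<bar>f x - f z\<bar>)"
            by (intro Bochner_Integration.integrable_add intA[OF xi c1] intA[OF xi c2])
          show "indicator (A z) x * g x \<le> indicator (A z) x * v + indicator (A z) x * \<bar>f x - f z\<bar>" for x
            using gv[of x] by (simp add: indicator_def)
        qed
        also have "\<dots> = (LINT x|nu \<mu>. indicator (A z) x * v) + (LINT x|nu \<mu>. indicator (A z) x * \<bar>f x - f z\<bar>)"
          by (rule Bochner_Integration.integral_add[OF intA[OF xi c2] intA[OF xi c1]])
        finally show ?thesis by (simp only: const[OF xi])
      qed
      have "(LINT x|nu \<mu>. f x) \<le> (\<Sum>z\<in>X. a z * f z) + T"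
        unfolding split[OF cf] T_def sum.distrib[symmetric]
        by (intro sum_mono diff cf) auto
      moreover have "F \<le> Z + T"
      proof -
        have c: "continuous_on UNIV (\<lambda>x. \<bar>f x\<bar>)" by (intro continuous_intros cf)
        show ?thesis unfolding F_def split[OF c] Z_def T_def sum.distrib[symmetric]
          by (intro sum_mono diff c) auto
      qed
      \<comment> \<open>From \<open>T \<le> F/3\<close> and \<open>F \<le> Z + T\<close> follows
        \<open>T \<le> Z/2\<close>. The weights \<open>l\<close> chosen next realize the bound
        exactly, by raising or lowering each cell mass by half according to the sign of
        \<open>f z\<close>.\<close>
      ultimately have le: "(LINT x|nu \<mu>. f x) \<le> (\<Sum>z\<in>X. a z * f z) + Z / 2" using T by linarith
      define l where "l = (\<lambda>z. a z + a z / 2 * sgn (f z))"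
      have "(\<Sum>z\<in>X. l z * f z) = (\<Sum>z\<in>X. a z * f z + a z * \<bar>f z\<bar> / 2)"
        by (intro sum.cong) (auto simp: l_def abs_sgn algebra_simps)
      then have "(\<Sum>z\<in>X. l z * f z) = (\<Sum>z\<in>X. a z * f z) + Z / 2"
        by (simp add: Z_def sum.distrib sum_divide_distrib)
      with le have "(\<Sum>\<alpha>\<in>I. r \<alpha> * t \<alpha>) \<le> (\<Sum>z\<in>X. l z * f z)" by (simp add: f_def Lint)
      moreover have "\<forall>z\<in>X. a z / 2 \<le> l z \<and> l z \<le> 3 / 2 * a z"
        using a0 by (auto simp: l_def sgn_if)
      ultimately show "\<exists>l. (\<forall>z\<in>X. a z / 2 \<le> l z \<and> l z \<le> 3 / 2 * a z) \<and>
          (\<Sum>\<alpha>\<in>I. r \<alpha> * t \<alpha>) \<le> (\<Sum>z\<in>X. l z * (\<Sum>\<alpha>\<in>I. r \<alpha> * mono \<alpha> z))"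
        unfolding f_def by blast
    qed
    then obtain l where l: "\<forall>z\<in>X. a z / 2 \<le> l z \<and> l z \<le> 3 / 2 * a z" "\<And>\<alpha>. \<alpha> \<in> I \<Longrightarrow> (\<Sum>z\<in>X. l z * mono \<alpha> z) = t \<alpha>"
      by blast
    have "(LINT x|nu \<mu>. f x) = (\<Sum>z\<in>X. l z * f z)" if fP: "f \<in> Poly_le n" for f :: "real^'d \<Rightarrow> real"
    proof -
      obtain r where f: "f = (\<lambda>x. \<Sum>\<alpha>\<in>I. r \<alpha> * mono \<alpha> x)"
        using fP unfolding Poly_le_def I_def mono_def by blast
      have "(\<Sum>z\<in>X. l z * f z) = (\<Sum>z\<in>X. \<Sum>\<alpha>\<in>I. r \<alpha> * (l z * mono \<alpha> z))"
        by (simp add: f sum_distrib_left mult.left_commute)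
      also have "\<dots> = (\<Sum>\<alpha>\<in>I. \<Sum>z\<in>X. r \<alpha> * (l z * mono \<alpha> z))" by (rule sum.swap)
      also have "\<dots> = (\<Sum>\<alpha>\<in>I. r \<alpha> * t \<alpha>)" by (simp add: l(2) flip: sum_distrib_left)
      finally show ?thesis by (simp add: f Lint)
    qed
    then show ?thesis using l(1) unfolding a_def cell_weights_def by blast
  qed
  show thesis by (rule that[OF C]) (rule main)
qed

section \<open>Geometry of the partition\<close>

lemma ball_dist_lift: "ball_dist x y = arccos (lift x \<bullet> lift y)"
  by (simp add: ball_dist_def lift_def rho_def inner_prod_def)

lemma cap_iff: "y \<in> cap x r \<longleftrightarrow> norm y \<le> 1 \<and> chord x y \<le> r"
  by (simp add: cap_def)

lemma dball_iff: "y \<in> dball x r \<longleftrightarrow> norm y \<le> 1 \<and> arccos (lift x \<bullet> lift y) \<le> r"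
  by (simp only: dball_def ball_dist_lift inner_commute[of "lift y" "lift x"] mem_Collect_eq mem_cball_0)

lemma dball_subset_cap:
  assumes x: "norm x \<le> 1"
  shows "dball x r \<subseteq> cap x r"
proof
  fix y assume "y \<in> dball x r"
  then have y: "norm y \<le> 1" "arccos (lift x \<bullet> lift y) \<le> r" unfolding dball_iff by blast+
  show "y \<in> cap x r"
    unfolding cap_iff
    using y(1) order_trans[OF dist_le_arccos(1)[OF norm_lift[OF x] norm_lift[OF y(1)]] y(2)] by (rule conjI)
qed

lemma cap_subset_dball:
  assumes x: "norm x \<le> 1"
  shows "cap x (r / 2) \<subseteq> dball x r"
proof
  fix y assume "y \<in> cap x (r / 2)"
  then have y: "norm y \<le> 1" "chord x y \<le> r / 2" unfolding cap_iff by blast+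
  have "2 * chord x y \<le> r" using y(2) by simp
  with y(1) show "y \<in> dball x r"
    unfolding dball_iff
    using order_trans[OF dist_le_arccos(2)[OF norm_lift[OF x] norm_lift[OF y(1)]]] by blast
qed

lemma dball_borel:
  fixes \<xi> :: "real^'d"
  assumes "norm \<xi> \<le> 1"
  shows "dball \<xi> r \<in> sets borel"
proof -
  have "continuous_on (cball 0 1) (\<lambda>x. arccos (lift x \<bullet> lift \<xi>))"
  proof (intro continuous_on_arccos continuous_intros continuous_lift ballI)
    fix x :: "real^'d" assume "x \<in> cball 0 1"
    then have "\<bar>lift x \<bullet> lift \<xi>\<bar> \<le> 1"
      using Cauchy_Schwarz_ineq2[of "lift x" "lift \<xi>"] norm_lift[of x] norm_lift[OF assms] by simp
    then show "- 1 \<le> lift x \<bullet> lift \<xi> \<and> lift x \<bullet> lift \<xi> \<le> 1" by auto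
  qed
  then have "closed {x \<in> cball 0 1. arccos (lift x \<bullet> lift \<xi>) \<le> r}"
    using continuous_closed_preimage[of "cball 0 1" "\<lambda>x. arccos (lift x \<bullet> lift \<xi>)" "{..r}"]
    by (simp add: vimage_def Int_def)
  then show ?thesis by (simp add: dball_def ball_dist_lift)
qed

text \<open>Open in the ambient space, so that inclusion in a cell is inclusion in its interior,
  where the cells are disjoint.\<close>

definition ocap :: "real^'d \<Rightarrow> real \<Rightarrow> (real^'d) set" where
  "ocap x r = {y. norm y < 1 \<and> chord x y < r}"

lemma open_ocap: "open (ocap x r)"
  unfolding ocap_def by (intro open_Collect_conj open_Collect_less continuous_intros continuous_lift)

lemma ocap_subset_cap: "ocap x r \<subseteq> cap x r" by (auto simp: ocap_def cap_def)

text \<open>The centre may lie on the unit sphere and then does not belong to the set; a witness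
  comes from the density of the open ball.\<close>

lemma ocap_nonempty:
  fixes x :: "real^'d"
  assumes "norm x \<le> 1" "0 < r"
  shows "ocap x r \<noteq> {}"
proof -
  have "open {y. chord x y < r}"
    by (intro open_Collect_less continuous_intros continuous_lift)
  moreover have "x \<in> closure (ball 0 1)" using assms by simp
  ultimately have "{y. chord x y < r} \<inter> ball 0 1 \<noteq> {}"
    using open_Int_closure_eq_empty[of "{y. chord x y < r}" "ball 0 1"] assms by force
  then show ?thesis by (auto simp: ocap_def)
qed

lemma measure_ocap_ge:
  assumes mu: "\<mu> \<ge> 0" and r: "r > 0"
  shows "mass \<mu> (cap x (r / 2)) \<le> mass \<mu> (ocap (x :: real^'d) r)"
proof -
  interpret finite_measure "nu \<mu> :: (real^'d) measure" by (rule finite_measure_nu[OF mu])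
  show ?thesis
  proof (rule finite_measure_mono_AE)
    show "AE y in nu \<mu>. y \<in> cap x (r / 2) \<longrightarrow> y \<in> ocap x r"
      using AE_nu_ball[of \<mu>] by eventually_elim (use r in \<open>auto simp: cap_def ocap_def\<close>)
  qed (simp add: open_ocap borel_open)
qed

text \<open>Shrinking \<open>x\<close> radially by \<open>t = 1 - r^2/32\<close> moves it by at most
  \<open>r/32\<close>. Squared heights change by at most \<open>r^2/16\<close>, hence heights by at
  most \<open>r/4\<close>, while \<open>1 - t^2 \<ge> r^2/32\<close> lifts the new point to height
  at least \<open>r/6\<close>.\<close>

lemma high_point:
  fixes x :: "real^'d"
  assumes x: "norm x \<le> 1" and r: "0 < r" "r \<le> 1"
  obtains y where "y \<in> cap x (r / 2)" "r / 6 \<le> rho y"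
proof -
  define t where "t = 1 - r\<^sup>2 / 32"
  have rr: "r\<^sup>2 \<le> r" using r by (simp add: power2_eq_square mult_left_le)
  have t: "0 < t" "t \<le> 1" "1 - t \<le> r / 32" using r rr by (auto simp: t_def)
  define y where "y = t *\<^sub>R x"
  have ny: "norm y \<le> t" using t x by (simp add: y_def mult_left_le)
  have ny1: "norm y \<le> 1" using ny t by simp
  have "(norm y)\<^sup>2 \<le> t\<^sup>2" using ny by (intro power_mono) auto
  also have "\<dots> \<le> t" using t by (simp add: power2_eq_square mult_left_le)
  finally have "r\<^sup>2 / 32 \<le> (rho y)\<^sup>2" by (simp add: rho_sq[OF ny1] t_def)
  moreover have "(r / 6)\<^sup>2 \<le> r\<^sup>2 / 32" by (simp add: power_divide field_simps)
  ultimately have "(r / 6)\<^sup>2 \<le> (rho y)\<^sup>2" by linarith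
  then have ry: "r / 6 \<le> rho y" using rho_bounds(1)[OF ny1] by (rule power2_le_imp_le)
  have nyx: "norm y = t * norm x" using t by (simp add: y_def)
  have le: "(norm x)\<^sup>2 - (norm y)\<^sup>2 \<le> r\<^sup>2 / 16" "0 \<le> (norm x)\<^sup>2 - (norm y)\<^sup>2"
  proof -
    have eq: "(norm x)\<^sup>2 - (norm y)\<^sup>2 = (norm x)\<^sup>2 * ((1 - t) * (1 + t))"
      by (simp add: nyx power2_eq_square algebra_simps)
    have "(norm x)\<^sup>2 * ((1 - t) * (1 + t)) \<le> 1 * ((1 - t) * 2)"
      using x t by (intro mult_mono) (auto simp: abs_square_le_1)
    then show "(norm x)\<^sup>2 - (norm y)\<^sup>2 \<le> r\<^sup>2 / 16" unfolding eq by (simp add: t_def)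
    show "0 \<le> (norm x)\<^sup>2 - (norm y)\<^sup>2" unfolding eq using t by simp
  qed
  have "\<bar>rho x - rho y\<bar> \<le> r / 4"
  proof -
    have "(rho x)\<^sup>2 \<le> (rho y)\<^sup>2" using le by (simp add: rho_sq x ny1)
    then have 1: "rho x \<le> rho y" using rho_bounds(1)[OF ny1] by (rule power2_le_imp_le)
    have "(rho y)\<^sup>2 \<le> (rho x)\<^sup>2 + (r / 4)\<^sup>2" using le by (simp add: rho_sq x ny1 power_divide)
    also have "\<dots> \<le> (rho x + r / 4)\<^sup>2" using rho_bounds[OF x] r by (simp add: power2_sum)
    finally have "rho y \<le> rho x + r / 4" by (rule power2_le_imp_le) (use rho_bounds[OF x] r in simp)
    then show ?thesis using 1 by simp
  qed
  moreover have "dist x y \<le> r / 32"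
  proof -
    have "x - y = (1 - t) *\<^sub>R x" by (simp add: y_def algebra_simps)
    then have "dist x y = (1 - t) * norm x" using t by (simp add: dist_norm)
    also have "\<dots> \<le> (1 - t) * 1" using t x by (intro mult_left_mono) auto
    finally show ?thesis using t by simp
  qed
  ultimately have "chord x y \<le> r / 2" using dist_lift_le[of x y] r by linarith
  then show thesis using that[of y] ry ny1 by (simp add: cap_def)
qed

section \<open>Heights in spherical simplices\<close>

lemma convex_orthant_face: "convex (orthant_face s)"
proof (rule convexI)
  fix x y and a b :: real
  assume xy: "x \<in> orthant_face s" "y \<in> orthant_face s" and ab: "0 \<le> a" "0 \<le> b" "a + b = 1"
  have "(\<Sum>i\<in>UNIV. s $ i * fst (a *\<^sub>R x + b *\<^sub>R y) $ i) + snd (a *\<^sub>R x + b *\<^sub>R y)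
      = a * ((\<Sum>i\<in>UNIV. s $ i * fst x $ i) + snd x) + b * ((\<Sum>i\<in>UNIV. s $ i * fst y $ i) + snd y)"
    by (simp add: algebra_simps sum.distrib sum_distrib_left)
  also have "\<dots> = 1" using xy ab by (simp add: orthant_face_def)
  finally have 1: "(\<Sum>i\<in>UNIV. s $ i * fst (a *\<^sub>R x + b *\<^sub>R y) $ i) + snd (a *\<^sub>R x + b *\<^sub>R y) = 1" .
  have 2: "0 \<le> s $ i * fst (a *\<^sub>R x + b *\<^sub>R y) $ i" for i
  proof -
    have "s $ i * fst (a *\<^sub>R x + b *\<^sub>R y) $ i = a * (s $ i * fst x $ i) + b * (s $ i * fst y $ i)"
      by (simp add: algebra_simps)
    moreover have "0 \<le> s $ i * fst x $ i" "0 \<le> s $ i * fst y $ i" using xy by (auto simp: orthant_face_def)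
    ultimately have "s $ i * fst (a *\<^sub>R x + b *\<^sub>R y) $ i \<ge> 0"
      using mult_nonneg_nonneg[OF ab(1)] mult_nonneg_nonneg[OF ab(2)] by (simp only: add_nonneg_nonneg)
    then show ?thesis .
  qed
  have 3: "0 \<le> snd (a *\<^sub>R x + b *\<^sub>R y)" using xy ab by (simp add: orthant_face_def)
  show "a *\<^sub>R x + b *\<^sub>R y \<in> orthant_face s" unfolding orthant_face_def using 1 2 3 by blast
qed

text \<open>The face is the part of the unit \<open>l1\<close> sphere in one orthant, so this
  compares \<open>l1\<close> and Euclidean norms. It bounds the distortion caused by radial
  projection of a simplex.\<close>

lemma orthant_face_norm:
  fixes z :: "(real^'d) \<times> real"
  assumes s: "\<And>i. s $ i = 1 \<or> s $ i = -1" and z: "z \<in> orthant_face s"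
  shows "norm z \<le> 1" "1 \<le> (real CARD('d) + 1) * norm z"
proof -
  have si: "s $ i * fst z $ i = \<bar>fst z $ i\<bar>" for i
  proof -
    have "0 \<le> s $ i * fst z $ i" using z by (simp add: orthant_face_def)
    then show ?thesis using s[of i] by (auto simp: abs_if)
  qed
  have l1: "(\<Sum>i\<in>UNIV. \<bar>fst z $ i\<bar>) + \<bar>snd z\<bar> = 1"
    using z by (simp add: orthant_face_def si)
  have "norm z \<le> norm (fst z) + norm (snd z)"
    using sqrt_sum_squares_le_sum_abs[of "norm (fst z)" "norm (snd z)"] by (simp add: norm_prod_def)
  also have "\<dots> \<le> (\<Sum>i\<in>UNIV. \<bar>fst z $ i\<bar>) + \<bar>snd z\<bar>" using norm_le_l1_cart[of "fst z"] by simp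
  finally show "norm z \<le> 1" using l1 by simp
  have fz: "norm (fst z) \<le> norm z" "norm (snd z) \<le> norm z"
    using norm_fst_le[of "fst z" "snd z"] norm_snd_le[of "snd z" "fst z"] by simp_all
  have "(\<Sum>i\<in>UNIV. \<bar>fst z $ i\<bar>) \<le> (\<Sum>i\<in>(UNIV :: 'd set). norm z)"
    using component_le_norm_cart[of "fst z"] fz(1) by (intro sum_mono) (meson order_trans)
  then show "1 \<le> (real CARD('d) + 1) * norm z" using l1 fz(2) by (simp add: algebra_simps)
qed

lemma simplex_vertices_hull:
  fixes V :: "((real^'d) \<times> real) set"
  assumes "simplex_vertices V"
  shows "finite V" "card V = CARD('d) + 1"
    and "\<And>z. z \<in> convex hull V \<Longrightarrow> 0 \<le> snd z \<and> norm z \<le> 1 \<and> 1 \<le> (real CARD('d) + 1) * norm z"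
    and "(1 / (real CARD('d) + 1)) *\<^sub>R (\<Sum>v\<in>V. v) \<in> convex hull V"
    and "\<And>z. z \<in> convex hull V \<Longrightarrow> snd z \<le> (\<Sum>v\<in>V. snd v)"
proof -
  obtain s where s: "\<And>i. s $ i = 1 \<or> s $ i = -1" "V \<subseteq> orthant_face s" and card: "card V = CARD('d) + 1"
    using assms by (auto simp: simplex_vertices_def)
  show fin: "finite V" using card by (intro card_ge_0_finite) simp
  show "card V = CARD('d) + 1" by (rule card)
  have hull: "convex hull V \<subseteq> orthant_face s" using s(2) convex_orthant_face by (rule hull_minimal)
  show "0 \<le> snd z \<and> norm z \<le> 1 \<and> 1 \<le> (real CARD('d) + 1) * norm z" if "z \<in> convex hull V" for z
    using that hull orthant_face_norm[of s z, OF s(1)] by (auto simp: orthant_face_def)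
  have "(1 / (real CARD('d) + 1)) *\<^sub>R (\<Sum>v\<in>V. v) = (\<Sum>v\<in>V. (1 / (real CARD('d) + 1)) *\<^sub>R v)"
    by (simp add: scaleR_sum_right)
  moreover have "(\<Sum>v\<in>V. 1 / (real CARD('d) + 1)) = 1" using card by (simp add: add_nonneg_eq_0_iff)
  ultimately show "(1 / (real CARD('d) + 1)) *\<^sub>R (\<Sum>v\<in>V. v) \<in> convex hull V"
    unfolding convex_hull_finite[OF fin]
    by (intro CollectI exI[of _ "\<lambda>_. 1 / (real CARD('d) + 1)"] conjI ballI) (simp_all only:, simp)
  show "snd z \<le> (\<Sum>v\<in>V. snd v)" if z: "z \<in> convex hull V" for z
  proof -
    obtain w where w: "\<forall>v\<in>V. 0 \<le> w v" "sum w V = 1" "(\<Sum>v\<in>V. w v *\<^sub>R v) = z"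
      using z unfolding convex_hull_finite[OF fin] by blast
    have "snd z = (\<Sum>v\<in>V. w v * snd v)" unfolding w(3)[symmetric] by (simp add: snd_sum)
    also have "\<dots> \<le> (\<Sum>v\<in>V. 1 * snd v)"
    proof (rule sum_mono)
      fix v assume v: "v \<in> V"
      have "w v \<le> 1" using member_le_sum[of v V w] w fin v by auto
      moreover have "0 \<le> snd v" using s(2) v by (auto simp: orthant_face_def)
      ultimately show "w v * snd v \<le> 1 * snd v" by (rule mult_right_mono)
    qed
    finally show ?thesis by simp
  qed
qed

lemma closed_spherical_simplex:
  assumes "simplex_vertices V"
  shows "closed (fst ` spherical_simplex V)"
proof -
  have "z \<noteq> 0" if "z \<in> convex hull V" for z using simplex_vertices_hull(3)[OF assms that] by auto
  then have "continuous_on (convex hull V) (\<lambda>z. fst (z /\<^sub>R norm z))"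
    by (intro continuous_intros) auto
  moreover have "compact (convex hull V)"
    using simplex_vertices_hull(1)[OF assms] by (rule finite_imp_compact_convex_hull)
  ultimately have "compact ((\<lambda>z. fst (z /\<^sub>R norm z)) ` (convex hull V))" by (rule compact_continuous_image)
  then show ?thesis by (simp add: spherical_simplex_def image_image compact_imp_closed)
qed

lemma rho_fst_unit: "norm z = 1 \<Longrightarrow> 0 \<le> snd z \<Longrightarrow> norm (fst z) \<le> 1 \<and> rho (fst z) = snd z"
proof -
  assume z: "norm z = 1" "0 \<le> snd z"
  have "(norm (fst z))\<^sup>2 + (snd z)\<^sup>2 = 1"
    using z(1) by (simp add: norm_prod_def)
  then have 1: "1 - (norm (fst z))\<^sup>2 = (snd z)\<^sup>2" by simp
  then have "(norm (fst z))\<^sup>2 \<le> 1\<^sup>2" using zero_le_power2[of "snd z"] by (simp only: one_power2)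
  then have "norm (fst z) \<le> 1" by (rule power2_le_imp_le) simp
  moreover have "rho (fst z) = snd z" unfolding rho_def 1 using z(2) by simp
  ultimately show ?thesis ..
qed

text \<open>Heights are nonnegative and convex weights are at most 1, so no point of the hull is
  higher than the sum of the vertex heights, which is \<open>d + 1\<close> times the height of the
  barycentre. Normalizing to the sphere costs a second factor \<open>d + 1\<close>.\<close>

lemma simplex_center_bounds:
  fixes V :: "((real^'d) \<times> real) set"
  assumes V: "simplex_vertices V"
  shows "norm (fst (simplex_center V)) \<le> 1"
    and "\<And>y. y \<in> fst ` spherical_simplex V \<Longrightarrow> rho y \<le> (real CARD('d) + 1)\<^sup>2 * rho (fst (simplex_center V))"
proof -
  define d1 where "d1 = real CARD('d) + 1"
  have d1: "d1 > 0" by (simp add: d1_def add_nonneg_pos)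
  note hull = simplex_vertices_hull[OF V, folded d1_def]
  define w where "w = (1 / d1) *\<^sub>R (\<Sum>v\<in>V. v)"
  have w: "0 \<le> snd w" "norm w \<le> 1" "1 \<le> d1 * norm w" using hull(3)[OF hull(4)] by (simp_all add: w_def)
  then have wpos: "norm w > 0" by (cases "norm w = 0") auto
  have c: "simplex_center V = w /\<^sub>R norm w" by (simp add: simplex_center_def w_def d1_def Let_def add.commute)
  have cc: "norm (w /\<^sub>R norm w) = 1" "0 \<le> snd (w /\<^sub>R norm w)" using w wpos by auto
  then show "norm (fst (simplex_center V)) \<le> 1" using rho_fst_unit[OF cc] by (simp add: c)
  have rc: "rho (fst (simplex_center V)) = snd w / norm w"
    using rho_fst_unit[OF cc] by (simp add: c divide_inverse mult.commute)
  have "snd w * norm w \<le> snd w" using w by (simp add: mult_left_le)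
  then have "snd w \<le> rho (fst (simplex_center V))" unfolding rc using wpos by (simp add: le_divide_eq)
  moreover have "snd w = (\<Sum>v\<in>V. snd v) / d1" by (simp add: w_def snd_sum)
  ultimately have sum: "(\<Sum>v\<in>V. snd v) \<le> d1 * rho (fst (simplex_center V))" using d1 by (simp add: divide_le_eq mult.commute)
  fix y assume "y \<in> fst ` spherical_simplex V"
  then obtain z where z: "z \<in> convex hull V" "y = fst (z /\<^sub>R norm z)" by (auto simp: spherical_simplex_def)
  have zz: "0 \<le> snd z" "1 \<le> d1 * norm z" using hull(3)[OF z(1)] by auto
  then have zpos: "norm z > 0" by (cases "norm z = 0") auto
  have "rho y = snd z / norm z"
    using rho_fst_unit[of "z /\<^sub>R norm z"] zz(1) zpos by (simp add: z(2) divide_inverse mult.commute)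
  also have "\<dots> \<le> d1 * snd z"
    using mult_right_mono[OF zz(2,1)] zpos by (simp add: divide_le_eq mult_ac)
  also have "\<dots> \<le> d1 * (d1 * rho (fst (simplex_center V)))"
    using hull(5)[OF z(1)] sum d1 by (intro mult_left_mono) auto
  finally show "rho y \<le> (real CARD('d) + 1)\<^sup>2 * rho (fst (simplex_center V))"
    by (simp add: d1_def power2_eq_square mult.assoc)
qed

text \<open>Every \<open>D\<close> stays whole in its own cell; any other point goes to the first
  cell of an enumeration that contains it. Keeping \<open>D\<close> whole is what bounds the masses
  of the cells from below.\<close>

lemma disjoint_cells:
  fixes R D :: "'a \<Rightarrow> 'b set"
  assumes X: "finite X" and D: "disjoint_family_on D X" and DR: "\<And>\<xi>. \<xi> \<in> X \<Longrightarrow> D \<xi> \<subseteq> R \<xi>"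
    and sets: "\<And>\<xi>. \<xi> \<in> X \<Longrightarrow> D \<xi> \<in> sets M" "\<And>\<xi>. \<xi> \<in> X \<Longrightarrow> R \<xi> \<in> sets M"
  obtains A where "disjoint_family_on A X" "(\<Union>\<xi>\<in>X. A \<xi>) = (\<Union>\<xi>\<in>X. R \<xi>)"
    "\<And>\<xi>. \<xi> \<in> X \<Longrightarrow> D \<xi> \<subseteq> A \<xi> \<and> A \<xi> \<subseteq> R \<xi>" "\<And>\<xi>. \<xi> \<in> X \<Longrightarrow> A \<xi> \<in> sets M"
proof -
  obtain idx :: "'a \<Rightarrow> nat" where idx: "inj_on idx X" using finite_imp_inj_to_nat_seg[OF X] by blast
  define A where "A = (\<lambda>\<xi>. D \<xi> \<union> (R \<xi> - (\<Union>\<eta>\<in>X. D \<eta>) - (\<Union>\<eta>\<in>{\<eta>\<in>X. idx \<eta> < idx \<xi>}. R \<eta>)))"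
  have sub: "D \<xi> \<subseteq> A \<xi> \<and> A \<xi> \<subseteq> R \<xi>" if "\<xi> \<in> X" for \<xi> using DR[OF that] by (auto simp: A_def)
  have disj: "disjoint_family_on A X"
    unfolding disjoint_family_on_def
  proof (intro ballI impI)
    fix \<xi> \<eta> assume xe: "\<xi> \<in> X" "\<eta> \<in> X" "\<xi> \<noteq> \<eta>"
    then have "D \<xi> \<inter> D \<eta> = {}" using D by (auto simp: disjoint_family_on_def)
    moreover have "idx \<xi> < idx \<eta> \<or> idx \<eta> < idx \<xi>" using idx xe by (metis inj_on_def linorder_neqE_nat)
    ultimately show "A \<xi> \<inter> A \<eta> = {}" using xe unfolding A_def by auto
  qed
  have union: "(\<Union>\<xi>\<in>X. A \<xi>) = (\<Union>\<xi>\<in>X. R \<xi>)"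
  proof
    show "(\<Union>\<xi>\<in>X. A \<xi>) \<subseteq> (\<Union>\<xi>\<in>X. R \<xi>)" using sub by blast
    show "(\<Union>\<xi>\<in>X. R \<xi>) \<subseteq> (\<Union>\<xi>\<in>X. A \<xi>)"
    proof
      fix x assume x: "x \<in> (\<Union>\<xi>\<in>X. R \<xi>)"
      show "x \<in> (\<Union>\<xi>\<in>X. A \<xi>)"
      proof (cases "x \<in> (\<Union>\<xi>\<in>X. D \<xi>)")
        case True
        then show ?thesis by (auto simp: A_def)
      next
        case False
        obtain \<xi> where \<xi>: "\<xi> \<in> X \<and> x \<in> R \<xi>" "\<And>\<eta>. \<eta> \<in> X \<and> x \<in> R \<eta> \<Longrightarrow> idx \<xi> \<le> idx \<eta>"
          using x ex_has_least_nat[of "\<lambda>\<xi>. \<xi> \<in> X \<and> x \<in> R \<xi>" _ idx] by blast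
        then have "x \<in> A \<xi>" using False unfolding A_def by (auto simp: not_less[symmetric])
        then show ?thesis using \<xi> by blast
      qed
    qed
  qed
  have meas: "A \<xi> \<in> sets M" if "\<xi> \<in> X" for \<xi>
    unfolding A_def using that X by (intro sets.Un sets.Diff sets.finite_UN sets) auto
  show thesis by (rule that[OF disj union sub meas])
qed

lemma associated_partitionD:
  assumes "associated_partition cs css \<epsilon> X RR"
  shows "\<And>R. R \<in> RR \<Longrightarrow> \<exists>V. simplex_vertices V \<and> R = fst ` spherical_simplex V"
    and "\<And>\<xi>. \<xi> \<in> X \<Longrightarrow> \<exists>V. simplex_vertices V \<and> \<xi> = fst (simplex_center V) \<and> fst ` spherical_simplex V \<in> RR"
    and "\<Union>RR = cball 0 1" "pairwise (\<lambda>R S. interior R \<inter> interior S = {}) RR"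
    and "\<And>R. R \<in> RR \<Longrightarrow> \<exists>\<xi>. \<xi> \<in> X \<and> dball \<xi> (cs * \<epsilon>) \<subseteq> R \<and> R \<subseteq> dball \<xi> \<epsilon>"
    and "finite RR" "finite X" "card X = card RR"
proof -
  note part = assms[unfolded associated_partition_def]
  show "\<And>R. R \<in> RR \<Longrightarrow> \<exists>V. simplex_vertices V \<and> R = fst ` spherical_simplex V"
    by (rule bspec[OF part[THEN conjunct1]])
  show "\<And>\<xi>. \<xi> \<in> X \<Longrightarrow> \<exists>V. simplex_vertices V \<and> \<xi> = fst (simplex_center V) \<and> fst ` spherical_simplex V \<in> RR"
    unfolding part[THEN conjunct2, THEN conjunct1] by blast
  note part2 = part[THEN conjunct2, THEN conjunct2]
  show "\<Union>RR = cball 0 1" using part2 by (elim conjE)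
  show "pairwise (\<lambda>R S. interior R \<inter> interior S = {}) RR" using part2 by (elim conjE)
  show "finite RR" "finite X" "card X = card RR" using part2 by - (elim conjE, assumption)+
  have unique: "\<forall>R\<in>RR. \<exists>!\<xi>. \<xi> \<in> X \<and> dball \<xi> (cs * \<epsilon>) \<subseteq> R \<and> R \<subseteq> dball \<xi> \<epsilon>"
    using part2 by (elim conjE)
  fix R assume "R \<in> RR"
  from bspec[OF unique this] show "\<exists>\<xi>. \<xi> \<in> X \<and> dball \<xi> (cs * \<epsilon>) \<subseteq> R \<and> R \<subseteq> dball \<xi> \<epsilon>"
    by (rule ex1_implies_ex)
qed

lemma simplex_center_norm_le:
  assumes "associated_partition cs css \<epsilon> X RR" "\<xi> \<in> X"
  shows "norm \<xi> \<le> 1"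
  using associated_partitionD(2)[OF assms] simplex_center_bounds(1) by blast

text \<open>The point \<open>\<xi>\<close> is the centre of a simplex \<open>R\<close> containing a cap (around a possibly different point of \<open>X\<close>), hence a
  point of height of order \<open>cs * \<epsilon>\<close>; heights in \<open>R\<close> are at most a constant times the height of its centre.\<close>

lemma center_height:
  fixes X :: "(real^'d) set"
  assumes part: "associated_partition cs css \<epsilon> X RR" and e: "0 < cs * \<epsilon>" "cs * \<epsilon> \<le> 1" and xi: "\<xi> \<in> X"
  shows "cs * \<epsilon> / (6 * (real CARD('d) + 1)\<^sup>2) \<le> rho \<xi>"
proof -
  obtain V where V: "simplex_vertices V" "\<xi> = fst (simplex_center V)" "fst ` spherical_simplex V \<in> RR"
    using associated_partitionD(2)[OF part xi] by blast
  obtain \<eta> where \<eta>: "\<eta> \<in> X" "dball \<eta> (cs * \<epsilon>) \<subseteq> fst ` spherical_simplex V"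
    using associated_partitionD(5)[OF part V(3)] by blast
  have n\<eta>: "norm \<eta> \<le> 1" by (rule simplex_center_norm_le[OF part \<eta>(1)])
  obtain y where y: "y \<in> cap \<eta> (cs * \<epsilon> / 2)" "cs * \<epsilon> / 6 \<le> rho y"
    using high_point[OF n\<eta> e] by blast
  then have "y \<in> fst ` spherical_simplex V" using cap_subset_dball[OF n\<eta>] \<eta>(2) by blast
  from simplex_center_bounds(2)[OF V(1) this] y(2)
  have "cs * \<epsilon> / 6 \<le> rho \<xi> * (real CARD('d) + 1)\<^sup>2" by (simp add: V(2) mult.commute)
  moreover have "(real CARD('d) + 1)\<^sup>2 > 0" by (simp add: add_nonneg_eq_0_iff)
  ultimately have "cs * \<epsilon> / 6 / (real CARD('d) + 1)\<^sup>2 \<le> rho \<xi>" by (simp only: pos_divide_le_eq)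
  then show ?thesis by simp
qed

text \<open>The point attached to a cell by the inclusion condition is not assumed to be the centre
  of that cell. The assignment is still a bijection onto \<open>X\<close>: two cells with the same
  point would share a nonempty open set, and the cardinalities agree.\<close>

lemma partition_cells:
  fixes X :: "(real^'d) set"
  assumes part: "associated_partition cs css \<epsilon> X RR" and e: "0 < cs * \<epsilon>"
  obtains A where "subordinate \<epsilon> X A" "(\<Union>\<xi>\<in>X. A \<xi>) = cball 0 1" "\<And>\<xi>. \<xi> \<in> X \<Longrightarrow> ocap \<xi> (cs * \<epsilon> / 2) \<subseteq> A \<xi>"
proof -
  define D where "D = (\<lambda>\<xi> :: real^'d. ocap \<xi> (cs * \<epsilon> / 2))"
  note fin = associated_partitionD(6-8)[OF part]
  note U = associated_partitionD(3)[OF part] and pw = associated_partitionD(4)[OF part]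
  have nX: "norm \<xi> \<le> 1" if "\<xi> \<in> X" for \<xi> by (rule simplex_center_norm_le[OF part that])
  obtain g where g: "\<And>R. R \<in> RR \<Longrightarrow> g R \<in> X \<and> dball (g R) (cs * \<epsilon>) \<subseteq> R \<and> R \<subseteq> dball (g R) \<epsilon>"
    using bchoice[of RR "\<lambda>R \<xi>. \<xi> \<in> X \<and> dball \<xi> (cs * \<epsilon>) \<subseteq> R \<and> R \<subseteq> dball \<xi> \<epsilon>"]
      associated_partitionD(5)[OF part] by blast
  have Dint: "D (g R) \<subseteq> interior R" if R: "R \<in> RR" for R
  proof (rule interior_maximal)
    show "D (g R) \<subseteq> R"
      using ocap_subset_cap[of "g R" "cs * \<epsilon> / 2"] cap_subset_dball[OF nX, of "g R" "cs * \<epsilon>"] g[OF R]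
      unfolding D_def by blast
    show "open (D (g R))" by (simp add: D_def open_ocap)
  qed
  have Dne: "D \<xi> \<noteq> {}" if "\<xi> \<in> X" for \<xi> unfolding D_def using ocap_nonempty[OF nX[OF that]] e by simp
  have inj: "inj_on g RR"
  proof (rule inj_onI)
    fix R S assume RS: "R \<in> RR" "S \<in> RR" "g R = g S"
    then have "D (g R) \<subseteq> interior R \<inter> interior S" using Dint[OF RS(1)] Dint[OF RS(2)] by simp
    then have "interior R \<inter> interior S \<noteq> {}" using Dne[of "g R"] g[OF RS(1)] by blast
    then show "R = S" using pairwiseD[OF pw RS(1,2)] by metis
  qed
  have img: "g ` RR = X"
  proof (rule card_subset_eq)
    show "g ` RR \<subseteq> X" using g by blast
  qed (simp_all add: card_image[OF inj] fin)
  define R where "R = inv_into RR g"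
  have R: "R \<xi> \<in> RR" "g (R \<xi>) = \<xi>" if "\<xi> \<in> X" for \<xi>
    using that inv_into_into[of \<xi> g RR] f_inv_into_f[of \<xi> g RR] unfolding R_def img by blast+
  have RX: "R ` X = RR" unfolding R_def img[symmetric] by (rule inv_into_image_cancel[OF inj order_refl])
  have disj: "disjoint_family_on D X"
    unfolding disjoint_family_on_def
  proof (intro ballI impI)
    fix \<xi> \<eta> assume xe: "\<xi> \<in> X" "\<eta> \<in> X" "\<xi> \<noteq> \<eta>"
    then have "R \<xi> \<noteq> R \<eta>" using R by metis
    then have "interior (R \<xi>) \<inter> interior (R \<eta>) = {}" using pairwiseD[OF pw R(1)[OF xe(1)] R(1)[OF xe(2)]] by simp
    then show "D \<xi> \<inter> D \<eta> = {}" using Dint[OF R(1)[OF xe(1)]] Dint[OF R(1)[OF xe(2)]] R(2)[OF xe(1)] R(2)[OF xe(2)] by auto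
  qed
  have DR: "D \<xi> \<subseteq> R \<xi>" if "\<xi> \<in> X" for \<xi>
    using Dint[OF R(1)[OF that]] R(2)[OF that] interior_subset[of "R \<xi>"] by simp
  have Rb: "R \<xi> \<in> sets borel" if xi: "\<xi> \<in> X" for \<xi>
  proof -
    obtain V where "simplex_vertices V" "R \<xi> = fst ` spherical_simplex V" using associated_partitionD(1)[OF part R(1)[OF xi]] by blast
    then show ?thesis using closed_spherical_simplex by (metis borel_closed)
  qed
  have Db: "D \<xi> \<in> sets borel" for \<xi> by (simp add: D_def open_ocap borel_open)
  obtain A where A: "disjoint_family_on A X" "(\<Union>\<xi>\<in>X. A \<xi>) = (\<Union>\<xi>\<in>X. R \<xi>)"
    "\<And>\<xi>. \<xi> \<in> X \<Longrightarrow> D \<xi> \<subseteq> A \<xi> \<and> A \<xi> \<subseteq> R \<xi>" "\<And>\<xi>. \<xi> \<in> X \<Longrightarrow> A \<xi> \<in> sets borel"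
    using disjoint_cells[OF fin(2) disj DR Db Rb] by blast
  have "A \<xi> \<subseteq> cap \<xi> \<epsilon>" if "\<xi> \<in> X" for \<xi>
  proof -
    have "A \<xi> \<subseteq> R \<xi>" using A(3)[OF that] by blast
    also have "R \<xi> \<subseteq> dball \<xi> \<epsilon>" using g[OF R(1)[OF that]] R(2)[OF that] by simp
    also have "\<dots> \<subseteq> cap \<xi> \<epsilon>" by (rule dball_subset_cap[OF nX[OF that]])
    finally show ?thesis .
  qed
  then have "subordinate \<epsilon> X A"
    using fin(2) A(1,4) nX by (auto simp: subordinate_def)
  moreover have "(\<Union>\<xi>\<in>X. A \<xi>) = cball 0 1" unfolding A(2) RX U ..
  ultimately show thesis using that[of A] A(3) by (simp add: D_def)
qed

section \<open>The cubature formula\<close>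

lemma set_integral_W:
  fixes f :: "real^'d \<Rightarrow> real"
  assumes f: "f \<in> borel_measurable borel" and E: "E \<in> sets borel" "E \<subseteq> cball 0 1"
  shows "(LINT x:E|lborel. f x * W \<mu> x) = (LINT x|nu \<mu>. indicator E x * f x)"
proof -
  have m: "(\<lambda>x :: real^'d. indicator (cball 0 1) x * W \<mu> x) \<in> borel_measurable lborel"
    unfolding measurable_lborel1 by (intro borel_measurable_times borel_measurable_indicator W_measurable) auto
  have "(LINT x|nu \<mu>. indicator E x * f x) = (LINT x|lborel. (indicator (cball 0 1) x * W \<mu> x) *\<^sub>R (indicator E x * f x))"
    unfolding nu_def
    by (rule integral_density) (use f E m in \<open>auto simp: W_nonneg\<close>)
  also have "\<dots> = (LINT x|lborel. indicator E x *\<^sub>R (f x * W \<mu> x))"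
    using E by (intro Bochner_Integration.integral_cong) (auto simp: indicator_def)
  finally show ?thesis by (simp add: set_lebesgue_integral_def)
qed

lemma m_weight_eq:
  assumes "E \<in> sets borel" "E \<subseteq> cball 0 1"
  shows "m_weight \<mu> E = mass \<mu> E"
  using set_integral_W[of "\<lambda>_. 1" E \<mu>] assms by (simp add: m_weight_def)

lemma integral_cball_W:
  fixes f :: "real^'d \<Rightarrow> real"
  assumes "f \<in> borel_measurable borel"
  shows "(LINT x:cball 0 1|lborel. f x * W \<mu> x) = (LINT x|nu \<mu>. f x)"
proof -
  have "(LINT x:cball 0 1|lborel. f x * W \<mu> x) = (LINT x|nu \<mu>. indicator (cball 0 1) x * f x)"
    by (rule set_integral_W[OF assms]) auto
  also have "\<dots> = (LINT x|nu \<mu>. f x)"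
  proof (rule integral_cong_AE)
    show "(\<lambda>x. indicator (cball 0 1) x * f x) \<in> borel_measurable (nu \<mu>)"
      using assms by (intro borel_measurable_times borel_measurable_indicator) simp_all
    show "AE x in nu \<mu>. indicator (cball 0 1) x * f x = f x"
      using AE_nu_cball[of \<mu>] by eventually_elim simp
  qed (use assms in simp)
  finally show ?thesis .
qed

text \<open>Lets all quantities of the theorem be compared with a single scale \<open>P\<close> and
  not pairwise.\<close>

lemma equiv_with_common_scale:
  assumes ab: "0 < \<alpha>" "0 < \<beta>" and x: "\<alpha> * P \<le> x" "x \<le> \<beta> * P" and y: "\<alpha> * P \<le> y" "y \<le> \<beta> * P"
  shows "equiv_with (\<alpha> / \<beta>) (\<beta> / \<alpha>) x y"
proof -
  have "\<alpha> * x \<le> \<beta> * (\<alpha> * P)" using mult_left_mono[OF x(2), of \<alpha>] ab by (simp add: mult.left_commute)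
  also have "\<dots> \<le> \<beta> * y" using mult_left_mono[OF y(1), of \<beta>] ab by simp
  finally have 1: "\<alpha> * x \<le> \<beta> * y" .
  have "\<alpha> * y \<le> \<beta> * (\<alpha> * P)" using mult_left_mono[OF y(2), of \<alpha>] ab by (simp add: mult.left_commute)
  also have "\<dots> \<le> \<beta> * x" using mult_left_mono[OF x(1), of \<beta>] ab by simp
  finally have "\<alpha> * y \<le> \<beta> * x" .
  with 1 show ?thesis using ab by (simp add: equiv_with_def field_simps)
qed

text \<open>Where the height is at least \<open>h0 * \<epsilon>\<close>, adding a multiple of
  \<open>\<epsilon>\<close> changes it by a bounded factor only. This is how the terms
  \<open>+ r\<close> and \<open>+ 1/n\<close> disappear at the centres.\<close>

lemma cap_scale:
  fixes \<rho> \<epsilon> \<theta> h0 \<mu> :: real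
  assumes mu: "\<mu> \<ge> 0" and e: "\<epsilon> > 0" and t: "\<theta> > 0" and h0: "h0 > 0" "h0 * \<epsilon> \<le> \<rho>"
  shows "\<rho> powr (2 * \<mu>) \<le> (\<rho> + \<theta> * \<epsilon>) powr (2 * \<mu>)"
    and "(\<rho> + \<theta> * \<epsilon>) powr (2 * \<mu>) \<le> (1 + \<theta> / h0) powr (2 * \<mu>) * \<rho> powr (2 * \<mu>)"
proof -
  have rho: "\<rho> > 0" using h0 e mult_pos_pos[of h0 \<epsilon>] by linarith
  show "\<rho> powr (2 * \<mu>) \<le> (\<rho> + \<theta> * \<epsilon>) powr (2 * \<mu>)"
    using rho e t mu by (intro powr_mono2) auto
  have "\<theta> / h0 * (h0 * \<epsilon>) \<le> \<theta> / h0 * \<rho>" using h0 t by (intro mult_left_mono) auto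
  then have "\<rho> + \<theta> * \<epsilon> \<le> (1 + \<theta> / h0) * \<rho>" using h0 by (simp add: distrib_right)
  then have "(\<rho> + \<theta> * \<epsilon>) powr (2 * \<mu>) \<le> ((1 + \<theta> / h0) * \<rho>) powr (2 * \<mu>)"
    using rho e t mu by (intro powr_mono2) auto
  also have "\<dots> = (1 + \<theta> / h0) powr (2 * \<mu>) * \<rho> powr (2 * \<mu>)"
    by (rule powr_mult)
  finally show "(\<rho> + \<theta> * \<epsilon>) powr (2 * \<mu>) \<le> (1 + \<theta> / h0) powr (2 * \<mu>) * \<rho> powr (2 * \<mu>)" .
qed

theorem theorem5p4:
  fixes \<mu> cs css :: real
  assumes "CARD('d::finite) > 1"
    and "\<mu> \<ge> 0"
    and "cs > 0" and "css > 0"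
    and "\<And>\<epsilon>. 0 < \<epsilon> \<Longrightarrow> \<epsilon> \<le> pi \<Longrightarrow> \<exists>X :: (real^'d) set. almost_uniform cs css \<epsilon> X"
  shows "\<exists>c > 0. c \<le> pi \<and> (\<exists>c1 > 0. \<exists>c2 > 0. \<forall>n \<ge> (1::nat). \<forall>X :: (real^'d) set.
    let \<epsilon> = c / real n in almost_uniform cs css \<epsilon> X \<longrightarrow>
      (\<exists>lam :: real^'d \<Rightarrow> real.
        (\<forall>\<xi>\<in>X. lam \<xi> > 0) \<and>
        (\<forall>f \<in> Poly_le n. (LINT x:cball 0 1|lborel. f x * W \<mu> x) = (\<Sum>\<xi>\<in>X. lam \<xi> * f \<xi>)) \<and>
        (\<forall>\<xi>\<in>X.
          equiv_with c1 c2 (lam \<xi>) ((1 / real n) ^ CARD('d) * W_n \<mu> n \<xi>) \<and>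
          equiv_with c1 c2 ((1 / real n) ^ CARD('d) * W_n \<mu> n \<xi>)
            (\<epsilon> ^ CARD('d) * (1 - (norm \<xi>)\<^sup>2) powr \<mu>) \<and>
          equiv_with c1 c2 (\<epsilon> ^ CARD('d) * (1 - (norm \<xi>)\<^sup>2) powr \<mu>)
            (m_weight \<mu> (dball \<xi> \<epsilon>)))))"
proof -
  note mu = assms(2) and cs = assms(3)
  interpret nu: finite_measure "nu \<mu> :: (real^'d) measure" by (rule finite_measure_nu[OF mu])
  obtain Cc where Cc: "Cc > 0"
    "\<And>n \<epsilon> (X :: (real^'d) set) A. n \<ge> 1 \<Longrightarrow> 0 \<le> \<epsilon> \<Longrightarrow> Cc * (real n * \<epsilon>) \<le> 1 \<Longrightarrow> subordinate \<epsilon> X A \<Longrightarrow>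
      (\<Union>\<xi>\<in>X. A \<xi>) = cball 0 1 \<Longrightarrow>
      \<exists>l. cell_weights \<mu> n X A l"
    by (rule cubature_of_partition[OF mu]) (rule that)
  obtain C0 where C0: "C0 > 0"
    "\<And>(x :: real^'d) r. norm x \<le> 1 \<Longrightarrow> 0 < r \<Longrightarrow>
      mass \<mu> (cap x r) \<le> C0 * r ^ CARD('d) * (rho x + r) powr (2 * \<mu>)"
    by (rule cap_upper[OF mu]) (rule that)
  obtain c0 r0 where c0: "c0 > 0" "r0 > 0" "r0 \<le> 1"
    "\<And>(x :: real^'d) r. norm x \<le> 1 \<Longrightarrow> 0 < r \<Longrightarrow> r \<le> r0 \<Longrightarrow>
      c0 * r ^ CARD('d) * (rho x + r) powr (2 * \<mu>) \<le> mass \<mu> (cap x r)"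
    by (rule cap_lower[OF mu]) (rule that)
  \<comment> \<open>\<open>1 / Cc\<close> allows exact positive weights, and \<open>1 / cs\<close>
    makes \<open>cs * \<epsilon> \<le> 1\<close> for the height of the centres. The last two entries
    keep the radii \<open>cs * \<epsilon> / 4\<close> and \<open>\<epsilon> / 2\<close> within reach
    of the lower cap bound. The entry 1 gives \<open>c \<le> pi\<close> and
    \<open>1/n \<ge> \<epsilon>\<close>.\<close>
  define c where "c = Min {1, 1 / Cc, 1 / cs, 4 * r0 / cs, 2 * r0}"
  have c: "c > 0" "c \<le> 1" "c \<le> 1 / Cc" "c \<le> 1 / cs" "c \<le> 4 * r0 / cs" "c \<le> 2 * r0"
    using Cc(1) cs c0(2) by (auto simp: c_def)
  define h0 where "h0 = cs / (6 * (real CARD('d) + 1)\<^sup>2)"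
  have h0: "h0 > 0" using cs by (simp add: h0_def add_nonneg_pos)
  define d where "d = CARD('d)"
  \<comment> \<open>Constants relative to the scale \<open>P\<close> below: \<open>\<alpha>1\<close>
    bounds the geodesic ball by the inner cap of radius \<open>\<epsilon>/2\<close>;
    \<open>\<alpha>2\<close> and \<open>\<beta>1\<close> bound the weights by an inner and an outer
    cap, including the factors \<open>1/2\<close> and \<open>3/2\<close>; \<open>\<beta>2\<close>
    belongs to \<open>W_n\<close>, where \<open>1/n = \<epsilon>/c\<close>.\<close>
  define \<alpha>1 where "\<alpha>1 = c0 * (1/2) ^ d"
  define \<alpha>2 where "\<alpha>2 = c0 * (cs / 4) ^ d / 2"
  define \<alpha> where "\<alpha> = min 1 (min \<alpha>1 \<alpha>2)"
  define \<beta>1 where "\<beta>1 = 3 / 2 * C0 * (1 + 1 / h0) powr (2 * \<mu>)"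
  define \<beta>2 where "\<beta>2 = (1 / c) ^ d * (1 + (1 / c) / h0) powr (2 * \<mu>)"
  define \<beta> where "\<beta> = max 1 (max \<beta>1 \<beta>2)"
  have ab: "0 < \<alpha>" "0 < \<beta>" using c0(1) cs by (auto simp: \<alpha>_def \<beta>_def \<alpha>1_def \<alpha>2_def)
  define E where "E = (\<lambda>n \<xi> l. equiv_with (\<alpha> / \<beta>) (\<beta> / \<alpha>) (l) ((1 / real n) ^ CARD('d) * W_n \<mu> n (\<xi> :: real^'d)) \<and>
          equiv_with (\<alpha> / \<beta>) (\<beta> / \<alpha>) ((1 / real n) ^ CARD('d) * W_n \<mu> n \<xi>)
            ((c / real n) ^ CARD('d) * (1 - (norm \<xi>)\<^sup>2) powr \<mu>) \<and>
          equiv_with (\<alpha> / \<beta>) (\<beta> / \<alpha>) ((c / real n) ^ CARD('d) * (1 - (norm \<xi>)\<^sup>2) powr \<mu>)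
            (m_weight \<mu> (dball \<xi> (c / real n))))"
  have main: "\<exists>lam :: real^'d \<Rightarrow> real. (\<forall>\<xi>\<in>X. lam \<xi> > 0) \<and>
        (\<forall>f \<in> Poly_le n. (LINT x:cball 0 1|lborel. f x * W \<mu> x) = (\<Sum>\<xi>\<in>X. lam \<xi> * f \<xi>)) \<and>
        (\<forall>\<xi>\<in>X. E n \<xi> (lam \<xi>))"
    if n: "n \<ge> 1" and au: "almost_uniform cs css (c / real n) X" for n and X :: "(real^'d) set"
  proof -
    define \<epsilon> where eps: "\<epsilon> = c / real n"
    obtain RR where part: "associated_partition cs css \<epsilon> X RR"
      using au unfolding almost_uniform_def eps by blast
    have npos: "real n > 0" using n by simp
    have e: "0 < \<epsilon>" "\<epsilon> \<le> c" "real n * \<epsilon> = c"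
      using npos n c(1) by (auto simp: eps divide_le_eq mult_le_cancel_left1)
    have cse: "0 < cs * \<epsilon>" "cs * \<epsilon> \<le> 1" "cs * \<epsilon> / 4 \<le> r0" "\<epsilon> / 2 \<le> r0"
    proof -
      show "0 < cs * \<epsilon>" using cs e by simp
      have "cs * \<epsilon> \<le> cs * c" using cs e by simp
      moreover have "cs * c \<le> 1" "cs * c \<le> 4 * r0" using c(4,5) cs by (simp_all add: field_simps)
      ultimately show "cs * \<epsilon> \<le> 1" "cs * \<epsilon> / 4 \<le> r0" by linarith+
      show "\<epsilon> / 2 \<le> r0" using e c(6) by simp
    qed
    obtain A where A: "subordinate \<epsilon> X A" "(\<Union>\<xi>\<in>X. A \<xi>) = cball 0 1" "\<And>\<xi>. \<xi> \<in> X \<Longrightarrow> ocap \<xi> (cs * \<epsilon> / 2) \<subseteq> A \<xi>"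
      using partition_cells[OF part cse(1)] by blast
    have "Cc * (real n * \<epsilon>) \<le> 1" unfolding e(3) using c(3) Cc(1) by (simp add: field_simps)
    from Cc(2)[OF n less_imp_le[OF e(1)] this A(1,2)] obtain lam where
      lam: "\<And>\<xi>. \<xi> \<in> X \<Longrightarrow> mass \<mu> (A \<xi>) / 2 \<le> lam \<xi> \<and> lam \<xi> \<le> 3 / 2 * mass \<mu> (A \<xi>)"
      and exact: "\<And>f. f \<in> Poly_le n \<Longrightarrow> (LINT x|nu \<mu>. f x) = (\<Sum>\<xi>\<in>X. lam \<xi> * f \<xi>)"
      unfolding cell_weights_def by blast
    have scale: "0 < lam \<xi> \<and> E n \<xi> (lam \<xi>)" if xi: "\<xi> \<in> X" for \<xi>
    proof -
      have nxi: "norm \<xi> \<le> 1" by (rule simplex_center_norm_le[OF part xi])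
      define \<rho> where "\<rho> = rho \<xi>"
      have h: "h0 * \<epsilon> \<le> \<rho>" using center_height[OF part cse(1,2) xi] by (simp add: h0_def \<rho>_def)
      then have rpos: "\<rho> > 0" using h0 e mult_pos_pos[of h0 \<epsilon>] by linarith
      \<comment> \<open>The common scale of all four quantities; it equals
        \<open>\<epsilon>^d * (1 - |\<xi>|^2) powr \<mu>\<close>.\<close>
      define P where "P = \<epsilon> ^ d * \<rho> powr (2 * \<mu>)"
      have P: "P > 0" using e rpos by (simp add: P_def)
      have P_eq: "\<epsilon> ^ CARD('d) * (1 - (norm \<xi>)\<^sup>2) powr \<mu> = P"
      proof -
        have "1 - (norm \<xi>)\<^sup>2 = \<rho> powr 2" using rho_sq[OF nxi] rpos by (simp add: \<rho>_def)
        then show ?thesis by (simp add: P_def d_def powr_powr)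
      qed
      note up = cap_scale(2)[OF mu e(1) _ h0 h] and lo = cap_scale(1)[OF mu e(1) _ h0 h]
      have ge: "\<alpha>1 * P \<ge> \<alpha> * P" "\<alpha>2 * P \<ge> \<alpha> * P" "P \<ge> \<alpha> * P" "\<beta>1 * P \<le> \<beta> * P" "\<beta>2 * P \<le> \<beta> * P" "P \<le> \<beta> * P"
        using P mult_right_mono[of \<alpha> 1 P] mult_right_mono[of 1 \<beta> P] by (auto simp: \<alpha>_def \<beta>_def intro!: mult_right_mono)
      have cap_up: "mass \<mu> (cap \<xi> \<epsilon>) \<le> 2 / 3 * (\<beta>1 * P)"
      proof -
        have "mass \<mu> (cap \<xi> \<epsilon>) \<le> C0 * \<epsilon> ^ d * (\<rho> + 1 * \<epsilon>) powr (2 * \<mu>)"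
          using C0(2)[OF nxi e(1)] by (simp add: d_def \<rho>_def)
        also have "\<dots> \<le> C0 * \<epsilon> ^ d * ((1 + 1 / h0) powr (2 * \<mu>) * \<rho> powr (2 * \<mu>))"
          using C0(1) e by (intro mult_left_mono up) auto
        finally show ?thesis by (simp add: \<beta>1_def P_def mult_ac)
      qed
      have cap_lo: "c0 * \<theta> ^ d * P \<le> mass \<mu> (cap \<xi> (\<theta> * \<epsilon>))" if t: "0 < \<theta>" "\<theta> * \<epsilon> \<le> r0" for \<theta>
      proof -
        have "c0 * (\<theta> * \<epsilon>) ^ d * \<rho> powr (2 * \<mu>) \<le> c0 * (\<theta> * \<epsilon>) ^ d * (\<rho> + \<theta> * \<epsilon>) powr (2 * \<mu>)"
          using c0(1) e t by (intro mult_left_mono lo) auto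
        also have "\<dots> \<le> mass \<mu> (cap \<xi> (\<theta> * \<epsilon>))"
          unfolding d_def \<rho>_def using e t by (intro c0(4)[OF nxi]) auto
        finally show ?thesis by (simp add: P_def power_mult_distrib mult_ac)
      qed
      have Ab: "A \<xi> \<in> sets borel" "A \<xi> \<subseteq> cap \<xi> \<epsilon>" using A(1) xi by (auto simp: subordinate_def)
      have lam_up: "lam \<xi> \<le> \<beta> * P"
      proof -
        have "mass \<mu> (A \<xi>) \<le> mass \<mu> (cap \<xi> \<epsilon>)"
          using Ab by (intro nu.finite_measure_mono) auto
        then have "lam \<xi> \<le> 3 / 2 * (2 / 3 * (\<beta>1 * P))" using lam[OF xi] cap_up by linarith
        then show ?thesis using ge(4) by linarith
      qed
      have lam_lo: "\<alpha> * P \<le> lam \<xi>"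
      proof -
        \<comment> \<open>The closed cap of half the radius lies almost everywhere in the open cap
          that the cell is known to contain.\<close>
        have "c0 * (cs / 4) ^ d * P \<le> mass \<mu> (cap \<xi> (cs / 4 * \<epsilon>))"
          using cs cse by (intro cap_lo) auto
        also have "\<dots> \<le> mass \<mu> (ocap \<xi> (cs * \<epsilon> / 2))"
          using measure_ocap_ge[OF mu, of "cs * \<epsilon> / 2" \<xi>] cse(1) by simp
        also have "\<dots> \<le> mass \<mu> (A \<xi>)"
          using A(3)[OF xi] Ab by (intro nu.finite_measure_mono) auto
        finally have "\<alpha>2 * P \<le> lam \<xi>" using lam[OF xi] by (simp add: \<alpha>2_def)
        then show ?thesis using ge by linarith
      qed
      have db: "dball \<xi> \<epsilon> \<in> sets borel" "dball \<xi> \<epsilon> \<subseteq> cball 0 1"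
        using dball_borel[OF nxi] by (auto simp: dball_def)
      have m_up: "m_weight \<mu> (dball \<xi> \<epsilon>) \<le> \<beta> * P"
      proof -
        have "mass \<mu> (dball \<xi> \<epsilon>) \<le> mass \<mu> (cap \<xi> \<epsilon>)"
          by (intro nu.finite_measure_mono dball_subset_cap[OF nxi]) simp
        also have "\<dots> \<le> 2 / 3 * (\<beta> * P)" using cap_up ge by linarith
        also have "\<dots> \<le> \<beta> * P" using ab P by simp
        finally show ?thesis by (simp add: m_weight_eq[OF db])
      qed
      have m_lo: "\<alpha> * P \<le> m_weight \<mu> (dball \<xi> \<epsilon>)"
      proof -
        have "\<alpha>1 * P \<le> mass \<mu> (cap \<xi> (1 / 2 * \<epsilon>))"
          unfolding \<alpha>1_def using cse by (intro cap_lo) auto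
        also have "\<dots> \<le> mass \<mu> (dball \<xi> \<epsilon>)"
          using db cap_subset_dball[OF nxi, of \<epsilon>] by (intro nu.finite_measure_mono) auto
        finally show ?thesis unfolding m_weight_eq[OF db] using ge(1) by linarith
      qed
      define Q where "Q = (1 / real n) ^ CARD('d) * W_n \<mu> n \<xi>"
      have n_eq: "1 / real n = 1 / c * \<epsilon>" using c(1) by (simp add: eps)
      have Q_eq: "Q = (1 / c) ^ d * \<epsilon> ^ d * (\<rho> + 1 / c * \<epsilon>) powr (2 * \<mu>)"
        unfolding Q_def W_n_rho \<rho>_def d_def n_eq by (simp only: power_mult_distrib)
      have Q_up: "Q \<le> \<beta> * P"
      proof -
        have "Q \<le> (1 / c) ^ d * \<epsilon> ^ d * ((1 + (1 / c) / h0) powr (2 * \<mu>) * \<rho> powr (2 * \<mu>))"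
          unfolding Q_eq using c(1) e by (intro mult_left_mono up) auto
        also have "\<dots> = \<beta>2 * P" by (simp add: \<beta>2_def P_def mult_ac)
        finally show ?thesis using ge by linarith
      qed
      have Q_lo: "\<alpha> * P \<le> Q"
      proof -
        have "1 ^ d \<le> (1 / c) ^ d" using c by (intro power_mono) auto
        then have "1 * P \<le> (1 / c) ^ d * P" using P by (intro mult_right_mono) auto
        also have "\<dots> = (1 / c) ^ d * \<epsilon> ^ d * \<rho> powr (2 * \<mu>)" by (simp add: P_def)
        also have "\<dots> \<le> Q"
          unfolding Q_eq using c(1) e by (intro mult_left_mono lo) auto
        finally show ?thesis using ge by linarith
      qed
      have "0 < lam \<xi>" using lam_lo mult_pos_pos[OF ab(1) P] by linarith
      moreover have "equiv_with (\<alpha> / \<beta>) (\<beta> / \<alpha>) (lam \<xi>) Q"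
        by (rule equiv_with_common_scale[OF ab lam_lo lam_up Q_lo Q_up])
      moreover have "equiv_with (\<alpha> / \<beta>) (\<beta> / \<alpha>) Q P"
        by (rule equiv_with_common_scale[OF ab Q_lo Q_up ge(3) ge(6)])
      moreover have "equiv_with (\<alpha> / \<beta>) (\<beta> / \<alpha>) P (m_weight \<mu> (dball \<xi> \<epsilon>))"
        by (rule equiv_with_common_scale[OF ab ge(3) ge(6) m_lo m_up])
      ultimately show ?thesis unfolding E_def eps[symmetric] P_eq Q_def[symmetric] by blast
    qed
    have "(LINT x:cball 0 1|lborel. f x * W \<mu> x) = (\<Sum>\<xi>\<in>X. lam \<xi> * f \<xi>)" if f: "f \<in> Poly_le n" for f
      using integral_cball_W[OF borel_measurable_continuous_onI[OF continuous_Poly_le[OF f]]] exact[OF f] by simp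
    with scale show ?thesis by (intro exI[of _ lam]) blast
  qed
  have cpi: "c \<le> pi" using c(2) pi_gt3 by linarith
  have pos: "\<alpha> / \<beta> > 0" "\<beta> / \<alpha> > 0" using ab by simp_all
  show ?thesis
    unfolding Let_def
    by (rule exI[of _ c], rule conjI[OF c(1)], rule conjI[OF cpi], rule exI[of _ "\<alpha> / \<beta>"],
        rule conjI[OF pos(1)], rule exI[of _ "\<beta> / \<alpha>"], rule conjI[OF pos(2)], intro allI impI)
       (rule main[unfolded E_def])
qed

end
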